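(* Let $F$ be a germ of holomorphic diffeomorphism of $\mathbb{C}^n$ fixing the origin $0$, with diagonal differential $dF_0=\mathrm{diag}(\lambda_1,\ldots,\lambda_n)$, and let $1\le m\le n$. Suppose that $F$ is one-resonant, non-degenerate and parabolically attracting with respect to $\{\lambda_1,\ldots,\lambda_m\}$, and that $|\lambda_j|<1$ for all $j>m$. Let $k\in\mathbb{N}$ be the order of $F$ with respect to $\{\lambda_1,\ldots,\lambda_m\}$. Then $F$ has $k$ (pairwise) disjoint basins of attraction having $0$ on the boundary.
   Context: Notation: $\mathbb{N}=\{0,1,2,\ldots\}$. For $l=(l_1,\ldots,l_n)\in\mathbb{N}^n$ put $|l|=\sum l_j$, $z^l=z_1^{l_1}\cdots z_n^{l_n}$, $\lambda^l=\lambda_1^{l_1}\cdots\lambda_n^{l_n}$; $e_j$ is the $j$-th unit vector. $F^{\circ p}$ denotes the $p$-th iterate of $F$. Resonance: a pair $(j,l)$ with $j\in\{1,\ldots,n\}$, $l\in\mathbb{N}^n$, $|l|\ge 2$ and $\lambda_j=\lambda^l$. One-resonant: $F$ is one-resonant with respect to the first $m$ eigenvalues $\{\lambda_1,\ldots,\lambda_m\}$ if there is a fixed multi-index $\alpha=(\alpha_1,\ldots,\alpha_m,0,\ldots,0)\in\mathbb{N}^n$, $\alpha\neq 0$ (the index of resonance), such that the resonances $(j,l)$ with $j\in\{1,\ldots,m\}$ are precisely the pairs $(j,k\alpha+e_j)$ with $j\in\{1,\ldots,m\}$ and $k\ge 1$ an arbitrary integer. Order and non-degeneracy: let $F$ be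 one-resonant with respect to $\{\lambda_1,\ldots,\lambda_m\}$ with index of resonance $\alpha$. Unless $F$ is formally linearizable in the first $m$ components (i.e. formally conjugate to a map whose first $m$ components are $\lambda_jz_j$), one can choose holomorphic coordinates at $0$ in which $$F_j(z)=\lambda_jz_j+a_jz^{k\alpha}z_j+O(|z|^{|\alpha|k+2}),\quad j=1,\ldots,m,$$ with $k\ge1$ an integer and $a=(a_1,\ldots,a_m)\ne0$. The integer $k$ does not depend on such a choice and is called the order of $F$ with respect to $\{\lambda_1,\ldots,\lambda_m\}$; the vector $a$ is unique up to multiplication by a nonzero scalar. Put $$\Lambda=\Lambda(F)=\sum_{j=1}^m\frac{a_j\alpha_j}{\lambda_j}.$$ $F$ is non-degenerate with respect to $\{\lambda_1,\ldots,\lambda_m\}$ if it admits such a form and $\Lambda\neq0$ (this is independent of the coordinates). Parabolically attracting: a one-resonant non-degenerate $F$ is parabolically attracting with respect to $\{\lambda_1,\ldots,\lambda_m\}$ if, in holomorphic coordinates at $0$ in which $F_j(z)=\lambda_jz_j+a_jz^{k\alpha}z_j+O(|z|^{|\alpha|k+2})$ for $j=1,\ldots,m$, with $k\ge1$ the order of $F$, $a=(a_1,\ldots,a_m)\neq0$ and $\Lambda=\sum_{j=1}^m a_j\alpha_j\lambda_j^{-1}$, one has $|\lambda_j|=1$ and $\mathrm{Re}\,(a_j\lambda_j^{-1}\Lambda^{-1})>0$ for all $j=1,\ldots,m$ (also independent of the coordinates). Basin of attraction: a basin of attraction for $F$ at $0$ is a nonempty (not necessarily connected) open set $U\subset\mathbb{C}^n$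 with $0\in\overline U$ for which there exists a neighborhood basis $\{\Omega_i\}$ of $0$ such that $F(U\cap\Omega_i)\subset U\cap\Omega_i$ for all $i$, and $F^{\circ p}(z)\to0$ as $p\to\infty$ whenever $z\in U\cap\Omega_i$ for some $i$. *)

theory Defs
  imports "HOL-Analysis.Analysis" "HOL-Library.Landau_Symbols"
begin

text \<open>
  Points of \<open>\<complex>\<^sup>n\<close> are vectors of type \<open>complex ^ 'n\<close> and multi-indices are vectors of type
  \<open>nat ^ 'n\<close>.  A germ at 0 is represented by a total function; its values matter only near 0.
  Every definition below is unaffected by changing the function away from 0.
\<close>

section \<open>Holomorphic germs\<close>

text \<open>Frechet differentiable with a complex-linear derivative at every point.\<close>

definition holomorphic_map_on :: "(complex ^ 'n \<Rightarrow> complex ^ 'n) \<Rightarrow> (complex ^ 'n) set \<Rightarrow> bool"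
  where "holomorphic_map_on F U \<longleftrightarrow>
    open U \<and> (\<forall>z\<in>U. \<exists>A :: complex ^ 'n ^ 'n. (F has_derivative (\<lambda>v. A *v v)) (at z))"

definition biholomorphic_germs ::
    "(complex ^ 'n \<Rightarrow> complex ^ 'n) \<Rightarrow> (complex ^ 'n \<Rightarrow> complex ^ 'n) \<Rightarrow> bool"
  where "biholomorphic_germs F G \<longleftrightarrow> F 0 = 0 \<and>
    (\<exists>U V. 0 \<in> U \<and> holomorphic_map_on F U \<and> holomorphic_map_on G V \<and> homeomorphism U V F G)"

definition holomorphic_diffeo_germ :: "(complex ^ 'n \<Rightarrow> complex ^ 'n) \<Rightarrow> bool"
  where "holomorphic_diffeo_germ F \<longleftrightarrow> (\<exists>G. biholomorphic_germs F G)"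

section \<open>Resonances\<close>

definition mi_deg :: "nat ^ 'n \<Rightarrow> nat"
  where "mi_deg l = (\<Sum>i\<in>UNIV. l $ i)"

definition mi_pow :: "complex ^ 'n \<Rightarrow> nat ^ 'n \<Rightarrow> complex"
  where "mi_pow z l = (\<Prod>i\<in>UNIV. (z $ i) ^ (l $ i))"

definition resonance :: "complex ^ 'n \<Rightarrow> 'n \<Rightarrow> nat ^ 'n \<Rightarrow> bool"
  where "resonance lam j l \<longleftrightarrow> mi_deg l \<ge> 2 \<and> lam $ j = mi_pow lam l"

text \<open>The first \<open>m\<close> coordinate indices, in the given order of the index type.\<close>

definition first_indices :: "nat \<Rightarrow> ('n :: {finite, linorder}) set"
  where "first_indices m = {j. card {i. i < j} < m}"

text \<open>
  One-resonance with respect to the eigenvalues with index in \<open>M\<close>, with index of resonance \<open>\<alpha>\<close>.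
  For nonempty \<open>M\<close> there is at most one such \<open>\<alpha>\<close>.
\<close>

definition one_resonant :: "complex ^ 'n \<Rightarrow> 'n set \<Rightarrow> nat ^ 'n \<Rightarrow> bool"
  where "one_resonant lam M \<alpha> \<longleftrightarrow>
    \<alpha> \<noteq> 0 \<and> (\<forall>j. j \<notin> M \<longrightarrow> \<alpha> $ j = 0) \<and>
    {(j, l). j \<in> M \<and> resonance lam j l} =
      {(j, k *s \<alpha> + axis j 1) | j k. j \<in> M \<and> k \<ge> 1}"

section \<open>Order, non-degeneracy and parabolic attraction\<close>

text \<open>
  In the holomorphic coordinates \<open>w = \<phi> z\<close> at 0, with inverse \<open>\<psi>\<close>, the germ \<open>F\<close> is
  \<open>\<phi> \<circ> F \<circ> \<psi>\<close>.  Only the components of \<open>a\<close> with index in \<open>M\<close> are meaningful.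
\<close>

definition has_leading_form ::
    "(complex ^ 'n \<Rightarrow> complex ^ 'n) \<Rightarrow> complex ^ 'n \<Rightarrow> 'n set \<Rightarrow> nat ^ 'n \<Rightarrow> nat \<Rightarrow> complex ^ 'n \<Rightarrow> bool"
  where "has_leading_form F lam M \<alpha> k a \<longleftrightarrow>
    k \<ge> 1 \<and> (\<exists>j\<in>M. a $ j \<noteq> 0) \<and>
    (\<exists>\<phi> \<psi>. biholomorphic_germs \<phi> \<psi> \<and>
      (\<forall>j\<in>M. (\<lambda>w. \<phi> (F (\<psi> w)) $ j
                 - (lam $ j * w $ j + a $ j * mi_pow w (k *s \<alpha>) * w $ j))
              \<in> O[nhds 0](\<lambda>w. of_real (norm w ^ (mi_deg \<alpha> * k + 2)))))"

text \<open>
  For a one-resonant germ \<open>F\<close> whose differential at 0 is diagonal with entries \<open>lam\<close>, at most one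
  \<open>k\<close> admits such a form, and none does if \<open>F\<close> is formally linearizable in the components in \<open>M\<close>.
  In the latter case the value is unspecified.  The two predicates below assert a leading form at
  this value, so they do not rest on an unspecified order.
\<close>

definition res_order ::
    "(complex ^ 'n \<Rightarrow> complex ^ 'n) \<Rightarrow> complex ^ 'n \<Rightarrow> 'n set \<Rightarrow> nat ^ 'n \<Rightarrow> nat"
  where "res_order F lam M \<alpha> = (THE k. \<exists>a. has_leading_form F lam M \<alpha> k a)"

definition Lambda_coeff :: "complex ^ 'n \<Rightarrow> 'n set \<Rightarrow> nat ^ 'n \<Rightarrow> complex ^ 'n \<Rightarrow> complex"
  where "Lambda_coeff lam M \<alpha> a = (\<Sum>j\<in>M. a $ j * of_nat (\<alpha> $ j) / lam $ j)"

definition nondegenerate ::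
    "(complex ^ 'n \<Rightarrow> complex ^ 'n) \<Rightarrow> complex ^ 'n \<Rightarrow> 'n set \<Rightarrow> nat ^ 'n \<Rightarrow> bool"
  where "nondegenerate F lam M \<alpha> \<longleftrightarrow>
    (\<exists>a. has_leading_form F lam M \<alpha> (res_order F lam M \<alpha>) a \<and> Lambda_coeff lam M \<alpha> a \<noteq> 0)"

definition parabolically_attracting ::
    "(complex ^ 'n \<Rightarrow> complex ^ 'n) \<Rightarrow> complex ^ 'n \<Rightarrow> 'n set \<Rightarrow> nat ^ 'n \<Rightarrow> bool"
  where "parabolically_attracting F lam M \<alpha> \<longleftrightarrow>
    (\<exists>a. has_leading_form F lam M \<alpha> (res_order F lam M \<alpha>) a \<and>
      (\<forall>j\<in>M. norm (lam $ j) = 1 \<and>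
        Re (a $ j * inverse (lam $ j) * inverse (Lambda_coeff lam M \<alpha> a)) > 0))"

section \<open>Basins of attraction\<close>

text \<open>Neighbourhoods are not required to be open.\<close>

definition nhd_basis_at_0 :: "(complex ^ 'n) set set \<Rightarrow> bool"
  where "nhd_basis_at_0 B \<longleftrightarrow>
    (\<forall>\<Omega>\<in>B. 0 \<in> interior \<Omega>) \<and> (\<forall>W. open W \<and> 0 \<in> W \<longrightarrow> (\<exists>\<Omega>\<in>B. \<Omega> \<subseteq> W))"

definition basin_of_attraction :: "(complex ^ 'n \<Rightarrow> complex ^ 'n) \<Rightarrow> (complex ^ 'n) set \<Rightarrow> bool"
  where "basin_of_attraction F U \<longleftrightarrow>
    open U \<and> U \<noteq> {} \<and> 0 \<in> closure U \<and>
    (\<exists>B. nhd_basis_at_0 B \<and>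
      (\<forall>\<Omega>\<in>B. F ` (U \<inter> \<Omega>) \<subseteq> U \<inter> \<Omega> \<and> (\<forall>z\<in>U \<inter> \<Omega>. (\<lambda>p. (F ^^ p) z) \<longlonglongrightarrow> 0)))"

end

theory Submission
  imports Defs "HOL-Complex_Analysis.Conformal_Mappings"
begin

text \<open>
  A Poincare-Dulac normalization, carried out only in the components with index in \<open>M\<close> and up to a
  high finite order \<open>d\<close>, yields functions \<open>x\<^sub>j\<close> with
  \<open>x\<^sub>j \<circ> F = x\<^sub>j (\<lambda>\<^sub>j + a\<^sub>j u\<^sup>k + O(u\<^bsup>k+1\<^esup>)) + O(\<bar>z\<bar>\<^sup>d)\<close>, where \<open>u = x\<^sup>\<alpha>\<close>; for the remaining indices \<open>x\<^sub>j = z\<^sub>j\<close>.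
  Since \<open>\<lambda>\<^sup>\<alpha> = 1\<close>, the Fatou coordinate \<open>V = - 1 / (k \<Lambda> u\<^sup>k)\<close> satisfies \<open>V \<circ> F = V + 1 + o(1)\<close> on
  \<open>Re V > R, \<bar>Im V\<bar> < \<epsilon> Re V, \<bar>x\<^sub>j\<bar> < (Re V)\<^bsup>-b\<^esup>\<close>.  There \<open>x\<^sub>j \<circ> F\<close> is about
  \<open>\<lambda>\<^sub>j x\<^sub>j (1 - p\<^sub>j / (k V))\<close> with \<open>p\<^sub>j = a\<^sub>j / (\<lambda>\<^sub>j \<Lambda>)\<close>; as \<open>Re p\<^sub>j > 0\<close>, for small \<open>b\<close> this decay is faster
  than that of \<open>(Re V)\<^bsup>-b\<^esup>\<close>, and the region is invariant.  It splits into \<open>k\<close> pieces according to the value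
  of \<open>u V\<^bsup>1/k\<^esup>\<close>, a \<open>k\<close>-th root of \<open>- 1 / (k \<Lambda>)\<close>.
\<close>

section \<open>Polynomial functions\<close>

text \<open>The remainder of order \<open>mi_deg \<alpha> * k + 2\<close> in the given coordinates
  is too weak: with \<open>t = Re V\<close>, a petal only gives \<open>|z| = O(t powr (-b))\<close>,
  and for the small \<open>b\<close> chosen at the end \<open>b * (mi_deg \<alpha> * k + 2)\<close>
  stays below 1, while relative errors must be \<open>o(1/t)\<close>. Hence \<open>d\<close> is
  raised until \<open>b * d \<ge> 3\<close>. The exponent 3 pays for a relative error of size
  \<open>t powr (-1/k) / t\<close> after division by a coordinate that is only known to be at least
  \<open>|u|\<close>, of size \<open>t powr (-1/k)\<close>. Only finitely many divisors
  \<open>\<lambda>_j - \<lambda>^l\<close> occur, so no small divisor problem arises. Outside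
  \<open>M\<close> nothing is normalized: resonances there are uncontrolled, but a geometric
  contraction always beats a barrier with polynomial decay. The barrier must leave room for
  \<open>|u| ~ t powr (-1/k)\<close>, which needs \<open>b * k * mi_deg \<alpha> < 1\<close>. The
  definition of \<open>\<Lambda>\<close> gives \<open>\<Sum> \<alpha>_j p_j = 1\<close>, so this
  follows from the smallness of \<open>b\<close> against the numbers \<open>Re p_j\<close>.\<close>

lemma norm_scaleC_vec: "norm (c *s (v :: complex ^ 'n)) = norm c * norm v"
  by (simp add: norm_vec_def L2_set_def norm_mult power_mult_distrib real_sqrt_mult
      flip: sum_distrib_left)

lemma mi_deg_add_axis: "mi_deg (l + axis i 1) = Suc (mi_deg l)"
  by (simp add: mi_deg_def sum.distrib axis_def)

lemma mi_pow_add: "mi_pow z (l + l') = mi_pow z l * mi_pow z l'"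
  by (simp add: mi_pow_def power_add prod.distrib)

lemma mi_pow_axis: "mi_pow z (axis i 1) = z $ i"
  by (simp add: mi_pow_def axis_def if_distrib [of "(^) _"] cong: if_cong)

lemma mi_pow_scalar: "mi_pow z (k *s l) = mi_pow z l ^ k"
  by (simp add: mi_pow_def mult.commute [of k] power_mult prod_power_distrib)

lemma mi_deg_scalar: "mi_deg (k *s l) = k * mi_deg l"
  by (simp add: mi_deg_def sum_distrib_left)

lemma mi_pow_scaleC: "mi_pow (t *s z) l = t ^ mi_deg l * mi_pow z l"
  by (simp add: mi_pow_def mi_deg_def power_mult_distrib prod.distrib power_sum)

definition polynomial_fun :: "(complex ^ 'n \<Rightarrow> complex) \<Rightarrow> bool"
  where "polynomial_fun f \<longleftrightarrow> (\<exists>L c. finite L \<and> f = (\<lambda>z. \<Sum>l\<in>L. c l * mi_pow z l))"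

lemma polynomial_fun_const: "polynomial_fun (\<lambda>z. a)"
  unfolding polynomial_fun_def
  by (rule exI [of _ "{0}"], rule exI [of _ "\<lambda>_. a"]) (simp add: mi_pow_def)

lemma polynomial_fun_add:
  assumes "polynomial_fun f" "polynomial_fun g"
  shows "polynomial_fun (\<lambda>z. f z + g z)"
proof -
  obtain L c L' c' where L: "finite L" "f = (\<lambda>z. \<Sum>l\<in>L. c l * mi_pow z l)"
    and L': "finite L'" "g = (\<lambda>z. \<Sum>l\<in>L'. c' l * mi_pow z l)"
    using assms by (auto simp: polynomial_fun_def)
  have f: "f z = (\<Sum>l\<in>L\<union>L'. (if l \<in> L then c l else 0) * mi_pow z l)" for z
    unfolding L(2) by (rule sum.mono_neutral_cong_left) (use L(1) L'(1) in auto)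
  have g: "g z = (\<Sum>l\<in>L\<union>L'. (if l \<in> L' then c' l else 0) * mi_pow z l)" for z
    unfolding L'(2) by (rule sum.mono_neutral_cong_left) (use L(1) L'(1) in auto)
  have "f z + g z =
      (\<Sum>l\<in>L\<union>L'. ((if l \<in> L then c l else 0) + (if l \<in> L' then c' l else 0)) * mi_pow z l)" for z
    unfolding f g by (simp add: sum.distrib distrib_right)
  then show ?thesis
    unfolding polynomial_fun_def using L(1) L'(1)
    by (intro exI [of _ "L \<union> L'"]
        exI [of _ "\<lambda>l. (if l \<in> L then c l else 0) + (if l \<in> L' then c' l else 0)"]) simp
qed

lemma polynomial_fun_cmult:
  assumes "polynomial_fun f"
  shows "polynomial_fun (\<lambda>z. a * f z)"
proof -
  obtain L c where L: "finite L" "f = (\<lambda>z. \<Sum>l\<in>L. c l * mi_pow z l)"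
    using assms by (auto simp: polynomial_fun_def)
  have "(\<lambda>z. a * f z) = (\<lambda>z. \<Sum>l\<in>L. (a * c l) * mi_pow z l)"
    by (simp add: L(2) sum_distrib_left mult.assoc)
  then show ?thesis
    unfolding polynomial_fun_def
    by (intro exI [of _ L] exI [of _ "\<lambda>l. a * c l"]) (simp add: L(1))
qed

lemma polynomial_fun_coord_mult:
  assumes "polynomial_fun f"
  shows "polynomial_fun (\<lambda>z. z $ i * f z)"
proof -
  obtain L c where L: "finite L" "f = (\<lambda>z. \<Sum>l\<in>L. c l * mi_pow z l)"
    using assms by (auto simp: polynomial_fun_def)
  have "z $ i * f z = (\<Sum>l\<in>(\<lambda>l. l + axis i 1) ` L. c (l - axis i 1) * mi_pow z l)" for z
    by (subst sum.reindex)
      (auto simp: L(2) inj_on_def sum_distrib_left mi_pow_add mi_pow_axis[simplified] ac_simps)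
  then show ?thesis
    unfolding polynomial_fun_def using L(1)
    by (intro exI [of _ "(\<lambda>l. l + axis i 1) ` L"] exI [of _ "\<lambda>l. c (l - axis i 1)"])
      (auto simp: fun_eq_iff)
qed

lemma polynomial_fun_poly_mult:
  assumes "polynomial_fun f"
  shows "polynomial_fun (\<lambda>z. poly p (z $ i) * f z)"
proof (induction p)
  case 0
  then show ?case by (simp add: polynomial_fun_const)
next
  case (pCons a p)
  have "polynomial_fun (\<lambda>z. a * f z + z $ i * (poly p (z $ i) * f z))"
    by (intro polynomial_fun_add polynomial_fun_cmult polynomial_fun_coord_mult assms pCons)
  then show ?case by (simp add: algebra_simps)
qed

lemma polynomial_fun_sum:
  assumes "finite S" "\<And>s. s \<in> S \<Longrightarrow> polynomial_fun (f s)"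
  shows "polynomial_fun (\<lambda>z. \<Sum>s\<in>S. f s z)"
  using assms by (induction S) (auto intro: polynomial_fun_const polynomial_fun_add)

section \<open>Lagrange interpolation and separately polynomial functions\<close>

lemma Lagrange_basis:
  obtains Lb :: "nat \<Rightarrow> complex poly"
  where "\<And>p t. degree p \<le> d \<Longrightarrow> poly p t = (\<Sum>s\<le>d. poly (Lb s) t * poly p (of_nat s))"
proof -
  define Lb :: "nat \<Rightarrow> complex poly" where "Lb s = smult (inverse (\<Prod>r\<in>{..d}-{s}. of_nat s - of_nat r))
      (\<Prod>r\<in>{..d}-{s}. [:- of_nat r, 1:])" for s
  have deg: "degree (Lb s) \<le> d" if "s \<le> d" for s
  proof -
    have "degree (\<Prod>r\<in>{..d}-{s}. [:- of_nat r, 1:] :: complex poly) \<le> (\<Sum>r\<in>{..d}-{s}. 1)"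
      by (rule order_trans [OF degree_prod_sum_le]) auto
    also have "\<dots> = d" using that by (simp add: card_Diff_singleton)
    finally show ?thesis unfolding Lb_def by simp
  qed
  have delta: "poly (Lb s) (of_nat q) = (if q = s then 1 else 0)" if "s \<le> d" "q \<le> d" for s q
  proof (cases "q = s")
    case True
    have "(\<Prod>r\<in>{..d}-{s}. of_nat s - of_nat r :: complex) \<noteq> 0" by auto
    then show ?thesis using True by (simp add: Lb_def poly_prod)
  next
    case False
    then show ?thesis using that by (auto simp: Lb_def poly_prod prod_zero_iff)
  qed
  have "poly p t = (\<Sum>s\<le>d. poly (Lb s) t * poly p (of_nat s))" if "degree p \<le> d" for p t
  proof -
    define q where "q = (\<Sum>s\<le>d. smult (poly p (of_nat s)) (Lb s))"
    have dq: "degree q \<le> d"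
      unfolding q_def by (rule degree_sum_le) (auto intro: order_trans [OF degree_smult_le] deg)
    have "p = q"
    proof (rule poly_eqI_degree)
      show "poly p x = poly q x" if "x \<in> of_nat ` {..d}" for x
        using that by (auto simp: q_def poly_sum delta if_distrib cong: if_cong)
      show "card (of_nat ` {..d} :: complex set) > degree p"
        using that by (simp add: card_image)
      show "card (of_nat ` {..d} :: complex set) > degree q"
        using dq by (simp add: card_image)
    qed
    then have "poly p t = poly q t" by simp
    also have "\<dots> = (\<Sum>s\<le>d. poly (Lb s) t * poly p (of_nat s))"
      by (simp add: q_def poly_sum mult.commute)
    finally show ?thesis .
  qed
  then show ?thesis by (rule that)
qed

text \<open>With a degree bound common to all lines, interpolation in \<open>z $ i\<close> expresses
  \<open>f\<close> through the functions obtained by freezing \<open>z $ i\<close> at the nodes, so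
  the variables can be eliminated one at a time.\<close>

lemma separately_polynomial:
  fixes f :: "complex ^ 'n \<Rightarrow> complex"
  assumes "\<And>z i. \<exists>p. degree p \<le> d \<and> (\<forall>t. f (\<chi> j. if j = i then t else z $ j) = poly p t)"
  shows "polynomial_fun f"
proof -
  obtain Lb :: "nat \<Rightarrow> complex poly" where
    Lb: "\<And>p t. degree p \<le> d \<Longrightarrow> poly p t = (\<Sum>s\<le>d. poly (Lb s) t * poly p (of_nat s))"
    using Lagrange_basis by blast
  \<comment> \<open>Induction on a set \<open>S\<close> of coordinates that determine
    \<open>f\<close>; freezing the coordinate \<open>i\<close> at a node removes it from the set and
    preserves the degree bound.\<close>
  have "finite S \<Longrightarrow> \<forall>z. f z = f (\<chi> i. if i \<in> S then z $ i else 0) \<Longrightarrow>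
     \<forall>z i. \<exists>p. degree p \<le> d \<and> (\<forall>t. f (\<chi> j. if j = i then t else z $ j) = poly p t) \<Longrightarrow>
     polynomial_fun f" for S :: "'n set" and f
  proof (induction S arbitrary: f rule: finite_induct)
    case empty
    then have "f = (\<lambda>z. f (\<chi> i. 0))" by auto
    then show ?case by (rule ssubst) (rule polynomial_fun_const)
  next
    case (insert i S)
    have "polynomial_fun (\<lambda>z. f (\<chi> j. if j = i then of_nat s else z $ j))" for s
    proof (rule insert.IH)
      have "f (\<chi> j. if j = i then of_nat s else z $ j) =
            f (\<chi> j. if j = i then of_nat s else if j \<in> S then z $ j else 0)" for z
        by (subst insert.prems(1) [rule_format])
           (rule arg_cong [where f = f], auto simp: vec_eq_iff)
      then show "\<forall>z. f (\<chi> j. if j = i then of_nat s else z $ j) =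
          f (\<chi> j. if j = i then of_nat s else (\<chi> i. if i \<in> S then z $ i else 0) $ j)"
        by (simp cong: if_cong)
      show "\<forall>z i'. \<exists>p. degree p \<le> d \<and> (\<forall>t. f (\<chi> j. if j = i then of_nat s else
          (\<chi> j. if j = i' then t else z $ j) $ j) = poly p t)"
      proof (intro allI)
        fix z i'
        show "\<exists>p. degree p \<le> d \<and> (\<forall>t. f (\<chi> j. if j = i then of_nat s else
          (\<chi> j. if j = i' then t else z $ j) $ j) = poly p t)"
        proof (cases "i' = i")
          case True
          have "f (\<chi> j. if j = i then of_nat s else (\<chi> j. if j = i then t else z $ j) $ j)
              = f (\<chi> j. if j = i then of_nat s else z $ j)" for t
            by (rule arg_cong [where f = f]) (auto simp: vec_eq_iff)
          then show ?thesis
            unfolding True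
            by (intro exI [of _ "[:f (\<chi> j. if j = i then of_nat s else z $ j):]"]) simp
        next
          case False
          have "f (\<chi> j. if j = i then of_nat s else (\<chi> j. if j = i' then t else z $ j) $ j)
              = f (\<chi> j. if j = i' then t else (\<chi> j. if j = i then of_nat s else z $ j) $ j)" for t
            by (rule arg_cong [where f = f]) (use False in \<open>auto simp: vec_eq_iff\<close>)
          then show ?thesis using insert.prems(2) by simp
        qed
      qed
    qed
    then have "polynomial_fun (\<lambda>z. \<Sum>s\<le>d. poly (Lb s) (z $ i) *
        f (\<chi> j. if j = i then of_nat s else z $ j))"
      by (intro polynomial_fun_sum polynomial_fun_poly_mult) auto
    moreover have "(\<Sum>s\<le>d. poly (Lb s) (z $ i) *
        f (\<chi> j. if j = i then of_nat s else z $ j)) = f z" for z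
    proof -
      obtain p where p: "degree p \<le> d" "\<And>t. f (\<chi> j. if j = i then t else z $ j) = poly p t"
        using insert.prems(2) by meson
      have "f z = f (\<chi> j. if j = i then z $ i else z $ j)"
        by (rule arg_cong [where f = f]) (auto simp: vec_eq_iff)
      also have "\<dots> = (\<Sum>s\<le>d. poly (Lb s) (z $ i) * poly p (of_nat s))"
        unfolding p(2) by (rule Lb [OF p(1)])
      finally show ?thesis by (simp add: p(2))
    qed
    ultimately show ?case by simp
  qed
  from this [of UNIV] show ?thesis using assms by auto
qed

section \<open>Leading terms of holomorphic germs\<close>

text \<open>The filter \<open>nhds 0\<close> includes the origin itself, so for positive
  \<open>d\<close> membership forces the value 0 there.\<close>

definition ord_germs :: "nat \<Rightarrow> ('a :: real_normed_vector \<Rightarrow> complex) set"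
  where "ord_germs d = O[nhds 0](\<lambda>z. of_real (norm z ^ d))"

lemma ord_germs_iff:
  "f \<in> ord_germs d \<longleftrightarrow> (\<exists>C>0. \<exists>r>0. \<forall>z. norm z < r \<longrightarrow> norm (f z) \<le> C * norm z ^ d)"
  by (simp add: ord_germs_def bigo_def eventually_nhds_metric norm_power)

lemma ord_germs_mono:
  assumes "f \<in> ord_germs e" "d \<le> e"
  shows "f \<in> ord_germs d"
proof -
  obtain C r where C: "C > 0" "r > 0" "\<And>z. norm z < r \<Longrightarrow> norm (f z) \<le> C * norm z ^ e"
    using assms(1) by (auto simp: ord_germs_iff)
  have "norm (f z) \<le> C * norm z ^ d" if "norm z < min r 1" for z
  proof -
    have "norm (f z) \<le> C * norm z ^ e" using C(3) that by simp
    also have "\<dots> \<le> C * norm z ^ d"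
      using that C(1) assms(2) by (intro mult_left_mono power_decreasing) auto
    finally show ?thesis .
  qed
  moreover have "min r 1 > 0" using C by simp
  ultimately show ?thesis unfolding ord_germs_iff using C(1) by blast
qed

lemma ord_germs_mult:
  "f \<in> ord_germs d \<Longrightarrow> g \<in> ord_germs e \<Longrightarrow> (\<lambda>z. f z * g z) \<in> ord_germs (d + e)"
  using landau_o.big.mult [of f "nhds 0" _ g] by (simp add: ord_germs_def power_add)

lemma ord_germs_add: "f \<in> ord_germs d \<Longrightarrow> g \<in> ord_germs d \<Longrightarrow> (\<lambda>z. f z + g z) \<in> ord_germs d"
  unfolding ord_germs_def by (rule sum_in_bigo)

lemma ord_germs_diff: "f \<in> ord_germs d \<Longrightarrow> g \<in> ord_germs d \<Longrightarrow> (\<lambda>z. f z - g z) \<in> ord_germs d"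
  unfolding ord_germs_def by (rule sum_in_bigo)

lemma ord_germs_sum:
  "(\<And>i. i \<in> S \<Longrightarrow> f i \<in> ord_germs d) \<Longrightarrow> (\<lambda>z. \<Sum>i\<in>S. f i z) \<in> ord_germs d"
  unfolding ord_germs_def by (rule big_sum_in_bigo)

lemma ord_germs_cmult: "f \<in> ord_germs d \<Longrightarrow> (\<lambda>z. c * f z) \<in> ord_germs d"
  unfolding ord_germs_def by (cases "c = 0") auto

lemma ord_germs_compose:
  assumes "f \<in> ord_germs d" and F: "(\<lambda>z. of_real (norm (F z))) \<in> ord_germs 1"
  shows "(\<lambda>z. f (F z)) \<in> ord_germs d"
proof -
  obtain C r where C: "C > 0" "r > 0" "\<And>z. norm z < r \<Longrightarrow> norm (f z) \<le> C * norm z ^ d"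
    using assms(1) by (auto simp: ord_germs_iff)
  obtain K s where K: "K > 0" "s > 0" "\<And>z. norm z < s \<Longrightarrow> norm (F z) \<le> K * norm z"
    using F by (auto simp: ord_germs_iff)
  have "norm (f (F z)) \<le> C * K ^ d * norm z ^ d" if "norm z < min s (r / K)" for z
  proof -
    have 1: "norm (F z) \<le> K * norm z" using K that by simp
    also have "\<dots> < r" using that K by (simp add: field_simps)
    finally have "norm (f (F z)) \<le> C * norm (F z) ^ d" using C by simp
    also have "\<dots> \<le> C * (K * norm z) ^ d"
      using 1 C(1) by (intro mult_left_mono power_mono) auto
    finally show ?thesis by (simp add: power_mult_distrib mult.assoc)
  qed
  moreover have "C * K ^ d > 0" "min s (r / K) > 0" using C K by auto
  ultimately show ?thesis unfolding ord_germs_iff by blast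
qed

text \<open>The quotient \<open>g t / t ^ d\<close> extends holomorphically over 0, and the Schwarz
  lemma makes the extension Lipschitz at 0. The resulting constant depends only on \<open>C\<close>
  and \<open>r\<close>, which is what makes the estimate uniform over all complex lines.\<close>

lemma one_variable_leading_term:
  fixes g :: "complex \<Rightarrow> complex"
  assumes r: "0 < r" and C: "0 < C" and holg: "g holomorphic_on ball 0 r"
    and bound: "\<And>t. norm t < r \<Longrightarrow> norm (g t) \<le> C * norm t ^ d"
  shows "\<exists>p. \<forall>t. norm t < r \<longrightarrow> norm (g t - p * t ^ d) \<le> 3 * C / r * norm t ^ (d + 1)"
proof -
  have "(\<lambda>t. g t / t ^ d) holomorphic_on ball 0 r - {0}"
    by (intro holomorphic_intros holomorphic_on_subset [OF holg]) auto
  moreover have quot: "norm (g t / t ^ d) \<le> C" if "norm t < r" "t \<noteq> 0" for t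
    using bound [OF that(1)] that(2) by (simp add: norm_divide norm_power divide_le_eq)
  then have "eventually (\<lambda>t. norm (g t / t ^ d) \<le> C) (at 0)"
    unfolding eventually_at using r by (auto intro!: exI [of _ r])
  ultimately obtain H where holH: "H holomorphic_on ball 0 r"
    and H: "\<And>t. t \<in> ball 0 r - {0} \<Longrightarrow> H t = g t / t ^ d"
    using holomorphic_on_extend_bounded [of "\<lambda>t. g t / t ^ d" "ball 0 r" 0] r by auto
  have "isCont H 0"
    using holH r by (auto simp: continuous_on_eq_continuous_at dest!: holomorphic_on_imp_continuous_on)
  then have "((\<lambda>t. norm (H t)) \<longlongrightarrow> norm (H 0)) (at 0)"
    by (simp add: isCont_def tendsto_norm)
  moreover have "eventually (\<lambda>t. norm (H t) \<le> C) (at 0)"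
    unfolding eventually_at using r H quot by (auto intro!: exI [of _ r])
  ultimately have H0: "norm (H 0) \<le> C"
    by (rule tendsto_upperbound) simp
  have HC: "norm (H t) \<le> C" if "norm t < r" for t
    using H0 H [of t] quot [of t] that by (cases "t = 0") auto
  \<comment> \<open>The difference has norm at most \<open>2 * C\<close>; dividing by
    \<open>3 * C\<close> yields the strict bound required by the Schwarz lemma.\<close>
  define f where "f s = (H (of_real r * s) - H 0) / of_real (3 * C)" for s
  have "(\<lambda>s. H (of_real r * s)) holomorphic_on ball 0 1"
    using r by (intro holomorphic_on_compose_gen [OF _ holH, unfolded o_def] holomorphic_intros)
      (auto simp: norm_mult)
  then have holf: "f holomorphic_on ball 0 1"
    unfolding f_def using C by (intro holomorphic_intros) auto
  have f_less: "norm (f s) < 1" if "norm s < 1" for s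
  proof -
    have "norm (H (of_real r * s)) \<le> C" using that r by (intro HC) (simp add: norm_mult)
    then have "norm (H (of_real r * s) - H 0) < 3 * C"
      using norm_triangle_ineq4 [of "H (of_real r * s)" "H 0"] H0 C by linarith
    then show ?thesis using C by (simp add: f_def norm_divide divide_less_eq norm_mult)
  qed
  have HL: "norm (H t - H 0) \<le> 3 * C / r * norm t" if "norm t < r" for t
  proof -
    have "norm (f (t / of_real r)) \<le> norm (t / of_real r)"
      by (rule Schwarz_Lemma(1) [OF holf _ f_less]) (use that r in \<open>auto simp: f_def norm_divide\<close>)
    then show ?thesis using r C by (simp add: f_def norm_divide field_simps norm_mult)
  qed
  have "norm (g t - H 0 * t ^ d) \<le> 3 * C / r * norm t ^ (d + 1)" if "norm t < r" for t
  proof (cases "t = 0")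
    case True
    \<comment> \<open>For positive \<open>d\<close> the bound forces \<open>g 0 = 0\<close>. For
      \<open>d = 0\<close> both sides are the limit of the same function, by continuity of
      \<open>g\<close> and \<open>H\<close>.\<close>
    have "g 0 = H 0 * 0 ^ d"
    proof (cases "d = 0")
      case True
      have "isCont g 0"
        using holg r by (auto simp: continuous_on_eq_continuous_at dest!: holomorphic_on_imp_continuous_on)
      then have "(g \<longlongrightarrow> g 0) (at 0)" by (simp add: isCont_def)
      moreover have "(H \<longlongrightarrow> H 0) (at 0)" using \<open>isCont H 0\<close> by (simp add: isCont_def)
      moreover have "eventually (\<lambda>t. H t = g t) (at 0)"
        unfolding eventually_at using r H True by (auto intro!: exI [of _ r])
      ultimately have "g 0 = H 0"
        using tendsto_cong [of H g "at 0" "H 0"] tendsto_unique [of "at 0" g] by auto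
      then show ?thesis using True by simp
    next
      case False
      then show ?thesis using bound [of 0] r by (simp add: power_0_left)
    qed
    then show ?thesis using True by simp
  next
    case False
    then have "g t - H 0 * t ^ d = (H t - H 0) * t ^ d"
      using H [of t] that by (simp add: field_simps)
    then have "norm (g t - H 0 * t ^ d) = norm (H t - H 0) * norm t ^ d"
      by (simp add: norm_mult norm_power)
    also have "\<dots> \<le> 3 * C / r * norm t * norm t ^ d"
      by (intro mult_right_mono HL that) auto
    finally show ?thesis by (simp add: mult.assoc)
  qed
  then show ?thesis by blast
qed

text \<open>Frechet derivatives are real linear, so homogeneity under complex scalars is demanded
  separately.\<close>

definition holomorphic_germ :: "(complex ^ 'n \<Rightarrow> complex) \<Rightarrow> bool"
  where "holomorphic_germ f \<longleftrightarrow>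
    (\<forall>\<^sub>F z in nhds 0. \<exists>D. (f has_derivative D) (at z) \<and> (\<forall>c v. D (c *s v) = c * D v))"

lemma bounded_linear_scaleC_left: "bounded_linear (\<lambda>t. t *s (v :: complex ^ 'n))"
  by (rule linear_conv_bounded_linear [THEN iffD1], rule linearI)
     (auto simp: vec_eq_iff algebra_simps)

lemma holomorphic_on_line:
  assumes "\<And>t. t \<in> S \<Longrightarrow>
      \<exists>D. (f has_derivative D) (at (w + t *s v)) \<and> (\<forall>c v. D (c *s v) = c * D v)"
  shows "(\<lambda>t. f (w + t *s (v :: complex ^ 'n)) :: complex) holomorphic_on S"
proof (rule holomorphic_onI)
  fix t assume "t \<in> S"
  then obtain D where D: "(f has_derivative D) (at (w + t *s v))" "\<And>c v. D (c *s v) = c * D v"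
    using assms by blast
  have "((\<lambda>t. w + t *s v) has_derivative (\<lambda>h. h *s v)) (at t within S)"
    by (rule derivative_eq_intros bounded_linear_imp_has_derivative bounded_linear_scaleC_left refl)+ simp
  then have "((\<lambda>t. f (w + t *s v)) has_derivative (\<lambda>h. D (h *s v))) (at t within S)"
    using has_derivative_compose D(1) by blast
  moreover have "(\<lambda>h. D (h *s v)) = (*) (D v)" by (simp add: D(2) fun_eq_iff)
  ultimately have "((\<lambda>t. f (w + t *s v)) has_field_derivative D v) (at t within S)"
    by (simp add: has_field_derivative_def)
  then show "(\<lambda>t. f (w + t *s v)) field_differentiable at t within S"
    by (auto simp: field_differentiable_def)
qed

text \<open>
  With \<open>P z = lim R (t z) / t\<^sup>d\<close>, the Schwarz lemma on complex lines makes the convergence locally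
  uniform, so \<open>P\<close> is entire on every line and of growth \<open>\<bar>z\<bar>\<^sup>d\<close>, hence by Liouville a polynomial
  in each variable separately.
\<close>

lemma holomorphic_leading_term:
  fixes R :: "complex ^ 'n \<Rightarrow> complex"
  assumes hol: "holomorphic_germ R" and ord: "R \<in> ord_germs d"
  obtains L c where "finite L" "\<And>l. l \<in> L \<Longrightarrow> mi_deg l = d"
    "(\<lambda>z. R z - (\<Sum>l\<in>L. c l * mi_pow z l)) \<in> ord_germs (d + 1)"
proof -
  obtain r1 where r1: "r1 > 0" "\<And>z. norm z < r1 \<Longrightarrow>
      \<exists>D. (R has_derivative D) (at z) \<and> (\<forall>c v. D (c *s v) = c * D v)"
    using hol by (auto simp: holomorphic_germ_def eventually_nhds_metric)
  obtain C r2 where C: "C > 0" "r2 > 0" "\<And>z. norm z < r2 \<Longrightarrow> norm (R z) \<le> C * norm z ^ d"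
    using ord by (auto simp: ord_germs_iff)
  define r where "r = min r1 r2"
  have r: "r > 0" "\<And>z. norm z < r \<Longrightarrow> norm (R z) \<le> C * norm z ^ d"
     and der: "\<And>z. norm z < r \<Longrightarrow>
      \<exists>D. (R has_derivative D) (at z) \<and> (\<forall>c v. D (c *s v) = c * D v)"
    using r1 C by (auto simp: r_def)
  define K where "K = 3 * C / r"
  have K: "K > 0" using C r by (simp add: K_def)
  \<comment> \<open>On the line through \<open>z\<close> the radius is \<open>r / norm z\<close> and
    the bound is \<open>C * norm z ^ d\<close>; the powers of \<open>norm z\<close> recombine so
    that one \<open>K\<close> serves all lines.\<close>
  have "\<exists>p. \<forall>t. norm (t *s z) < r \<longrightarrow> norm (R (t *s z) - p * t ^ d) \<le> K * norm (t *s z) ^ (d + 1)" for z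
  proof (cases "z = 0")
    case True
    have "R 0 = R 0 * t ^ d" for t
      using r(2) [of 0] r(1) by (cases "d = 0") (auto simp: power_0_left)
    then show ?thesis using True by (intro exI [of _ "R 0"]) simp
  next
    case False
    have "(\<lambda>t. R (0 + t *s z)) holomorphic_on ball 0 (r / norm z)"
      by (rule holomorphic_on_line) (use False der in \<open>auto simp: norm_scaleC_vec field_simps\<close>)
    moreover have "norm (R (0 + t *s z)) \<le> C * norm z ^ d * norm t ^ d" if "norm t < r / norm z" for t
      using r(2) [of "t *s z"] that False
      by (simp add: norm_scaleC_vec field_simps)
    ultimately obtain p where p: "\<And>t. norm t < r / norm z \<Longrightarrow>
        norm (R (0 + t *s z) - p * t ^ d) \<le> 3 * (C * norm z ^ d) / (r / norm z) * norm t ^ (d + 1)"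
      using one_variable_leading_term [of "r / norm z" "C * norm z ^ d" "\<lambda>t. R (0 + t *s z)" d]
        C r False by auto
    have "norm (R (t *s z) - p * t ^ d) \<le> K * norm (t *s z) ^ (d + 1)" if "norm (t *s z) < r" for t
      using p [of t] that False
      by (simp add: norm_scaleC_vec K_def field_simps)
    then show ?thesis by blast
  qed
  then obtain P where P: "\<And>z t. norm (t *s z) < r \<Longrightarrow>
      norm (R (t *s z) - P z * t ^ d) \<le> K * norm (t *s z) ^ (d + 1)"
    by metis
  have RP: "norm (R z - P z) \<le> K * norm z ^ (d + 1)" if "norm z < r" for z
    using P [of 1 z] that by simp
  have small: "\<forall>\<^sub>F t in at_right (0::real). norm (of_real t *s z :: complex ^ 'n) < r" for z
  proof -
    have "((\<lambda>t. \<bar>t\<bar> * norm z) \<longlongrightarrow> \<bar>0\<bar> * norm z) (at_right 0)"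
      by (intro tendsto_intros)
    then show ?thesis
      using order_tendstoD(2) r(1) by (fastforce simp: norm_scaleC_vec)
  qed
  have limP: "((\<lambda>t. R (of_real t *s z) / of_real t ^ d) \<longlongrightarrow> P z) (at_right (0::real))" for z
  proof (rule Lim_null [THEN iffD2], rule Lim_null_comparison)
    have "eventually (\<lambda>t::real. t > 0) (at_right 0)" by (simp add: eventually_at_right_less)
    with small [of z] show "\<forall>\<^sub>F t in at_right 0. norm (R (of_real t *s z) / of_real t ^ d - P z)
        \<le> K * norm z ^ (d + 1) * t"
    proof eventually_elim
      case (elim t)
      have "norm (R (of_real t *s z) - P z * of_real t ^ d) \<le> K * (t * norm z) ^ (d + 1)"
        using P [of "of_real t" z] elim by (simp add: norm_scaleC_vec)
      moreover have "R (of_real t *s z) / of_real t ^ d - P z =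
          (R (of_real t *s z) - P z * of_real t ^ d) / of_real t ^ d"
        using elim by (simp add: diff_divide_distrib)
      ultimately have "norm (R (of_real t *s z) / of_real t ^ d - P z) \<le> K * (t * norm z) ^ (d + 1) / t ^ d"
        using elim by (simp add: norm_divide norm_power divide_right_mono)
      also have "\<dots> = K * norm z ^ (d + 1) * t"
        using elim by (simp add: power_mult_distrib)
      finally show ?case .
    qed
    show "((\<lambda>t. K * norm z ^ (d + 1) * t) \<longlongrightarrow> 0) (at_right 0)"
      by (rule tendsto_eq_intros refl | simp)+
  qed
  \<comment> \<open>\<open>P\<close> was chosen separately for each \<open>z\<close>; homogeneity
    comes from its description as a limit along the positive reals, which is unique.\<close>
  have hom: "P (s *s z) = s ^ d * P z" for s z
  proof -
    have "eventually (\<lambda>t::real. t > 0) (at_right 0)" by (simp add: eventually_at_right_less)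
    with small [of "s *s z"] have "\<forall>\<^sub>F t in at_right 0. norm (R (of_real t *s (s *s z)) / of_real t ^ d - s ^ d * P z)
        \<le> K * norm (s *s z) ^ (d + 1) * t"
    proof eventually_elim
      case (elim t)
      have "norm (R ((of_real t * s) *s z) - P z * (of_real t * s) ^ d) \<le> K * (t * norm (s *s z)) ^ (d + 1)"
        using P [of "of_real t * s" z] elim by (simp add: norm_scaleC_vec norm_mult mult.assoc vector_smult_assoc)
      moreover have "R (of_real t *s (s *s z)) / of_real t ^ d - s ^ d * P z =
          (R ((of_real t * s) *s z) - P z * (of_real t * s) ^ d) / of_real t ^ d"
        using elim by (simp add: diff_divide_distrib power_mult_distrib vector_smult_assoc)
      ultimately have "norm (R (of_real t *s (s *s z)) / of_real t ^ d - s ^ d * P z)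
          \<le> K * (t * norm (s *s z)) ^ (d + 1) / t ^ d"
        using elim by (simp add: norm_divide norm_power divide_right_mono)
      also have "\<dots> = K * norm (s *s z) ^ (d + 1) * t"
        using elim by (simp add: power_mult_distrib)
      finally show ?case .
    qed
    moreover have "((\<lambda>t. K * norm (s *s z) ^ (d + 1) * t) \<longlongrightarrow> 0) (at_right 0)"
      by (rule tendsto_eq_intros refl | simp)+
    ultimately have "((\<lambda>t. R (of_real t *s (s *s z)) / of_real t ^ d - s ^ d * P z) \<longlongrightarrow> 0) (at_right (0::real))"
      by (rule Lim_null_comparison)
    then have "((\<lambda>t. R (of_real t *s (s *s z)) / of_real t ^ d) \<longlongrightarrow> s ^ d * P z) (at_right (0::real))"
      by (rule Lim_null [THEN iffD2])
    then show ?thesis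
      using tendsto_unique [OF _ limP [of "s *s z"]] by simp
  qed
  \<comment> \<open>On the sphere of radius \<open>r / 2\<close> the bound on \<open>R\<close>
    controls \<open>P\<close>; homogeneity carries it to every \<open>z\<close>.\<close>
  have growth: "norm (P z) \<le> (C + K * r) * norm z ^ d" for z
  proof (cases "z = 0")
    case True
    have "norm (R 0 - P 0) \<le> 0" using RP [of 0] r(1) by simp
    then have "R 0 = P 0" by simp
    then have "norm (P 0) \<le> C * 0 ^ d" using r(2) [of 0] r(1) by simp
    also have "\<dots> \<le> (C + K * r) * norm z ^ d"
      using K C r True by (cases "d = 0") (auto simp: power_0_left)
    finally show ?thesis using True by simp
  next
    case False
    define w where "w = of_real (r / (2 * norm z)) *s z"
    have nw: "norm w = r / 2" using False r(1) by (simp add: w_def norm_scaleC_vec norm_divide norm_mult)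
    have "norm (P w) \<le> norm (R w) + norm (R w - P w)"
      by (metis norm_minus_commute norm_triangle_sub)
    also have "\<dots> \<le> C * (r / 2) ^ d + K * (r / 2) ^ (d + 1)"
      using RP [of w] r nw by (intro add_mono) fastforce+
    also have "\<dots> \<le> (C + K * r) * (r / 2) ^ d"
      using K r(1) by (simp add: algebra_simps)
    finally have w: "norm (P w) \<le> (C + K * r) * (r / 2) ^ d" .
    have "z = of_real (2 * norm z / r) *s w"
      using False r(1) by (simp add: w_def vector_smult_assoc)
    then have "P z = of_real (2 * norm z / r) ^ d * P w"
      using hom [of "of_real (2 * norm z / r)" w] by argo
    then have "norm (P z) = norm (of_real (2 * norm z / r) :: complex) ^ d * norm (P w)"
      by (simp only: norm_mult norm_power)
    also have "\<dots> = (2 * norm z / r) ^ d * norm (P w)"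
      using r(1) by (simp add: norm_mult norm_divide)
    also have "\<dots> \<le> (2 * norm z / r) ^ d * ((C + K * r) * (r / 2) ^ d)"
      using r(1) by (intro mult_left_mono w) auto
    also have "\<dots> = (C + K * r) * (2 * norm z / r * (r / 2)) ^ d"
      by (simp only: power_mult_distrib ac_simps)
    also have "\<dots> = (C + K * r) * norm z ^ d"
      using r(1) by simp
    finally show ?thesis .
  qed
  have entire: "(\<lambda>t. P (w + t *s v)) holomorphic_on UNIV" for w v
  proof -
    have "(\<lambda>t. P (w + t *s v)) holomorphic_on ball 0 \<rho>" if \<rho>: "\<rho> > 0" for \<rho>
    proof -
      define B where "B = norm w + \<rho> * norm v"
      have B: "norm (w + t *s v) \<le> B" if "norm t \<le> \<rho>" for t
        using norm_triangle_ineq [of w "t *s v"] mult_right_mono [OF that norm_ge_zero [of v]]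
        by (simp add: B_def norm_scaleC_vec)
      \<comment> \<open>Blow-up of \<open>R\<close>: the choice of \<open>P\<close> bounds the
        distance of \<open>m ^ d * R (y / m)\<close> from \<open>P y\<close> by
        \<open>K * norm y ^ (d + 1) / m\<close>, uniformly for bounded \<open>y\<close>, and
        \<open>y / m\<close> eventually lies where \<open>R\<close> is holomorphic.\<close>
      define f where "f m t = of_nat m ^ d * R (inverse (of_nat m) *s w + t *s (inverse (of_nat m) *s v))"
        for m :: nat and t :: complex
      have arg: "inverse (of_nat m) *s w + t *s (inverse (of_nat m) *s v)
         = inverse (of_nat m) *s (w + t *s v)" for m t
        by (simp add: vec_eq_iff algebra_simps)
      have big: "\<forall>\<^sub>F m in sequentially. real m > B / r \<and> m > 0"
        by (intro eventually_conj eventually_gt_at_top filterlim_real_sequentially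
            [unfolded filterlim_at_top_dense, rule_format])
      have inball: "norm (inverse (of_nat m) *s (w + t *s v)) < r"
        if "real m > B / r \<and> m > 0" "norm t \<le> \<rho>" for m t
      proof -
        have "norm (w + t *s v) / real m \<le> B / real m"
          using B [OF that(2)] by (simp add: divide_right_mono)
        also have "\<dots> < r" using that r(1) by (simp add: field_simps)
        finally show ?thesis
          unfolding norm_scaleC_vec by (simp add: norm_inverse divide_inverse mult.commute)
      qed
      show ?thesis
      proof (rule holomorphic_uniform_limit)
        show "\<forall>\<^sub>F m in sequentially. continuous_on (cball 0 \<rho>) (f m) \<and> f m holomorphic_on ball 0 \<rho>"
          using big
        proof eventually_elim
          case (elim m)
          have "f m holomorphic_on cball 0 \<rho>"
            unfolding f_def
            by (intro holomorphic_intros holomorphic_on_line, unfold arg, rule der,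
                rule inball [OF elim]) simp
          then show ?case
            by (meson ball_subset_cball holomorphic_on_imp_continuous_on holomorphic_on_subset)
        qed
        show "uniform_limit (cball 0 \<rho>) f (\<lambda>t. P (w + t *s v)) sequentially"
        proof (rule uniform_limitI)
          fix e :: real assume e: "e > 0"
          have "\<forall>\<^sub>F m in sequentially. real m > K * B ^ (d + 1) / e"
            by (intro filterlim_real_sequentially [unfolded filterlim_at_top_dense, rule_format])
          with big show "\<forall>\<^sub>F m in sequentially. \<forall>t\<in>cball 0 \<rho>. dist (f m t) (P (w + t *s v)) < e"
          proof eventually_elim
            case (elim m)
            show ?case
            proof
              fix t :: complex assume "t \<in> cball 0 \<rho>"
              then have t: "norm t \<le> \<rho>" by simp
              define y where "y = w + t *s v"
              have "norm (R (inverse (of_nat m) *s y) - P y * inverse (of_nat m) ^ d)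
                  \<le> K * norm (inverse (of_nat m :: complex) *s y) ^ (d + 1)"
                using inball [OF elim(1) t] unfolding y_def by (rule P)
              then have "real m ^ d * norm (R (inverse (of_nat m) *s y) - P y * inverse (of_nat m) ^ d)
                  \<le> real m ^ d * (K * (norm y / real m) ^ (d + 1))"
                unfolding norm_scaleC_vec
                by (intro mult_left_mono) (auto simp: norm_inverse divide_inverse mult.commute)
              also have "\<dots> = K * norm y ^ (d + 1) / real m"
                using elim by (simp add: power_divide)
              also have "\<dots> \<le> K * B ^ (d + 1) / real m"
                using B [OF t] K by (intro divide_right_mono mult_left_mono power_mono) (auto simp: y_def)
              also have "\<dots> < e" using elim e by (simp add: field_simps)
              also have "real m ^ d * norm (R (inverse (of_nat m) *s y) - P y * inverse (of_nat m) ^ d)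
                = norm (of_nat m ^ d * (R (inverse (of_nat m) *s y) - P y * inverse (of_nat m) ^ d))"
                by (simp add: norm_mult norm_power)
              also have "of_nat m ^ d * (R (inverse (of_nat m) *s y) - P y * inverse (of_nat m) ^ d)
                = f m t - P y"
                using elim unfolding f_def arg y_def by (simp add: field_simps)
              finally show "dist (f m t) (P (w + t *s v)) < e" by (simp add: dist_norm y_def)
            qed
          qed
        qed
      qed auto
    qed
    then have "(\<lambda>t. P (w + t *s v)) field_differentiable at t" for t
      using holomorphic_on_imp_differentiable_at
        [of "\<lambda>t. P (w + t *s v)" "ball 0 (norm t + 1)" t] by (simp add: add_nonneg_pos)
    then show ?thesis
      by (simp add: holomorphic_on_def)
  qed
  have "polynomial_fun P"
  proof (rule separately_polynomial [where d = d])
    fix z :: "complex ^ 'n" and i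
    define w where "w = (\<chi> j. if j = i then 0 else z $ j)"
    define c where "c k = (deriv ^^ k) (\<lambda>t. P (w + t *s axis i 1)) 0 / fact k" for k
    have "norm (P (w + t *s axis i 1)) \<le> (C + K * r) * 2 ^ d * norm t ^ d"
      if "norm w \<le> norm t" for t
    proof -
      have "norm (w + t *s axis i 1) \<le> norm w + norm t * 1"
        using norm_triangle_ineq [of w "t *s axis i 1"] by (simp add: norm_scaleC_vec)
      then have "norm (w + t *s axis i 1) ^ d \<le> (2 * norm t) ^ d"
        using that by (intro power_mono) auto
      then have "(C + K * r) * norm (w + t *s axis i 1) ^ d
          \<le> (C + K * r) * (2 * norm t) ^ d"
        using C K r by (intro mult_left_mono) auto
      then show ?thesis using growth [of "w + t *s axis i 1"] by (simp add: power_mult_distrib)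
    qed
    then have "P (w + t *s axis i 1) = (\<Sum>k\<le>d. c k * t ^ k)" for t
      unfolding c_def by (rule Liouville_polynomial [OF entire])
    moreover have "(\<chi> j. if j = i then t else z $ j) = w + t *s axis i 1" for t
      by (auto simp: vec_eq_iff w_def axis_def)
    ultimately have "P (\<chi> j. if j = i then t else z $ j) = poly (\<Sum>k\<le>d. monom (c k) k) t" for t
      by (simp add: poly_sum poly_monom)
    moreover have "degree (\<Sum>k\<le>d. monom (c k) k) \<le> d"
      by (rule degree_sum_le) (auto intro: order_trans [OF degree_monom_le])
    ultimately show "\<exists>p. degree p \<le> d \<and> (\<forall>t. P (\<chi> j. if j = i then t else z $ j) = poly p t)"
      by blast
  qed
  then obtain L c where L: "finite L" "P = (\<lambda>z. \<Sum>l\<in>L. c l * mi_pow z l)"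
    by (auto simp: polynomial_fun_def)
  \<comment> \<open>Both sides of \<open>P (t z) = t ^ d * P z\<close> are polynomials in
    \<open>t\<close>; comparing the coefficients of \<open>t ^ d\<close> retains exactly the
    monomials of degree \<open>d\<close>.\<close>
  have PL: "P z = (\<Sum>l\<in>{l\<in>L. mi_deg l = d}. c l * mi_pow z l)" for z
  proof -
    have "(\<Sum>l\<in>L. monom (c l * mi_pow z l) (mi_deg l)) = monom (P z) d"
    proof (rule poly_eq_poly_eq_iff [THEN iffD1], rule ext)
      fix t
      show "poly (\<Sum>l\<in>L. monom (c l * mi_pow z l) (mi_deg l)) t = poly (monom (P z) d) t"
        using hom [of t z] by (simp add: poly_sum poly_monom L(2) mi_pow_scaleC ac_simps)
    qed
    then have "coeff (\<Sum>l\<in>L. monom (c l * mi_pow z l) (mi_deg l)) d = P z" by simp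
    then show ?thesis using L(1) by (simp add: coeff_sum sum.inter_filter)
  qed
  show ?thesis
  proof (rule that)
    show "finite {l\<in>L. mi_deg l = d}" using L by simp
    show "(\<lambda>z. R z - (\<Sum>l\<in>{l\<in>L. mi_deg l = d}. c l * mi_pow z l)) \<in> ord_germs (d + 1)"
      unfolding ord_germs_iff PL [symmetric] using RP K r(1) by blast
  qed auto
qed

section \<open>Closure properties of holomorphic germs and their orders of vanishing\<close>

lemma holomorphic_germ_const: "holomorphic_germ (\<lambda>z. c)"
  unfolding holomorphic_germ_def by (rule always_eventually) (auto intro!: exI [of _ "\<lambda>_. 0"])

lemma holomorphic_germ_coord: "holomorphic_germ (\<lambda>z. z $ i)"
  unfolding holomorphic_germ_def
  by (rule always_eventually)
     (auto intro!: exI [of _ "\<lambda>v. v $ i"] bounded_linear_imp_has_derivative bounded_linear_vec_nth)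

lemma holomorphic_germ_add:
  assumes "holomorphic_germ f" "holomorphic_germ g"
  shows "holomorphic_germ (\<lambda>z. f z + g z)"
  using assms unfolding holomorphic_germ_def
proof eventually_elim
  case (elim z)
  then obtain D E where "(f has_derivative D) (at z)" "(g has_derivative E) (at z)"
    "\<And>c v. D (c *s v) = c * D v" "\<And>c v. E (c *s v) = c * E v" by blast
  then show ?case
    by (intro exI [of _ "\<lambda>v. D v + E v"]) (auto intro: has_derivative_add simp: algebra_simps)
qed

lemma holomorphic_germ_mult:
  assumes "holomorphic_germ f" "holomorphic_germ g"
  shows "holomorphic_germ (\<lambda>z. f z * g z)"
  using assms unfolding holomorphic_germ_def
proof eventually_elim
  case (elim z)
  then obtain D E where "(f has_derivative D) (at z)" "(g has_derivative E) (at z)"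
    "\<And>c v. D (c *s v) = c * D v" "\<And>c v. E (c *s v) = c * E v" by blast
  then show ?case
    by (intro exI [of _ "\<lambda>v. f z * E v + D v * g z"])
       (auto intro: has_derivative_mult simp: distrib_left mult.left_commute)
qed

lemma holomorphic_germ_cmult: "holomorphic_germ f \<Longrightarrow> holomorphic_germ (\<lambda>z. c * f z)"
  by (intro holomorphic_germ_mult holomorphic_germ_const)

lemma holomorphic_germ_diff:
  assumes "holomorphic_germ f" "holomorphic_germ g"
  shows "holomorphic_germ (\<lambda>z. f z - g z)"
  using holomorphic_germ_add [OF assms(1) holomorphic_germ_cmult [OF assms(2), of "-1"]] by simp

lemma holomorphic_germ_sum:
  "finite S \<Longrightarrow> (\<And>i. i \<in> S \<Longrightarrow> holomorphic_germ (f i)) \<Longrightarrow> holomorphic_germ (\<lambda>z. \<Sum>i\<in>S. f i z)"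
  by (induction S rule: finite_induct) (auto intro: holomorphic_germ_const holomorphic_germ_add)

lemma holomorphic_germ_prod:
  "finite S \<Longrightarrow> (\<And>i. i \<in> S \<Longrightarrow> holomorphic_germ (f i)) \<Longrightarrow> holomorphic_germ (\<lambda>z. \<Prod>i\<in>S. f i z)"
  by (induction S rule: finite_induct) (auto intro: holomorphic_germ_const holomorphic_germ_mult)

lemma holomorphic_germ_power: "holomorphic_germ f \<Longrightarrow> holomorphic_germ (\<lambda>z. f z ^ n)"
  by (induction n) (auto intro: holomorphic_germ_const holomorphic_germ_mult)

lemma holomorphic_germ_mi_pow:
  "(\<And>i. holomorphic_germ (\<lambda>z. X z $ i)) \<Longrightarrow> holomorphic_germ (\<lambda>z. mi_pow (X z) l)"
  unfolding mi_pow_def by (intro holomorphic_germ_prod holomorphic_germ_power) auto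

lemmas holomorphic_germ_intros = holomorphic_germ_const holomorphic_germ_coord holomorphic_germ_add
  holomorphic_germ_diff holomorphic_germ_mult holomorphic_germ_sum holomorphic_germ_power

lemma holomorphic_germ_bounded:
  assumes "holomorphic_germ f"
  shows "f \<in> ord_germs 0"
proof -
  obtain D where "(f has_derivative D) (at 0)"
    using eventually_nhds_x_imp_x [OF assms [unfolded holomorphic_germ_def]] by blast
  then have "(f \<longlongrightarrow> f 0) (at 0)"
    using has_derivative_continuous isContD by blast
  then have "\<forall>\<^sub>F z in at 0. norm (f z) < norm (f 0) + 1"
    by (rule order_tendstoD(2) [OF tendsto_norm]) simp
  then have "\<forall>\<^sub>F z in nhds 0. norm (f z) < norm (f 0) + 1"
    by (simp add: eventually_nhds_conv_at)
  then obtain r where "r > 0" "\<And>z. norm z < r \<Longrightarrow> norm (f z) < norm (f 0) + 1"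
    by (auto simp: eventually_nhds_metric)
  then show ?thesis
    unfolding ord_germs_iff
    by (intro exI [of _ "norm (f 0) + 1"] conjI exI [of _ r]) (auto simp: add_nonneg_pos less_imp_le)
qed

lemma has_derivative_small:
  assumes "(f has_derivative D) (at 0)" "f 0 = 0" "e > 0"
  obtains r where "r > 0" "\<And>z. norm z < r \<Longrightarrow> norm (f z - D z) \<le> e * norm z"
  using assms unfolding has_derivative_at_alt by (metis diff_zero)

lemma differentiable_ord_germs:
  fixes f :: "complex ^ 'n \<Rightarrow> complex"
  assumes "(f has_derivative D) (at 0)" "f 0 = 0"
  shows "f \<in> ord_germs 1"
proof -
  obtain r where r: "r > 0" "\<And>z. norm z < r \<Longrightarrow> norm (f z - D z) \<le> 1 * norm z"
    using has_derivative_small [OF assms zero_less_one] by metis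
  have D: "norm (D z) \<le> onorm D * norm z" for z
    using assms(1) has_derivative_bounded_linear onorm by blast
  have "norm (f z) \<le> (\<bar>onorm D\<bar> + 1) * norm z ^ 1" if "norm z < r" for z
  proof -
    have "norm (f z) \<le> norm (f z - D z) + norm (D z)" by (metis norm_triangle_sub add.commute)
    moreover have "onorm D * norm z \<le> \<bar>onorm D\<bar> * norm z" by (intro mult_right_mono) auto
    ultimately show ?thesis using r(2) [OF that] D [of z] by (simp add: algebra_simps)
  qed
  then show ?thesis unfolding ord_germs_iff
    by (intro exI [of _ "\<bar>onorm D\<bar> + 1"] conjI exI [of _ r]) (use r(1) in auto)
qed

lemma holomorphic_germ_ord_1:
  assumes "holomorphic_germ f" "f 0 = 0"
  shows "f \<in> ord_germs 1"
  using eventually_nhds_x_imp_x [OF assms(1) [unfolded holomorphic_germ_def]]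
    differentiable_ord_germs assms(2) by blast

text \<open>Vanishing of the derivative alone gives only \<open>o(|z|)\<close>. Holomorphy supplies
  a homogeneous leading term of degree 1 with an error of order 2, and a homogeneous term of degree
  1 that is \<open>o(|z|)\<close> is zero.\<close>

lemma holomorphic_germ_ord_2:
  assumes hol: "holomorphic_germ f" and "f 0 = 0" and der: "(f has_derivative (\<lambda>_. 0)) (at 0)"
  shows "f \<in> ord_germs 2"
proof -
  obtain L c where L: "finite L" "\<And>l. l \<in> L \<Longrightarrow> mi_deg l = 1"
    "(\<lambda>z. f z - (\<Sum>l\<in>L. c l * mi_pow z l)) \<in> ord_germs (1 + 1)"
    by (rule holomorphic_leading_term [OF hol holomorphic_germ_ord_1 [OF assms(1,2)]]) blast
  define P where "P z = (\<Sum>l\<in>L. c l * mi_pow z l)" for z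
  have hom: "P (t *s z) = t * P z" for t z
    unfolding P_def sum_distrib_left
    by (intro sum.cong refl) (use L(2) in \<open>simp add: mi_pow_scaleC\<close>)
  obtain K r where K: "K > 0" "r > 0" "\<And>z. norm z < r \<Longrightarrow> norm (f z - P z) \<le> K * norm z ^ 2"
    using L(3) unfolding ord_germs_iff one_add_one P_def by blast
  have "P z = 0" for z
  proof (rule ccontr)
    assume nz: "P z \<noteq> 0"
    then have z: "z \<noteq> 0" using hom [of 0 z] hom [of 0 0] by auto
    \<comment> \<open>At a small multiple of \<open>z\<close> both error bounds are at most
      \<open>e\<close> times the norm of that multiple, so together they reach only two thirds of
      the norm of \<open>P\<close> there.\<close>
    define e where "e = norm (P z) / (3 * norm z)"
    have e: "e > 0" using nz z by (simp add: e_def)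
    obtain s where s: "s > 0" "\<And>z. norm z < s \<Longrightarrow> norm (f z - 0) \<le> e * norm z"
      using has_derivative_small [OF der assms(2) e] by metis
    define q where "q = min (min r s) (e / K)"
    have q: "q > 0" "q \<le> r" "q \<le> s" "q \<le> e / K"
      using K s e by (auto simp: q_def)
    define t where "t = q / (2 * norm z)"
    have tz: "t * norm z = q / 2" using z by (simp add: t_def)
    have "K * q \<le> e" using q(4) K(1) by (simp add: pos_le_divide_eq mult.commute)
    then have t: "t > 0" "t * norm z < r" "t * norm z < s" "K * (t * norm z) \<le> e"
      using q z K(1) e unfolding tz by (auto simp: t_def)
    have nt: "norm (of_real t *s z) = t * norm z" using t by (simp add: norm_scaleC_vec)
    have "t * norm (P z) = norm (P (of_real t *s z))" using t by (simp add: hom norm_mult)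
    also have "\<dots> \<le> norm (f (of_real t *s z) - P (of_real t *s z)) + norm (f (of_real t *s z))"
      by (metis norm_minus_commute norm_triangle_sub add.commute)
    also have "\<dots> \<le> K * (t * norm z) ^ 2 + e * (t * norm z)"
      using K(3) [of "of_real t *s z"] s(2) [of "of_real t *s z"] t by (simp add: nt)
    also have "K * (t * norm z) ^ 2 = K * (t * norm z) * (t * norm z)"
      by (simp add: power2_eq_square)
    also have "K * (t * norm z) * (t * norm z) \<le> e * (t * norm z)"
      using t by (intro mult_right_mono) auto
    finally have "norm (P z) \<le> 2 * e * norm z" using t by (simp add: algebra_simps)
    then show False using nz z by (simp add: e_def)
  qed
  then show ?thesis using L(3) unfolding one_add_one P_def by simp
qed

lemma holomorphic_germ_component:
  assumes "holomorphic_map_on F U" "0 \<in> U"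
  shows "holomorphic_germ (\<lambda>z. F z $ i)"
proof -
  have "open U" using assms by (simp add: holomorphic_map_on_def)
  then have "\<forall>\<^sub>F z in nhds 0. z \<in> U" using assms(2) by (rule eventually_nhds_in_open)
  then show ?thesis unfolding holomorphic_germ_def
  proof eventually_elim
    case (elim z)
    then obtain A where "(F has_derivative (\<lambda>v. A *v v)) (at z)"
      using assms(1) by (auto simp: holomorphic_map_on_def)
    then have "((\<lambda>z. F z $ i) has_derivative (\<lambda>v. (A *v v) $ i)) (at z)"
      by (rule bounded_linear.has_derivative [OF bounded_linear_vec_nth])
    then show ?case
      by (intro exI [of _ "\<lambda>v. (A *v v) $ i"]) (auto simp: vector_scalar_commute)
  qed
qed

lemma holomorphic_germ_compose:
  assumes f: "holomorphic_germ f" and F: "holomorphic_map_on F U" "0 \<in> U" "F 0 = 0"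
  shows "holomorphic_germ (\<lambda>z. f (F z))"
proof -
  have U: "open U" using F by (simp add: holomorphic_map_on_def)
  have "isCont F 0"
    using F by (auto simp: holomorphic_map_on_def dest!: bspec has_derivative_continuous)
  then have "(F \<longlongrightarrow> F 0) (nhds 0)"
    by (simp add: isCont_def tendsto_at_iff_tendsto_nhds)
  then have "filterlim F (nhds 0) (nhds 0)" using F(3) by simp
  then have 1: "\<forall>\<^sub>F z in nhds 0. \<exists>D. (f has_derivative D) (at (F z)) \<and> (\<forall>c v. D (c *s v) = c * D v)"
    using f unfolding holomorphic_germ_def filterlim_iff by blast
  have 2: "\<forall>\<^sub>F z in nhds 0. z \<in> U" using U F(2) by (rule eventually_nhds_in_open)
  from 1 2 show ?thesis unfolding holomorphic_germ_def
  proof eventually_elim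
    case (elim z)
    obtain A where A: "(F has_derivative (\<lambda>v. A *v v)) (at z)"
      using F(1) elim(2) by (auto simp: holomorphic_map_on_def)
    obtain D where D: "(f has_derivative D) (at (F z))" "\<And>c v. D (c *s v) = c * D v"
      using elim(1) by blast
    have "((\<lambda>z. f (F z)) has_derivative (\<lambda>v. D (A *v v))) (at z)"
      using has_derivative_compose [OF A D(1)] .
    then show ?case
      by (intro exI [of _ "\<lambda>v. D (A *v v)"]) (auto simp: vector_scalar_commute D(2))
  qed
qed

lemma norm_vec_le_sum: "norm (x :: complex ^ 'n) \<le> (\<Sum>i\<in>UNIV. norm (x $ i))"
  by (simp add: norm_vec_def L2_set_le_sum)

lemma norm_ord_germs:
  assumes "\<And>i. (\<lambda>z. F z $ i :: complex) \<in> ord_germs d"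
  shows "(\<lambda>z. of_real (norm (F z))) \<in> ord_germs d"
proof -
  have "(\<lambda>z. of_real (norm (F z $ i))) \<in> ord_germs d" for i
    using assms [of i] by (simp add: ord_germs_iff)
  then have "(\<lambda>z. \<Sum>i\<in>UNIV. of_real (norm (F z $ i))) \<in> ord_germs d"
    by (intro ord_germs_sum) auto
  then obtain C r where C: "C > 0" "r > 0"
    "\<And>z. norm z < r \<Longrightarrow> norm (\<Sum>i\<in>UNIV. of_real (norm (F z $ i)) :: complex) \<le> C * norm z ^ d"
    by (auto simp: ord_germs_iff)
  have "norm (of_real (norm (F z)) :: complex) \<le> norm (\<Sum>i\<in>UNIV. of_real (norm (F z $ i)) :: complex)" for z
    using norm_vec_le_sum [of "F z"] by (simp flip: of_real_sum)
  then show ?thesis unfolding ord_germs_iff using C by (meson order_trans)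
qed

text \<open>Equality of leading parts: \<open>g\<close> is the model, in applications a monomial
  with coefficient. Requiring the order of \<open>g\<close> makes the relation multiplicative, with
  orders adding up.\<close>

definition agree :: "nat \<Rightarrow> ('a :: real_normed_vector \<Rightarrow> complex) \<Rightarrow> ('a \<Rightarrow> complex) \<Rightarrow> bool"
  where "agree d f g \<longleftrightarrow> g \<in> ord_germs d \<and> (\<lambda>z. f z - g z) \<in> ord_germs (Suc d)"

lemma agree_ord: "agree d f g \<Longrightarrow> f \<in> ord_germs d"
  using ord_germs_add [of g d "\<lambda>z. f z - g z"] ord_germs_mono [of _ "Suc d" d]
  by (auto simp: agree_def)

lemma ord_germs_zero: "(\<lambda>z. 0) \<in> ord_germs d"
  by (simp add: ord_germs_def)

lemma ord_germs_const: "(\<lambda>z. c) \<in> ord_germs 0"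
  unfolding ord_germs_iff
  by (intro exI [of _ "norm c + 1"] conjI exI [of _ "1::real"]) (auto simp: add_nonneg_pos)

lemma agree_const: "agree 0 (\<lambda>z. c) (\<lambda>z. c)"
  by (simp add: agree_def ord_germs_const ord_germs_zero)

lemma agree_mult:
  assumes "agree d f f'" "agree e g g'"
  shows "agree (d + e) (\<lambda>z. f z * g z) (\<lambda>z. f' z * g' z)"
proof -
  have "(\<lambda>z. (f z - f' z) * g z + f' z * (g z - g' z)) \<in> ord_germs (Suc (d + e))"
    using ord_germs_mult [of "\<lambda>z. f z - f' z" "Suc d" g e] ord_germs_mult [of f' d "\<lambda>z. g z - g' z" "Suc e"]
      assms agree_ord [OF assms(2)]
    by (intro ord_germs_add) (auto simp: agree_def)
  then show ?thesis
    using assms ord_germs_mult [of f' d g' e] by (simp add: agree_def algebra_simps)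
qed

lemma agree_power: "agree d f g \<Longrightarrow> agree (n * d) (\<lambda>z. f z ^ n) (\<lambda>z. g z ^ n)"
proof (induction n)
  case 0
  show ?case by (simp add: agree_const)
next
  case (Suc n)
  then show ?case using agree_mult [OF Suc.prems Suc.IH] by simp
qed

lemma agree_prod:
  "finite S \<Longrightarrow> (\<And>i. i \<in> S \<Longrightarrow> agree (d i) (f i) (g i)) \<Longrightarrow>
   agree (\<Sum>i\<in>S. d i) (\<lambda>z. \<Prod>i\<in>S. f i z) (\<lambda>z. \<Prod>i\<in>S. g i z)"
proof (induction S rule: finite_induct)
  case empty
  show ?case by (simp add: agree_const)
next
  case (insert i S)
  then show ?case using agree_mult [of "d i" "f i" "g i"] by simp
qed

lemma agree_mi_pow:
  assumes "\<And>i. agree 1 (\<lambda>z. X z $ i) (\<lambda>z. c $ i * z $ i)"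
  shows "agree (mi_deg l) (\<lambda>z. mi_pow (X z) l) (\<lambda>z. mi_pow c l * mi_pow z l)"
proof -
  have "agree (\<Sum>i\<in>UNIV. l $ i * 1) (\<lambda>z. \<Prod>i\<in>UNIV. (X z $ i) ^ (l $ i))
      (\<lambda>z. \<Prod>i\<in>UNIV. (c $ i * z $ i) ^ (l $ i))"
    by (intro agree_prod agree_power assms) auto
  then show ?thesis by (simp add: mi_deg_def mi_pow_def power_mult_distrib prod.distrib)
qed

lemma ord_germs_mi_pow: "(\<lambda>z. mi_pow z l) \<in> ord_germs (mi_deg l)"
proof -
  have "agree 1 (\<lambda>z. z $ i) (\<lambda>z. 1 $ i * z $ i)" for i :: 'a
    unfolding agree_def
    using holomorphic_germ_ord_1 [OF holomorphic_germ_coord, of i]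
    by (simp add: ord_germs_zero)
  then show ?thesis
    using agree_mi_pow [of "\<lambda>z. z" 1 l] agree_ord by blast
qed

section \<open>The normal form\<close>

lemma bchoice_pair:
  assumes "\<forall>x\<in>S. \<exists>y z. P x y z"
  shows "\<exists>f g. \<forall>x\<in>S. P x (f x) (g x)"
  using assms by metis

text \<open>Replacing the factors one at a time multiplies each error of order \<open>d\<close> by a
  factor of order \<open>e\<close>. With \<open>e = 1\<close> this gains the order that the
  normalization needs.\<close>

lemma ord_germs_diff_mult:
  assumes "(\<lambda>z. f z - f' z) \<in> ord_germs d" "(\<lambda>z. g z - g' z) \<in> ord_germs d"
    "f' \<in> ord_germs e" "g \<in> ord_germs e"
  shows "(\<lambda>z. f z * g z - f' z * g' z) \<in> ord_germs (d + e)"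
proof -
  have "(\<lambda>z. (f z - f' z) * g z + f' z * (g z - g' z)) \<in> ord_germs (d + e)"
    using ord_germs_mult [OF assms(1,4)] ord_germs_mult [OF assms(3,2)]
    by (intro ord_germs_add) (auto simp: add.commute)
  then show ?thesis by (simp add: algebra_simps)
qed

lemma ord_germs_bounded_mult:
  assumes "f \<in> ord_germs 0" "g \<in> ord_germs d"
  shows "(\<lambda>z. f z * g z) \<in> ord_germs d"
  using ord_germs_mult [OF assms] by simp

lemma ord_germs_diff_power:
  assumes "(\<lambda>z. f z - g z) \<in> ord_germs d" "f \<in> ord_germs 0" "g \<in> ord_germs 0"
  shows "(\<lambda>z. f z ^ n - g z ^ n) \<in> ord_germs d \<and> (\<lambda>z. f z ^ n) \<in> ord_germs 0 \<and> (\<lambda>z. g z ^ n) \<in> ord_germs 0"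
proof (induction n)
  case 0
  show ?case using ord_germs_const [of 1] by (simp add: ord_germs_zero)
next
  case (Suc n)
  then have "(\<lambda>z. f z * f z ^ n - g z * g z ^ n) \<in> ord_germs (d + 0)"
    using assms by (intro ord_germs_diff_mult) auto
  then show ?case
    using Suc ord_germs_bounded_mult [of f] ord_germs_bounded_mult [of g] assms by simp
qed

lemma ord_germs_diff_prod:
  assumes "finite S" "\<And>i. i \<in> S \<Longrightarrow> (\<lambda>z. f i z - g i z) \<in> ord_germs d"
    "\<And>i. i \<in> S \<Longrightarrow> f i \<in> ord_germs 0" "\<And>i. i \<in> S \<Longrightarrow> g i \<in> ord_germs 0"
  shows "(\<lambda>z. (\<Prod>i\<in>S. f i z) - (\<Prod>i\<in>S. g i z)) \<in> ord_germs d \<and>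
    (\<lambda>z. \<Prod>i\<in>S. f i z) \<in> ord_germs 0 \<and> (\<lambda>z. \<Prod>i\<in>S. g i z) \<in> ord_germs 0"
  using assms
proof (induction S rule: finite_induct)
  case empty
  show ?case using ord_germs_const [of 1] by (simp add: ord_germs_zero)
next
  case (insert i S)
  then have "(\<lambda>z. f i z * (\<Prod>i\<in>S. f i z) - g i z * (\<Prod>i\<in>S. g i z)) \<in> ord_germs (d + 0)"
    by (intro ord_germs_diff_mult) auto
  then show ?case
    using insert ord_germs_bounded_mult [of "f i"] ord_germs_bounded_mult [of "g i"] by simp
qed

lemma ord_germs_diff_mi_pow:
  assumes "\<And>i. (\<lambda>z. X z $ i - Y z $ i) \<in> ord_germs d"
    "\<And>i. (\<lambda>z. X z $ i) \<in> ord_germs 0" "\<And>i. (\<lambda>z. Y z $ i) \<in> ord_germs 0"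
  shows "(\<lambda>z. mi_pow (X z) l - mi_pow (Y z) l) \<in> ord_germs d"
proof -
  have *: "(\<lambda>z. X z $ i ^ l $ i - Y z $ i ^ l $ i) \<in> ord_germs d \<and>
      (\<lambda>z. X z $ i ^ l $ i) \<in> ord_germs 0 \<and> (\<lambda>z. Y z $ i ^ l $ i) \<in> ord_germs 0" for i
    by (rule ord_germs_diff_power [OF assms])
  show ?thesis
    unfolding mi_pow_def
    by (rule ord_germs_diff_prod [THEN conjunct1]) (simp_all only: * finite)
qed

text \<open>\<open>c\<close> is the diagonal of the linear part of the coordinates \<open>X\<close>,
  which need not be tangent to the identity. The germs \<open>g j\<close> collect all resonant terms
  beyond \<open>u ^ k\<close>; their holomorphy keeps the remainder holomorphic, so that it has a
  leading term at every stage, and makes them bounded near 0.\<close>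

definition normal_form ::
    "(complex ^ 'n \<Rightarrow> complex ^ 'n) \<Rightarrow> complex ^ 'n \<Rightarrow> 'n set \<Rightarrow> nat ^ 'n \<Rightarrow> nat \<Rightarrow> complex ^ 'n \<Rightarrow>
      complex ^ 'n \<Rightarrow> nat \<Rightarrow> (complex ^ 'n \<Rightarrow> complex ^ 'n) \<Rightarrow> ('n \<Rightarrow> complex ^ 'n \<Rightarrow> complex) \<Rightarrow> bool"
  where "normal_form F lam M \<alpha> k a c d X g \<longleftrightarrow>
    (\<forall>i. holomorphic_germ (\<lambda>z. X z $ i)) \<and>
    (\<forall>i. agree 1 (\<lambda>z. X z $ i) (\<lambda>z. c $ i * z $ i)) \<and>
    (\<forall>i. i \<notin> M \<longrightarrow> (\<forall>z. X z $ i = z $ i)) \<and>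
    (\<forall>j\<in>M. holomorphic_germ (g j) \<and>
      (\<lambda>z. X (F z) $ j - X z $ j *
         (lam $ j + a $ j * mi_pow (X z) \<alpha> ^ k + mi_pow (X z) \<alpha> ^ (k + 1) * g j z)) \<in> ord_germs d)"

text \<open>The algebra behind one normalization step. \<open>A\<close> is the leading part of the
  old remainder, \<open>q\<close> the correction of the coordinate, \<open>B\<close> the leading
  part of its composition with the germ, and \<open>C\<close> the resonant part passed to
  \<open>h\<close>. The hypothesis is the homological equation; what remains on the right is a sum
  of terms of higher order.\<close>

lemma homological_identity:
  fixes A :: complex
  assumes "A + B - l * q - C = 0"
  shows "xF + QF - (x + q) * (l + a * vk + vk1 * (g + h)) =
    xF - x * (l + a * uk + uk1 * g) - A + (QF - B) - a * ((x + q) * vk - x * uk) -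
    g * ((x + q) * vk1 - x * uk1) - ((x + q) * vk1 * h - C)"
proof -
  have C: "C = A + B - l * q" using assms by simp
  show ?thesis unfolding C by (simp add: algebra_simps)
qed

text \<open>
  Composing \<open>z\<^sup>l\<close> with \<open>F\<close> multiplies it by \<open>\<lambda>\<^sup>l\<close> up to higher order, so adding a multiple of
  \<open>z\<^sup>l / (\<lambda>\<^sub>j - \<lambda>\<^sup>l)\<close> to the \<open>j\<close>-th coordinate removes a nonresonant term \<open>z\<^sup>l\<close>; a resonant one is a
  multiple of \<open>x\<^sub>j u\<^sup>\<kappa>\<close> with \<open>\<kappa> > k\<close> up to higher order and is absorbed by \<open>g\<close>.
\<close>

lemma normal_form_step:
  fixes F :: "complex ^ 'n \<Rightarrow> complex ^ 'n"
  assumes F: "holomorphic_map_on F U" "0 \<in> U" "F 0 = 0"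
    and Flin: "\<And>i. agree 1 (\<lambda>z. F z $ i) (\<lambda>z. lam $ i * z $ i)"
    and res: "\<And>j l. j \<in> M \<Longrightarrow> mi_deg l \<ge> 2 \<Longrightarrow> lam $ j = mi_pow lam l \<Longrightarrow>
       \<exists>\<kappa>. l = \<kappa> *s \<alpha> + axis j 1"
    and \<alpha>: "mi_deg \<alpha> \<ge> 1" and k: "k \<ge> 1" and d: "d \<ge> mi_deg \<alpha> * k + 2" and c: "\<And>i. c $ i \<noteq> 0"
    and nf: "normal_form F lam M \<alpha> k a c d X g"
  shows "\<exists>X g. normal_form F lam M \<alpha> k a c (Suc d) X g"
proof -
  define u where "u z = mi_pow (X z) \<alpha>" for z
  define R where "R j z = X (F z) $ j - X z $ j * (lam $ j + a $ j * u z ^ k + u z ^ (k + 1) * g j z)" for j z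
  have X: "holomorphic_germ (\<lambda>z. X z $ i)" "agree 1 (\<lambda>z. X z $ i) (\<lambda>z. c $ i * z $ i)"
    "i \<notin> M \<Longrightarrow> X z $ i = z $ i" for i z
    using nf by (auto simp: normal_form_def)
  have g: "j \<in> M \<Longrightarrow> holomorphic_germ (g j)" and ordR: "j \<in> M \<Longrightarrow> R j \<in> ord_germs d" for j
    using nf by (auto simp: normal_form_def R_def [abs_def] u_def [abs_def])
  have X1: "(\<lambda>z. X z $ i) \<in> ord_germs 1" for i using X(2) agree_ord by blast
  have holu: "holomorphic_germ u"
    unfolding u_def by (intro holomorphic_germ_mi_pow X)
  have holR: "holomorphic_germ (R j)" if "j \<in> M" for j
    unfolding R_def
    by (intro holomorphic_germ_intros holu g [OF that] X holomorphic_germ_compose [OF X(1) F])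
  have "\<forall>j\<in>M. \<exists>L b. finite L \<and> (\<forall>l\<in>L. mi_deg l = d) \<and>
      (\<lambda>z. R j z - (\<Sum>l\<in>L. b l * mi_pow z l)) \<in> ord_germs (Suc d)"
  proof
    fix j assume j: "j \<in> M"
    show "\<exists>L b. finite L \<and> (\<forall>l\<in>L. mi_deg l = d) \<and>
      (\<lambda>z. R j z - (\<Sum>l\<in>L. b l * mi_pow z l)) \<in> ord_germs (Suc d)"
      by (rule holomorphic_leading_term [OF holR [OF j] ordR [OF j]]) auto
  qed
  from bchoice_pair [OF this] obtain L b
    where Lb': "\<forall>j\<in>M. finite (L j) \<and> (\<forall>l\<in>L j. mi_deg l = d) \<and>
      (\<lambda>z. R j z - (\<Sum>l\<in>L j. b j l * mi_pow z l)) \<in> ord_germs (Suc d)"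
    by (elim exE that)
  have Lb: "j \<in> M \<Longrightarrow> finite (L j)" "j \<in> M \<Longrightarrow> l \<in> L j \<Longrightarrow> mi_deg l = d"
    "j \<in> M \<Longrightarrow> (\<lambda>z. R j z - (\<Sum>l\<in>L j. b j l * mi_pow z l)) \<in> ord_germs (Suc d)" for j l
    using bspec [OF Lb', of j] by simp_all
  \<comment> \<open>Off resonance, \<open>\<beta>\<close> solves
    \<open>b + \<beta> \<lambda>^l - \<lambda>_j \<beta> = 0\<close>; on a resonant monomial the
    divisor vanishes and no correction is made.\<close>
  define \<beta> where "\<beta> j l = (if lam $ j = mi_pow lam l then 0 else b j l / (lam $ j - mi_pow lam l))" for j l
  define Q where "Q j z = (\<Sum>l\<in>L j. \<beta> j l * mi_pow z l)" for j z
  define Y where "Y z = (\<chi> i. if i \<in> M then X z $ i + Q i z else z $ i)" for z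
  define v where "v z = mi_pow (Y z) \<alpha>" for z
  define S where "S j = {l\<in>L j. lam $ j = mi_pow lam l}" for j
  \<comment> \<open>Comparison of degrees: \<open>\<kappa> * mi_deg \<alpha> + 1 = d \<ge> mi_deg
    \<alpha> * k + 2\<close>. Hence a resonant term contains the factor \<open>u ^ (k + 1)\<close>
    and does not disturb the coefficient of \<open>u ^ k\<close>.\<close>
  have S: "\<exists>\<kappa>. l = \<kappa> *s \<alpha> + axis j 1 \<and> \<kappa> > k" if "j \<in> M" "l \<in> S j" for j l
  proof -
    have "mi_deg l = d" "lam $ j = mi_pow lam l" using that Lb(2) by (auto simp: S_def)
    moreover from this have "mi_deg l \<ge> 2" using d by simp
    ultimately obtain \<kappa> where \<kappa>: "l = \<kappa> *s \<alpha> + axis j 1" using res [OF \<open>j \<in> M\<close>] by blast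
    then have "\<kappa> * mi_deg \<alpha> + 1 \<ge> mi_deg \<alpha> * k + 2"
      using \<open>mi_deg l \<ge> 2\<close> \<open>mi_deg l = d\<close> d by (simp add: mi_deg_add_axis [simplified] mi_deg_scalar)
    then have "k * mi_deg \<alpha> < \<kappa> * mi_deg \<alpha>" unfolding mult.commute [of k] by linarith
    then have "\<kappa> > k" by (rule mult_less_cancel2 [THEN iffD1, THEN conjunct2])
    then show ?thesis using \<kappa> by blast
  qed
  define \<kappa> where "\<kappa> j l = (SOME \<kappa>. l = \<kappa> *s \<alpha> + axis j 1 \<and> \<kappa> > k)" for j l
  have \<kappa>: "l = \<kappa> j l *s \<alpha> + axis j 1 \<and> \<kappa> j l > k" if "j \<in> M" "l \<in> S j" for j l
    unfolding \<kappa>_def by (rule someI_ex) (rule S [OF that])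
  \<comment> \<open>Division by \<open>mi_pow c l\<close> compensates the leading coefficient of the
    monomial in the new coordinates; the natural subtraction is exact because
    \<open>\<kappa> j l > k\<close>.\<close>
  define h where "h j z = (\<Sum>l\<in>S j. b j l / mi_pow c l * v z ^ (\<kappa> j l - (k + 1)))" for j z
  have holQ: "holomorphic_germ (Q j)" if "j \<in> M" for j
    unfolding Q_def using Lb(1) [OF that]
    by (intro holomorphic_germ_sum holomorphic_germ_cmult holomorphic_germ_mi_pow holomorphic_germ_coord)
  have ordQ: "Q j \<in> ord_germs d" if "j \<in> M" for j
    unfolding Q_def using ord_germs_mi_pow Lb(2) [OF that]
    by (intro ord_germs_sum ord_germs_cmult) auto
  have holY: "holomorphic_germ (\<lambda>z. Y z $ i)" for i
    by (cases "i \<in> M") (auto simp: Y_def intro: holomorphic_germ_coord holomorphic_germ_add X holQ)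
  have YX: "(\<lambda>z. Y z $ i - X z $ i) \<in> ord_germs d" for i
    using ordQ [of i] X(3) [of i] by (cases "i \<in> M") (auto simp: Y_def ord_germs_zero)
  have Y: "agree 1 (\<lambda>z. Y z $ i) (\<lambda>z. c $ i * z $ i)" for i
  proof -
    have "(\<lambda>z. (Y z $ i - X z $ i) + (X z $ i - c $ i * z $ i)) \<in> ord_germs 2"
      using X(2) [of i] ord_germs_mono [OF YX, of 2] d
      by (intro ord_germs_add) (auto simp: agree_def numeral_2_eq_2)
    then show ?thesis using X(2) [of i] by (simp add: agree_def numeral_2_eq_2)
  qed
  have Y1: "(\<lambda>z. Y z $ i) \<in> ord_germs 1" for i using Y agree_ord by blast
  have X0: "(\<lambda>z. X z $ i) \<in> ord_germs 0" and Y0: "(\<lambda>z. Y z $ i) \<in> ord_germs 0" for i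
    using X1 Y1 ord_germs_mono by blast+
  have holv: "holomorphic_germ v"
    unfolding v_def by (intro holomorphic_germ_mi_pow holY)
  have vu: "(\<lambda>z. v z - u z) \<in> ord_germs d"
    unfolding v_def u_def by (intro ord_germs_diff_mi_pow YX X0 Y0)
  have v1: "v \<in> ord_germs 1"
    using agree_ord [OF agree_mi_pow [OF Y, of \<alpha>]] ord_germs_mono \<alpha> by (auto simp: v_def [abs_def])
  \<comment> \<open>The changes of coordinate and of monomial have order \<open>d\<close>, and each
    is multiplied by a factor vanishing at 0, so the nonlinear terms notice the change of
    coordinates only at order \<open>d + 1\<close>.\<close>
  have diff: "(\<lambda>z. Y z $ j * v z ^ e - X z $ j * u z ^ e) \<in> ord_germs (Suc d)" if "e \<ge> 1" for j e
  proof -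
    have "(\<lambda>z. v z ^ e - u z ^ e) \<in> ord_germs d"
      using ord_germs_diff_power [OF vu holomorphic_germ_bounded [OF holv] holomorphic_germ_bounded [OF holu]]
      by blast
    moreover have "(\<lambda>z. v z ^ e) \<in> ord_germs 1"
    proof -
      obtain e' where e': "e = Suc e'" using \<open>e \<ge> 1\<close> by (cases e) auto
      have "(\<lambda>z. v z ^ e' * v z) \<in> ord_germs 1"
        by (intro ord_germs_bounded_mult holomorphic_germ_bounded holomorphic_germ_power holv v1)
      then show ?thesis by (simp add: e' mult.commute)
    qed
    ultimately have "(\<lambda>z. Y z $ j * v z ^ e - X z $ j * u z ^ e) \<in> ord_germs (d + 1)"
      by (intro ord_germs_diff_mult YX X1) auto
    then show ?thesis by simp
  qed
  have "holomorphic_germ (\<lambda>z. g j z + h j z)" if "j \<in> M" for j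
    unfolding h_def S_def using Lb(1) [OF that]
    by (intro holomorphic_germ_intros g [OF that] holv) auto
  moreover have "(\<lambda>z. Y (F z) $ j - Y z $ j * (lam $ j + a $ j * v z ^ k + v z ^ (k + 1) * (g j z + h j z)))
      \<in> ord_germs (Suc d)" if j: "j \<in> M" for j
  proof -
    \<comment> \<open>\<open>T1\<close> is the remainder after its leading part, \<open>T2\<close>
      the correction composed with \<open>F\<close> minus its leading part, \<open>T3\<close> and
      \<open>T4\<close> the effect of the new coordinates on the old nonlinear terms, and
      \<open>T5\<close> the error in absorbing the resonant part.\<close>
    define T1 where "T1 z = R j z - (\<Sum>l\<in>L j. b j l * mi_pow z l)" for z
    define T2 where "T2 z = Q j (F z) - (\<Sum>l\<in>L j. \<beta> j l * (mi_pow lam l * mi_pow z l))" for z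
    define T3 where "T3 z = a $ j * (Y z $ j * v z ^ k - X z $ j * u z ^ k)" for z
    define T4 where "T4 z = g j z * (Y z $ j * v z ^ (k + 1) - X z $ j * u z ^ (k + 1))" for z
    define T5 where "T5 z = Y z $ j * v z ^ (k + 1) * h j z - (\<Sum>l\<in>S j. b j l * mi_pow z l)" for z
    have T1: "T1 \<in> ord_germs (Suc d)" using Lb(3) [OF j] by (simp add: T1_def [abs_def])
    have "(\<lambda>z. \<Sum>l\<in>L j. \<beta> j l * (mi_pow (F z) l - mi_pow lam l * mi_pow z l)) \<in> ord_germs (Suc d)"
    proof (intro ord_germs_sum ord_germs_cmult)
      fix l assume "l \<in> L j"
      then show "(\<lambda>z. mi_pow (F z) l - mi_pow lam l * mi_pow z l) \<in> ord_germs (Suc d)"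
        using agree_mi_pow [OF Flin, of l] Lb(2) [OF j] by (simp add: agree_def)
    qed
    then have T2: "T2 \<in> ord_germs (Suc d)"
      by (simp add: T2_def [abs_def] Q_def right_diff_distrib sum_subtractf)
    have T3: "T3 \<in> ord_germs (Suc d)"
      unfolding T3_def by (intro ord_germs_cmult diff k)
    have T4: "T4 \<in> ord_germs (Suc d)"
      unfolding T4_def by (intro ord_germs_bounded_mult holomorphic_germ_bounded g j diff) simp
    have "(\<lambda>z. \<Sum>l\<in>S j. b j l / mi_pow c l * (mi_pow (Y z) l - mi_pow c l * mi_pow z l)) \<in> ord_germs (Suc d)"
    proof (intro ord_germs_sum ord_germs_cmult)
      fix l assume "l \<in> S j"
      then show "(\<lambda>z. mi_pow (Y z) l - mi_pow c l * mi_pow z l) \<in> ord_germs (Suc d)"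
        using agree_mi_pow [OF Y, of l] Lb(2) [OF j] by (simp add: agree_def S_def)
    qed
    also have "(\<lambda>z. \<Sum>l\<in>S j. b j l / mi_pow c l * (mi_pow (Y z) l - mi_pow c l * mi_pow z l)) = T5"
    proof
      fix z
      have "Y z $ j * v z ^ (k + 1) * h j z = (\<Sum>l\<in>S j. b j l / mi_pow c l * mi_pow (Y z) l)"
        unfolding h_def sum_distrib_left
      proof (rule sum.cong)
        fix l assume l: "l \<in> S j"
        have "mi_pow (Y z) l = v z ^ \<kappa> j l * Y z $ j"
          by (subst \<kappa> [OF j l, THEN conjunct1]) (simp add: mi_pow_add mi_pow_axis [simplified] mi_pow_scalar v_def)
        also have "\<kappa> j l = (k + 1) + (\<kappa> j l - (k + 1))" using \<kappa> [OF j l] by simp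
        then have "v z ^ \<kappa> j l = v z ^ (k + 1) * v z ^ (\<kappa> j l - (k + 1))"
          by (metis power_add)
        finally show "Y z $ j * v z ^ (k + 1) * (b j l / mi_pow c l * v z ^ (\<kappa> j l - (k + 1))) =
            b j l / mi_pow c l * mi_pow (Y z) l"
          by (simp add: ac_simps)
      qed simp
      moreover have "mi_pow c l \<noteq> 0" for l using c by (simp add: mi_pow_def)
      ultimately show "(\<Sum>l\<in>S j. b j l / mi_pow c l * (mi_pow (Y z) l - mi_pow c l * mi_pow z l)) = T5 z"
        by (simp add: T5_def right_diff_distrib sum_subtractf)
    qed
    finally have T5: "T5 \<in> ord_germs (Suc d)" .
    have cancel: "(\<Sum>l\<in>L j. b j l * mi_pow z l) + (\<Sum>l\<in>L j. \<beta> j l * (mi_pow lam l * mi_pow z l))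
        - lam $ j * Q j z - (\<Sum>l\<in>S j. b j l * mi_pow z l) = 0" for z
    proof -
      have "(\<Sum>l\<in>S j. b j l * mi_pow z l) = (\<Sum>l\<in>L j. if lam $ j = mi_pow lam l then b j l * mi_pow z l else 0)"
        unfolding S_def using Lb(1) [OF j] by (rule sum.inter_filter)
      then have "(\<Sum>l\<in>L j. b j l * mi_pow z l) + (\<Sum>l\<in>L j. \<beta> j l * (mi_pow lam l * mi_pow z l))
        - lam $ j * Q j z - (\<Sum>l\<in>S j. b j l * mi_pow z l) =
        (\<Sum>l\<in>L j. b j l * mi_pow z l + \<beta> j l * (mi_pow lam l * mi_pow z l) - lam $ j * (\<beta> j l * mi_pow z l)
           - (if lam $ j = mi_pow lam l then b j l * mi_pow z l else 0))"
        by (simp add: Q_def sum.distrib sum_subtractf sum_distrib_left)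
      also have "\<dots> = 0"
      proof (rule sum.neutral, rule ballI)
        fix l
        have "b j l + \<beta> j l * mi_pow lam l - lam $ j * \<beta> j l - (if lam $ j = mi_pow lam l then b j l else 0) = 0"
        proof (cases "lam $ j = mi_pow lam l")
          case False
          then have "\<beta> j l * (lam $ j - mi_pow lam l) = b j l" by (simp add: \<beta>_def)
          then show ?thesis using False by (simp add: algebra_simps)
        qed (simp add: \<beta>_def)
        then have "(b j l + \<beta> j l * mi_pow lam l - lam $ j * \<beta> j l - (if lam $ j = mi_pow lam l then b j l else 0))
          * mi_pow z l = 0" by simp
        then show "b j l * mi_pow z l + \<beta> j l * (mi_pow lam l * mi_pow z l) - lam $ j * (\<beta> j l * mi_pow z l)
           - (if lam $ j = mi_pow lam l then b j l * mi_pow z l else 0) = 0"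
          by (simp add: algebra_simps split: if_splits)
      qed
      finally show ?thesis .
    qed
    have "Y (F z) $ j - Y z $ j * (lam $ j + a $ j * v z ^ k + v z ^ (k + 1) * (g j z + h j z)) =
        T1 z + T2 z - T3 z - T4 z - T5 z" for z
    proof -
      have "Y (F z) $ j = X (F z) $ j + Q j (F z)" "Y z $ j = X z $ j + Q j z"
        using j by (simp_all add: Y_def)
      then show ?thesis
        unfolding T1_def T2_def T3_def T4_def T5_def R_def
        by (simp only: homological_identity [OF cancel])
    qed
    then show ?thesis
      using T1 T2 T3 T4 T5 by (simp only:) (intro ord_germs_add ord_germs_diff)
  qed
  ultimately have "normal_form F lam M \<alpha> k a c (Suc d) Y (\<lambda>j z. g j z + h j z)"
    using holY Y by (auto simp: normal_form_def v_def Y_def)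
  then show ?thesis by blast
qed

lemma normal_form_exists:
  fixes F :: "complex ^ 'n \<Rightarrow> complex ^ 'n"
  assumes F: "holomorphic_map_on F U" "0 \<in> U" "F 0 = 0"
    and Flin: "\<And>i. agree 1 (\<lambda>z. F z $ i) (\<lambda>z. lam $ i * z $ i)"
    and res: "\<And>j l. j \<in> M \<Longrightarrow> mi_deg l \<ge> 2 \<Longrightarrow> lam $ j = mi_pow lam l \<Longrightarrow>
       \<exists>\<kappa>. l = \<kappa> *s \<alpha> + axis j 1"
    and \<alpha>: "mi_deg \<alpha> \<ge> 1" and k: "k \<ge> 1" and c: "\<And>i. c $ i \<noteq> 0"
    and nf: "\<exists>X g. normal_form F lam M \<alpha> k a c (mi_deg \<alpha> * k + 2) X g"
    and d: "d \<ge> mi_deg \<alpha> * k + 2"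
  shows "\<exists>X g. normal_form F lam M \<alpha> k a c d X g"
  using d
proof (induction d rule: dec_induct)
  case base
  show ?case by (rule nf)
next
  case (step d)
  then show ?case using normal_form_step [OF F Flin res \<alpha> k _ c] by blast
qed

section \<open>Consequences of one-resonance and the initial normal form\<close>

lemma ord_germs_2_derivative:
  fixes f :: "'a :: real_normed_vector \<Rightarrow> complex"
  assumes "f \<in> ord_germs 2"
  shows "(f has_derivative (\<lambda>_. 0)) (at 0)"
proof -
  obtain C r where C: "C > 0" "r > 0" "\<And>z. norm z < r \<Longrightarrow> norm (f z) \<le> C * norm z ^ 2"
    using assms unfolding ord_germs_iff by blast
  have f0: "f 0 = 0" using C(3) [of 0] C(2) by simp
  have "\<exists>d>0. \<forall>y. norm (y - 0) < d \<longrightarrow> norm (f y - f 0 - 0) \<le> e * norm (y - 0)" if e: "e > 0" for e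
  proof (intro exI [of _ "min r (e / C)"] conjI allI impI)
    fix y :: 'a assume y: "norm (y - 0) < min r (e / C)"
    then have "C * norm y * norm y \<le> e * norm y"
      using C(1) by (intro mult_right_mono) (auto simp: field_simps)
    then show "norm (f y - f 0 - 0) \<le> e * norm (y - 0)"
      using C(3) [of y] y f0 by (simp add: power2_eq_square mult.assoc)
  qed (use C e in auto)
  then show ?thesis unfolding has_derivative_at_alt by simp
qed

lemma ord_germs_cong:
  assumes "f \<in> ord_germs d" "\<forall>\<^sub>F z in nhds 0. f z = g z"
  shows "g \<in> ord_germs d"
  using assms landau_o.big.in_cong [of f g "nhds 0"] by (simp add: ord_germs_def)

lemma agree_linear:
  assumes hol: "holomorphic_germ f" and "f 0 = 0"
    and der: "(f has_derivative (\<lambda>v. c * v $ i)) (at 0)"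
  shows "agree 1 f (\<lambda>z. c * z $ i)"
proof -
  have z: "((\<lambda>z. c * z $ i) has_derivative (\<lambda>v. c * v $ i)) (at 0)"
    by (intro bounded_linear_imp_has_derivative bounded_linear_const_mult bounded_linear_vec_nth)
  have "((\<lambda>z. f z - c * z $ i) has_derivative (\<lambda>v. c * v $ i - c * v $ i)) (at 0)"
    by (rule has_derivative_diff [OF der z])
  then have "((\<lambda>z. f z - c * z $ i) has_derivative (\<lambda>_. 0)) (at 0)"
    by simp
  then have "(\<lambda>z. f z - c * z $ i) \<in> ord_germs 2"
    by (intro holomorphic_germ_ord_2 holomorphic_germ_intros holomorphic_germ_cmult hol) (use assms(2) in auto)
  moreover have "(\<lambda>z. c * z $ i) \<in> ord_germs 1"
    using differentiable_ord_germs [OF z] by simp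
  ultimately show ?thesis by (simp add: agree_def numeral_2_eq_2)
qed

text \<open>Distinctness of the eigenvalues in \<open>M\<close> is a hidden consequence of
  one-resonance; it is needed to diagonalize the relevant rows of the linear part of the given
  coordinates.\<close>

lemma one_resonant_facts:
  assumes "one_resonant lam M \<alpha>"
  shows one_resonant_deg: "mi_deg \<alpha> \<ge> 1"
    and one_resonant_off: "j \<notin> M \<Longrightarrow> \<alpha> $ j = 0"
    and one_resonant_cases: "j \<in> M \<Longrightarrow> mi_deg l \<ge> 2 \<Longrightarrow> lam $ j = mi_pow lam l \<Longrightarrow>
      \<exists>\<kappa>\<ge>1. l = \<kappa> *s \<alpha> + axis j 1"
    and one_resonant_eigenvalue: "j \<in> M \<Longrightarrow> lam $ j \<noteq> 0 \<Longrightarrow> mi_pow lam \<alpha> = 1"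
    and one_resonant_distinct: "i \<in> M \<Longrightarrow> j \<in> M \<Longrightarrow> lam $ i \<noteq> 0 \<Longrightarrow> lam $ i = lam $ j \<Longrightarrow> i = j"
proof -
  have "\<alpha> \<noteq> 0" using assms by (simp add: one_resonant_def)
  then obtain i where "\<alpha> $ i \<noteq> 0" by (auto simp: vec_eq_iff)
  moreover have "\<alpha> $ i \<le> mi_deg \<alpha>"
    unfolding mi_deg_def by (rule member_le_sum) auto
  ultimately show deg: "mi_deg \<alpha> \<ge> 1" by simp
  show "\<alpha> $ j = 0" if "j \<notin> M" for j using assms that by (simp add: one_resonant_def)
  have eq: "{(j, l). j \<in> M \<and> resonance lam j l} = {(j, k *s \<alpha> + axis j 1) | j k. j \<in> M \<and> k \<ge> 1}"
    using assms by (simp add: one_resonant_def)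
  show cases: "\<exists>\<kappa>\<ge>1. l = \<kappa> *s \<alpha> + axis j 1"
    if "j \<in> M" "mi_deg l \<ge> 2" "lam $ j = mi_pow lam l" for j l
  proof -
    have "(j, l) \<in> {(j, l). j \<in> M \<and> resonance lam j l}" using that by (simp add: resonance_def)
    then show ?thesis unfolding eq by auto
  qed
  have basic: "lam $ j = mi_pow lam \<alpha> * lam $ j" if "j \<in> M" for j
  proof -
    have "(j, 1 *s \<alpha> + axis j 1) \<in> {(j, k *s \<alpha> + axis j 1) | j k. j \<in> M \<and> k \<ge> 1}"
      using that by blast
    then have "resonance lam j (1 *s \<alpha> + axis j 1)" unfolding eq [symmetric] by simp
    then show ?thesis
      by (simp add: resonance_def mi_pow_add mi_pow_axis [simplified] mi_pow_scalar [of _ "Suc 0", simplified])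
  qed
  show ev: "mi_pow lam \<alpha> = 1" if "j \<in> M" "lam $ j \<noteq> 0" for j
    using basic [OF that(1)] that(2) by simp
  show "i = j" if "i \<in> M" "j \<in> M" "lam $ i \<noteq> 0" "lam $ i = lam $ j" for i j
  proof (rule ccontr)
    assume "i \<noteq> j"
    \<comment> \<open>Since \<open>\<lambda>^\<alpha> = 1\<close>, equal eigenvalues would make
      \<open>\<alpha> + e_i\<close> a resonance for \<open>j\<close>. It would then equal
      \<open>\<kappa> \<alpha> + e_j\<close>, and the \<open>j\<close>-th entries give
      \<open>\<alpha>_j = \<kappa> \<alpha>_j + 1\<close> with
      \<open>\<kappa> \<ge> 1\<close>.\<close>
    have "lam $ j = mi_pow lam (\<alpha> + axis i 1)"
      using ev [OF that(1,3)] that(4) by (simp add: mi_pow_add mi_pow_axis [simplified])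
    moreover have "mi_deg (\<alpha> + axis i 1) \<ge> 2"
      using deg by (simp add: mi_deg_add_axis [simplified])
    ultimately obtain \<kappa> where \<kappa>: "\<kappa> \<ge> 1" "\<alpha> + axis i 1 = \<kappa> *s \<alpha> + axis j 1"
      using cases [OF \<open>j \<in> M\<close>] by blast
    have "(\<alpha> + axis i 1) $ j = (\<kappa> *s \<alpha> + axis j 1) $ j" by (simp only: \<kappa>(2))
    then have "\<alpha> $ j = \<kappa> * \<alpha> $ j + 1" using \<open>i \<noteq> j\<close> by (simp add: axis_def)
    moreover have "1 * \<alpha> $ j \<le> \<kappa> * \<alpha> $ j" using \<kappa>(1) by (rule mult_right_mono) simp
    ultimately show False by simp
  qed
qed

lemma mi_pow_cong:
  assumes "\<And>i. l $ i \<noteq> 0 \<Longrightarrow> x $ i = y $ i"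
  shows "mi_pow x l = mi_pow y l"
proof -
  have "x $ i ^ l $ i = y $ i ^ l $ i" for i using assms [of i] by (cases "l $ i = 0") auto
  then show ?thesis by (simp add: mi_pow_def)
qed

text \<open>To first order the components of \<open>\<phi>\<close> in \<open>M\<close> intertwine
  the differential with its diagonal entries, and \<open>\<lambda>_j\<close> with \<open>j\<close>
  in \<open>M\<close> differs from every other eigenvalue. So these rows of the derivative of
  \<open>\<phi>\<close> are already diagonal. Keeping \<open>z $ i\<close> for the other indices
  leaves \<open>u\<close> unchanged, because \<open>\<alpha>\<close> is supported in
  \<open>M\<close>.\<close>

lemma leading_form_normal_form:
  fixes F :: "complex ^ 'n \<Rightarrow> complex ^ 'n"
  assumes F: "holomorphic_map_on F U" "0 \<in> U" "F 0 = 0"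
    and der: "(F has_derivative (\<lambda>v. \<chi> i. lam $ i * v $ i)) (at 0)"
    and res: "one_resonant lam M \<alpha>"
    and lf: "has_leading_form F lam M \<alpha> k a"
    and M: "\<And>j. j \<in> M \<Longrightarrow> norm (lam $ j) = 1" and N: "\<And>j. j \<notin> M \<Longrightarrow> norm (lam $ j) < 1"
  shows "\<exists>c. (\<forall>i. c $ i \<noteq> 0) \<and> (\<exists>X g. normal_form F lam M \<alpha> k a c (mi_deg \<alpha> * k + 2) X g)"
proof -
  obtain \<phi> \<psi> where bih: "biholomorphic_germs \<phi> \<psi>" and k: "k \<ge> 1"
    and form: "\<And>j. j \<in> M \<Longrightarrow> (\<lambda>w. \<phi> (F (\<psi> w)) $ j
                 - (lam $ j * w $ j + a $ j * mi_pow w (k *s \<alpha>) * w $ j)) \<in> ord_germs (mi_deg \<alpha> * k + 2)"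
    using lf unfolding has_leading_form_def ord_germs_def by blast
  obtain U' V' where \<phi>: "\<phi> 0 = 0" "0 \<in> U'" "holomorphic_map_on \<phi> U'" "holomorphic_map_on \<psi> V'"
    "homeomorphism U' V' \<phi> \<psi>"
    using bih unfolding biholomorphic_germs_def by blast
  have V': "0 \<in> V'" "open V'" and U': "open U'"
    using \<phi> by (auto simp: homeomorphism_def holomorphic_map_on_def)
  have inv: "\<psi> (\<phi> z) = z" if "z \<in> U'" for z using \<phi>(5) that by (simp add: homeomorphism_def)
  have inv': "\<phi> (\<psi> w) = w" if "w \<in> V'" for w using \<phi>(5) that by (simp add: homeomorphism_def)
  have \<psi>0: "\<psi> 0 = 0" using inv [OF \<phi>(2)] \<phi>(1) by simp
  obtain A where A: "(\<phi> has_derivative (\<lambda>v. A *v v)) (at 0)"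
    using \<phi> by (auto simp: holomorphic_map_on_def)
  obtain B where B: "(\<psi> has_derivative (\<lambda>v. B *v v)) (at 0)"
    using \<phi> V' by (auto simp: holomorphic_map_on_def)
  have hol\<phi>: "holomorphic_germ (\<lambda>z. \<phi> z $ j)" for j
    by (rule holomorphic_germ_component [OF \<phi>(3,2)])
  have \<phi>1: "(\<lambda>z. \<phi> z $ j) \<in> ord_germs 1" for j
    by (rule holomorphic_germ_ord_1 [OF hol\<phi>]) (simp add: \<phi>)
  have n\<phi>: "(\<lambda>z. of_real (norm (\<phi> z))) \<in> ord_germs 1"
    by (rule norm_ord_germs [OF \<phi>1])
  have ev: "\<forall>\<^sub>F z in nhds 0. z \<in> U'" using U' \<phi>(2) by (rule eventually_nhds_in_open)
  have form': "(\<lambda>z. \<phi> (F z) $ j - (lam $ j * \<phi> z $ j + a $ j * mi_pow (\<phi> z) (k *s \<alpha>) * \<phi> z $ j))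
      \<in> ord_germs (mi_deg \<alpha> * k + 2)" if j: "j \<in> M" for j
    by (rule ord_germs_cong [OF ord_germs_compose [OF form [OF j] n\<phi>]])
       (rule eventually_mono [OF ev], simp add: inv)
  have row: "A $ j $ i = 0" if j: "j \<in> M" and "i \<noteq> j" for i j
  proof -
    have "(\<lambda>z. mi_pow (\<phi> z) (k *s \<alpha>)) \<in> ord_germs 1"
      using ord_germs_mono [OF ord_germs_compose [OF ord_germs_mi_pow n\<phi>, of "k *s \<alpha>"], of 1]
        k one_resonant_deg [OF res] by (simp add: mi_deg_scalar)
    then have "(\<lambda>z. mi_pow (\<phi> z) (k *s \<alpha>) * \<phi> z $ j) \<in> ord_germs (1 + 1)"
      by (intro ord_germs_mult \<phi>1)
    then have "(\<lambda>z. a $ j * (mi_pow (\<phi> z) (k *s \<alpha>) * \<phi> z $ j)) \<in> ord_germs 2"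
      unfolding one_add_one by (rule ord_germs_cmult)
    moreover have "(\<lambda>z. \<phi> (F z) $ j - (lam $ j * \<phi> z $ j + a $ j * mi_pow (\<phi> z) (k *s \<alpha>) * \<phi> z $ j))
      \<in> ord_germs 2" using ord_germs_mono [OF form' [OF j]] by simp
    ultimately have "(\<lambda>z. \<phi> (F z) $ j - (lam $ j * \<phi> z $ j + a $ j * mi_pow (\<phi> z) (k *s \<alpha>) * \<phi> z $ j)
      + a $ j * (mi_pow (\<phi> z) (k *s \<alpha>) * \<phi> z $ j)) \<in> ord_germs 2"
      by (rule ord_germs_add [rotated])
    then have "(\<lambda>z. \<phi> (F z) $ j - lam $ j * \<phi> z $ j) \<in> ord_germs 2"
      by (simp add: algebra_simps)
    then have d0: "((\<lambda>z. \<phi> (F z) $ j - lam $ j * \<phi> z $ j) has_derivative (\<lambda>_. 0)) (at 0)"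
      by (rule ord_germs_2_derivative)
    have d1: "((\<lambda>z. \<phi> (F z) $ j) has_derivative (\<lambda>v. (A *v (\<chi> i. lam $ i * v $ i)) $ j)) (at 0)"
      using A F(3)
      by (intro bounded_linear.has_derivative [OF bounded_linear_vec_nth] has_derivative_compose [OF der]) simp
    have d2: "((\<lambda>z. lam $ j * \<phi> z $ j) has_derivative (\<lambda>v. lam $ j * (A *v v) $ j)) (at 0)"
      by (intro has_derivative_mult_right bounded_linear.has_derivative [OF bounded_linear_vec_nth] A)
    have "(\<lambda>v. (A *v (\<chi> i. lam $ i * v $ i)) $ j - lam $ j * (A *v v) $ j) = (\<lambda>_. 0)"
      by (rule has_derivative_unique [OF has_derivative_diff [OF d1 d2] d0])
    from fun_cong [OF this, of "axis i 1"] have "A $ j $ i * lam $ i - lam $ j * A $ j $ i = 0"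
      by (simp add: matrix_vector_mult_def axis_def if_distrib [of "(*) _"] cong: if_cong)
    then have "A $ j $ i * (lam $ i - lam $ j) = 0" by (simp add: algebra_simps)
    \<comment> \<open>Inside \<open>M\<close> this is the distinctness forced by one-resonance;
      outside \<open>M\<close> the moduli differ.\<close>
    moreover have "lam $ i \<noteq> lam $ j"
    proof (cases "i \<in> M")
      case True
      then have "lam $ i \<noteq> 0" using M by force
      then show ?thesis using one_resonant_distinct [OF res True j] \<open>i \<noteq> j\<close> by blast
    next
      case False
      then show ?thesis using N [of i] M [of j] j by auto
    qed
    ultimately show ?thesis by simp
  qed
  have Aj: "(A *v v) $ j = A $ j $ j * v $ j" if "j \<in> M" for j v
  proof -
    have "(A *v v) $ j = (\<Sum>i\<in>UNIV. if i = j then A $ j $ j * v $ j else 0)"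
      unfolding matrix_vector_mult_def vec_lambda_beta
      by (rule sum.cong) (auto simp: row [OF that])
    then show ?thesis by simp
  qed
  \<comment> \<open>The derivative \<open>A\<close> is inverted by that of \<open>\<psi>\<close>,
    and a diagonal row of an invertible matrix has a nonzero diagonal entry.\<close>
  have Ajj: "A $ j $ j \<noteq> 0" if j: "j \<in> M" for j
  proof -
    have "((\<lambda>w. \<phi> (\<psi> w)) has_derivative (\<lambda>v. A *v (B *v v))) (at 0)"
      using A \<psi>0 by (intro has_derivative_compose [OF B]) simp
    moreover have "((\<lambda>w. \<phi> (\<psi> w)) has_derivative (\<lambda>v. v)) (at 0)"
      by (rule has_derivative_transform_within_open [OF has_derivative_ident V'(2,1)]) (simp add: inv')
    ultimately have "(\<lambda>v. A *v (B *v v)) = (\<lambda>v. v)" by (rule has_derivative_unique)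
    from fun_cong [OF this, of "axis j 1"] have "(A *v (B *v axis j 1)) $ j = 1" by simp
    then show ?thesis by (auto simp: Aj [OF j])
  qed
  define c where "c = (\<chi> i. if i \<in> M then A $ i $ i else 1)"
  define X where "X z = (\<chi> i. if i \<in> M then \<phi> z $ i else z $ i)" for z
  have "\<forall>i. c $ i \<noteq> 0" by (simp add: c_def Ajj)
  moreover have "normal_form F lam M \<alpha> k a c (mi_deg \<alpha> * k + 2) X (\<lambda>j z. 0)"
    unfolding normal_form_def
  proof (intro conjI allI impI ballI)
    fix i
    show "holomorphic_germ (\<lambda>z. X z $ i)"
      by (cases "i \<in> M") (simp_all add: X_def hol\<phi> holomorphic_germ_coord)
    show "agree 1 (\<lambda>z. X z $ i) (\<lambda>z. c $ i * z $ i)"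
    proof (cases "i \<in> M")
      case True
      have "((\<lambda>z. \<phi> z $ i) has_derivative (\<lambda>v. (A *v v) $ i)) (at 0)"
        by (intro bounded_linear.has_derivative [OF bounded_linear_vec_nth] A)
      then have "agree 1 (\<lambda>z. \<phi> z $ i) (\<lambda>z. A $ i $ i * z $ i)"
        by (intro agree_linear hol\<phi>) (simp_all add: \<phi>(1) Aj [OF True])
      then show ?thesis using True by (simp add: X_def c_def)
    next
      case False
      then show ?thesis
        using holomorphic_germ_ord_1 [OF holomorphic_germ_coord, of i]
        by (simp add: X_def c_def agree_def ord_germs_zero)
    qed
    show "X z $ i = z $ i" if "i \<notin> M" for z using that by (simp add: X_def)
  next
    fix j assume j: "j \<in> M"
    have "mi_pow (X z) (k *s \<alpha>) = mi_pow (\<phi> z) (k *s \<alpha>)" for z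
      by (rule mi_pow_cong) (use one_resonant_off [OF res] in \<open>auto simp: X_def\<close>)
    then show "(\<lambda>z. X (F z) $ j - X z $ j *
         (lam $ j + a $ j * mi_pow (X z) \<alpha> ^ k + mi_pow (X z) \<alpha> ^ (k + 1) * 0)) \<in> ord_germs (mi_deg \<alpha> * k + 2)"
      using form' [OF j] j by (simp add: X_def mi_pow_scalar algebra_simps)
  qed (rule holomorphic_germ_const)
  ultimately show ?thesis by blast
qed

section \<open>One step of the dynamics\<close>

text \<open>The bound on the linear part is carried through the induction because the cross term
  \<open>(f - 1) * (g - 1)\<close> of two factors is estimated with it. The constant is uniform in
  \<open>\<eta>\<close> and \<open>e\<close>.\<close>

lemma prod_expansion:
  assumes "finite S"
  shows "\<exists>C>0. \<forall>\<eta> e. 0 \<le> e \<longrightarrow> e \<le> 1 \<longrightarrow> (\<forall>i\<in>S. norm (\<eta> i) \<le> e) \<longrightarrow>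
    norm ((\<Prod>i\<in>S. (1 + \<eta> i) ^ n i) - 1 - (\<Sum>i\<in>S. of_nat (n i) * \<eta> i :: complex)) \<le> C * e\<^sup>2 \<and>
    norm (\<Sum>i\<in>S. of_nat (n i) * \<eta> i) \<le> C * e"
proof -
  have mult: "norm (f * g - 1 - (s + s')) \<le> (C + C' + 4 * C * C') * e\<^sup>2 \<and>
      norm (s + s') \<le> (C + C' + 4 * C * C') * e"
    if e: "0 \<le> e" "e \<le> 1" and C: "C > 0" "C' > 0"
      and f: "norm (f - 1 - s) \<le> C * e\<^sup>2" "norm s \<le> C * e"
      and g: "norm (g - 1 - s') \<le> C' * e\<^sup>2" "norm s' \<le> C' * e"
    for f g s s' :: complex and e C C' :: real
  proof
    have sq: "e\<^sup>2 \<le> e" using e by (simp add: power2_eq_square mult_left_le)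
    have "norm (f - 1) \<le> norm (f - 1 - s) + norm s" by (metis diff_add_cancel norm_triangle_ineq)
    also have "\<dots> \<le> C * e + C * e" using f C sq by (intro add_mono) (auto intro: order_trans)
    finally have f1: "norm (f - 1) \<le> 2 * C * e" by simp
    have "norm (g - 1) \<le> norm (g - 1 - s') + norm s'" by (metis diff_add_cancel norm_triangle_ineq)
    also have "\<dots> \<le> C' * e + C' * e" using g C sq by (intro add_mono) (auto intro: order_trans)
    finally have g1: "norm (g - 1) \<le> 2 * C' * e" by simp
    have "f * g - 1 - (s + s') = (f - 1 - s) + (g - 1 - s') + (f - 1) * (g - 1)"
      by (simp add: algebra_simps)
    then have "norm (f * g - 1 - (s + s')) \<le> norm (f - 1 - s) + norm (g - 1 - s') + norm (f - 1) * norm (g - 1)"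
      by (metis norm_mult norm_triangle_le add_mono norm_triangle_ineq order_refl)
    also have "\<dots> \<le> C * e\<^sup>2 + C' * e\<^sup>2 + (2 * C * e) * (2 * C' * e)"
      using f g f1 g1 e C by (intro add_mono mult_mono) auto
    also have "\<dots> = (C + C' + 4 * C * C') * e\<^sup>2"
      by (simp add: algebra_simps power2_eq_square)
    finally show "norm (f * g - 1 - (s + s')) \<le> (C + C' + 4 * C * C') * e\<^sup>2" .
    have "norm (s + s') \<le> C * e + C' * e" using f g norm_triangle_mono by blast
    also have "\<dots> \<le> (C + C' + 4 * C * C') * e"
      using C e by (simp add: algebra_simps)
    finally show "norm (s + s') \<le> (C + C' + 4 * C * C') * e" .
  qed
  have power: "\<exists>C>0. \<forall>\<eta> e. 0 \<le> e \<longrightarrow> e \<le> 1 \<longrightarrow> norm \<eta> \<le> e \<longrightarrow>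
    norm ((1 + \<eta>) ^ m - 1 - of_nat m * \<eta> :: complex) \<le> C * e\<^sup>2 \<and> norm (of_nat m * \<eta>) \<le> C * e" for m
  proof (induction m)
    case 0
    show ?case by (intro exI [of _ "1"]) auto
  next
    case (Suc m)
    then obtain C where C: "C > 0" "\<And>\<eta> e. 0 \<le> e \<Longrightarrow> e \<le> 1 \<Longrightarrow> norm \<eta> \<le> e \<Longrightarrow>
      norm ((1 + \<eta>) ^ m - 1 - of_nat m * \<eta> :: complex) \<le> C * e\<^sup>2 \<and> norm (of_nat m * \<eta>) \<le> C * e" by blast
    show ?case
    proof (intro exI [of _ "1 + C + 4 * 1 * C"] conjI allI impI)
      fix \<eta> :: complex and e :: real assume e: "0 \<le> e" "e \<le> 1" "norm \<eta> \<le> e"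
      have *: "norm ((1 + \<eta>) * (1 + \<eta>) ^ m - 1 - (\<eta> + of_nat m * \<eta>)) \<le> (1 + C + 4 * 1 * C) * e\<^sup>2 \<and>
          norm (\<eta> + of_nat m * \<eta>) \<le> (1 + C + 4 * 1 * C) * e"
        by (rule mult) (use e C in auto)
      then show "norm ((1 + \<eta>) ^ Suc m - 1 - of_nat (Suc m) * \<eta>) \<le> (1 + C + 4 * 1 * C) * e\<^sup>2"
        "norm (of_nat (Suc m) * \<eta>) \<le> (1 + C + 4 * 1 * C) * e"
        by (simp_all add: algebra_simps)
    qed (use C in auto)
  qed
  show ?thesis using assms
  proof (induction S rule: finite_induct)
    case empty
    show ?case by (intro exI [of _ "1"]) auto
  next
    case (insert j S)
    obtain C where C: "C > 0" "\<And>\<eta> e. 0 \<le> e \<Longrightarrow> e \<le> 1 \<Longrightarrow> norm \<eta> \<le> e \<Longrightarrow>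
      norm ((1 + \<eta>) ^ n j - 1 - of_nat (n j) * \<eta> :: complex) \<le> C * e\<^sup>2 \<and> norm (of_nat (n j) * \<eta>) \<le> C * e"
      using power [of "n j"] by blast
    obtain C' where C': "C' > 0" "\<And>\<eta> e. 0 \<le> e \<Longrightarrow> e \<le> 1 \<Longrightarrow> (\<forall>i\<in>S. norm (\<eta> i) \<le> e) \<Longrightarrow>
      norm ((\<Prod>i\<in>S. (1 + \<eta> i) ^ n i) - 1 - (\<Sum>i\<in>S. of_nat (n i) * \<eta> i :: complex)) \<le> C' * e\<^sup>2 \<and>
      norm (\<Sum>i\<in>S. of_nat (n i) * \<eta> i) \<le> C' * e"
      using insert.IH by blast
    show ?case
    proof (rule exI [of _ "C + C' + 4 * C * C'"], intro conjI allI impI)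
      show "0 < C + C' + 4 * C * C'" using C C' by (simp add: add_pos_pos)
      fix \<eta> :: "'a \<Rightarrow> complex" and e :: real
      assume e: "0 \<le> e" "e \<le> 1" "\<forall>i\<in>insert j S. norm (\<eta> i) \<le> e"
      have "norm ((1 + \<eta> j) ^ n j * (\<Prod>i\<in>S. (1 + \<eta> i) ^ n i) - 1 -
           (of_nat (n j) * \<eta> j + (\<Sum>i\<in>S. of_nat (n i) * \<eta> i))) \<le> (C + C' + 4 * C * C') * e\<^sup>2 \<and>
          norm (of_nat (n j) * \<eta> j + (\<Sum>i\<in>S. of_nat (n i) * \<eta> i)) \<le> (C + C' + 4 * C * C') * e"
        by (rule mult) (use e C C' in auto)
      then show "norm ((\<Prod>i\<in>insert j S. (1 + \<eta> i) ^ n i) - 1 - (\<Sum>i\<in>insert j S. of_nat (n i) * \<eta> i))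
            \<le> (C + C' + 4 * C * C') * e\<^sup>2"
          "norm (\<Sum>i\<in>insert j S. of_nat (n i) * \<eta> i) \<le> (C + C' + 4 * C * C') * e"
        using insert.hyps by simp_all
    qed
  qed
qed

text \<open>All other factors have modulus at most 1. Read as a lower bound for
  \<open>x $ j\<close>, this is what permits division by that coordinate when the change of
  \<open>u\<close> is computed.\<close>

lemma mi_pow_le_component:
  assumes "\<And>i. norm (x $ i) \<le> 1" "\<alpha> $ j \<noteq> 0"
  shows "norm (mi_pow x \<alpha>) \<le> norm (x $ j)"
proof -
  have "norm (mi_pow x \<alpha>) = norm (x $ j) ^ \<alpha> $ j * (\<Prod>i\<in>UNIV-{j}. norm (x $ i) ^ \<alpha> $ i)"
    unfolding mi_pow_def prod_norm [symmetric] norm_power by (rule prod.remove) auto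
  also have "\<dots> \<le> norm (x $ j) * 1"
  proof (rule mult_mono)
    show "norm (x $ j) ^ \<alpha> $ j \<le> norm (x $ j)"
      using power_decreasing [of 1 "\<alpha> $ j" "norm (x $ j)"] assms by simp
    show "(\<Prod>i\<in>UNIV-{j}. norm (x $ i) ^ \<alpha> $ i) \<le> 1"
      by (intro prod_le_1) (use assms(1) in \<open>auto intro: power_le_one\<close>)
  qed (auto intro: prod_nonneg)
  finally show ?thesis by simp
qed

text \<open>Only coordinates with \<open>\<alpha> $ j \<noteq> 0\<close> enter \<open>u\<close>, and
  these satisfy \<open>|x_j| \<ge> |u|\<close>, so their relative changes are
  \<open>a_j / \<lambda>_j * u ^ k\<close> up to \<open>O(t powr (-1/k) / t)\<close>. Weighted by
  \<open>\<alpha>\<close> they sum to \<open>\<Lambda> u ^ k\<close>, the eigenvalues cancel as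
  \<open>\<lambda>^\<alpha> = 1\<close>, and \<open>k \<Lambda> u ^ k = - 1 / V\<close>. The
  parameter \<open>t\<close> stands for \<open>Re V\<close> and is comparable to
  \<open>|V|\<close>.\<close>

lemma u_step:
  fixes lam a :: "complex ^ 'n" and \<alpha> :: "nat ^ 'n"
  assumes k: "k \<ge> 1" and \<Lambda>: "\<Lambda> = (\<Sum>j\<in>M. a $ j * of_nat (\<alpha> $ j) / lam $ j)" "\<Lambda> \<noteq> 0"
    and lam: "\<And>j. j \<in> M \<Longrightarrow> norm (lam $ j) = 1" "mi_pow lam \<alpha> = 1"
    and \<alpha>: "\<And>j. j \<notin> M \<Longrightarrow> \<alpha> $ j = 0" and K: "K > 0" and B: "B \<ge> 3"
  shows "\<exists>C\<ge>1. \<forall>x x' \<gamma> V t. t \<ge> C \<longrightarrow> mi_pow x \<alpha> \<noteq> 0 \<longrightarrow>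
     V = -1 / (of_nat k * \<Lambda> * mi_pow x \<alpha> ^ k) \<longrightarrow> t \<le> norm V \<longrightarrow> norm V \<le> 2 * t \<longrightarrow>
     (\<forall>i. norm (x $ i) \<le> 1) \<longrightarrow> (\<forall>j\<in>M. norm (\<gamma> j) \<le> K \<and>
       norm (x' $ j - x $ j * (lam $ j + a $ j * mi_pow x \<alpha> ^ k + mi_pow x \<alpha> ^ (k + 1) * \<gamma> j)) \<le> K * t powr (-B)) \<longrightarrow>
     (\<exists>P. mi_pow x' \<alpha> = mi_pow x \<alpha> * P \<and> norm (P - 1) \<le> C / t \<and>
        norm (P ^ k - (1 - 1 / V)) \<le> C * (t powr (-1/k) / t))"
proof -
  \<comment> \<open>\<open>|u| ^ k = 1 / (L0 * |V|)\<close>, so \<open>|u|\<close> lies between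
    \<open>A'\<close> and \<open>A\<close> times \<open>t powr (-1/k)\<close>. \<open>K3\<close>
    bounds the error of a relative change, \<open>K4\<close> the relative change itself.\<close>
  define L0 where "L0 = k * norm \<Lambda>"
  have L0: "L0 > 0" using k \<Lambda> by (simp add: L0_def)
  define A where "A = (1 / L0) powr (1/k)"
  define A' where "A' = (1 / (2 * L0)) powr (1/k)"
  have A: "A > 0" "A' > 0" using L0 by (auto simp: A_def A'_def)
  define K3 where "K3 = A * K / L0 + K / A'"
  define K4 where "K4 = (\<Sum>j\<in>UNIV. norm (a $ j)) / L0 + K3"
  have K3: "K3 > 0" using A K L0 by (simp add: K3_def add_pos_pos)
  have K4: "K4 > 0" using K3 L0 by (simp add: K4_def add_nonneg_pos sum_nonneg)
  obtain C1 where C1: "C1 > 0" "\<And>\<eta> e. 0 \<le> e \<Longrightarrow> e \<le> 1 \<Longrightarrow> (\<forall>i\<in>(UNIV::'n set). norm (\<eta> i) \<le> e) \<Longrightarrow>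
    norm ((\<Prod>i\<in>UNIV. (1 + \<eta> i) ^ (\<alpha> $ i)) - 1 - (\<Sum>i\<in>UNIV. of_nat (\<alpha> $ i) * \<eta> i :: complex)) \<le> C1 * e\<^sup>2 \<and>
    norm (\<Sum>i\<in>UNIV. of_nat (\<alpha> $ i) * \<eta> i) \<le> C1 * e"
    using prod_expansion [of UNIV "\<lambda>i. \<alpha> $ i"] by auto
  obtain C2 where C2: "C2 > 0" "\<And>\<eta> e. 0 \<le> e \<Longrightarrow> e \<le> 1 \<Longrightarrow> (\<forall>i\<in>(UNIV::'n set). norm (\<eta> i) \<le> e) \<Longrightarrow>
    norm ((\<Prod>i\<in>UNIV. (1 + \<eta> i) ^ (k * \<alpha> $ i)) - 1 - (\<Sum>i\<in>UNIV. of_nat (k * \<alpha> $ i) * \<eta> i :: complex)) \<le> C2 * e\<^sup>2 \<and>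
    norm (\<Sum>i\<in>UNIV. of_nat (k * \<alpha> $ i) * \<eta> i) \<le> C2 * e"
    using prod_expansion [of UNIV "\<lambda>i. k * \<alpha> $ i"] by auto
  define D where "D = C2 * K4\<^sup>2 + (\<Sum>i\<in>UNIV. real (k * \<alpha> $ i)) * K3"
  define C where "C = 1 + K4 + 2 * C1 * K4 + D"
  have D: "D \<ge> 0" using C2 K3 by (simp add: D_def sum_nonneg)
  have C: "C \<ge> 1" "C \<ge> K4" "C \<ge> 2 * C1 * K4" "C \<ge> D" using D C1 K4 by (auto simp: C_def)
  show ?thesis
  proof (intro exI [of _ C] conjI allI impI C(1))
    fix x x' :: "complex ^ 'n" and \<gamma> :: "'n \<Rightarrow> complex" and V :: complex and t :: real
    define u where "u = mi_pow x \<alpha>"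
    assume t: "t \<ge> C" and u0: "mi_pow x \<alpha> \<noteq> 0" and V: "V = -1 / (of_nat k * \<Lambda> * mi_pow x \<alpha> ^ k)"
      and tV: "t \<le> norm V" and Vt: "norm V \<le> 2 * t" and x1: "\<forall>i. norm (x $ i) \<le> 1"
      and form: "\<forall>j\<in>M. norm (\<gamma> j) \<le> K \<and>
       norm (x' $ j - x $ j * (lam $ j + a $ j * mi_pow x \<alpha> ^ k + mi_pow x \<alpha> ^ (k + 1) * \<gamma> j)) \<le> K * t powr (-B)"
    define T where "T = t powr (-1/k)"
    have t1: "t \<ge> 1" using t C by simp
    have T: "T > 0" "1 / t \<le> T" "T \<le> 1"
    proof -
      have "t powr (-1/k) \<le> t powr 0" using t1 by (intro powr_mono) auto
      then show "T \<le> 1" using t1 by (simp add: T_def)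
      show "T > 0" using t1 by (simp add: T_def)
      have "t powr (-1) \<le> t powr (-1/k)" using t1 k by (intro powr_mono) (auto simp: divide_simps)
      then show "1 / t \<le> T" using t1 by (simp add: T_def powr_minus_divide)
    qed
    have nu: "norm u ^ k = 1 / (L0 * norm V)"
      using u0 \<Lambda> k by (simp add: V L0_def u_def norm_divide norm_mult norm_power)
    have uk: "norm u ^ k \<le> 1 / (L0 * t)" "norm u ^ k \<ge> 1 / (2 * L0 * t)"
    proof -
      have V0: "norm V > 0" using tV t1 by linarith
      show "norm u ^ k \<le> 1 / (L0 * t)"
        unfolding nu using tV t1 L0 V0 by (intro divide_left_mono mult_left_mono) auto
      have "L0 * norm V \<le> L0 * (2 * t)" using Vt L0 by (intro mult_left_mono) auto
      then show "norm u ^ k \<ge> 1 / (2 * L0 * t)"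
        unfolding nu using t1 L0 V0 by (intro divide_left_mono) (auto simp: ac_simps)
    qed
    have nuk: "norm u = (norm u ^ k) powr (1/k)"
      using u0 k by (simp add: u_def powr_powr flip: powr_realpow)
    have uA: "norm u \<le> A * T"
    proof -
      have "norm u \<le> (1 / (L0 * t)) powr (1/k)"
        by (subst nuk) (use uk in \<open>auto intro!: powr_mono2\<close>)
      also have "\<dots> = A * T"
        using t1 L0 by (simp add: A_def T_def powr_divide powr_mult powr_minus_divide)
      finally show ?thesis .
    qed
    have uA': "norm u \<ge> A' * T"
    proof -
      have "A' * T = (1 / (2 * L0 * t)) powr (1/k)"
        using t1 L0 by (simp add: A'_def T_def powr_divide powr_mult powr_minus_divide)
      also have "\<dots> \<le> norm u"
        by (subst nuk) (use uk t1 L0 in \<open>auto intro!: powr_mono2\<close>)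
      finally show ?thesis .
    qed
    \<comment> \<open>Since \<open>1 / t \<le> T\<close>, the exponent 3 leaves two factors
      \<open>T\<close>: one is lost in dividing by \<open>|x_j| \<ge> A' * T\<close>, the other
      remains in the error \<open>T / t\<close>.\<close>
    have tB: "t powr (-B) \<le> T * (T / t)"
    proof -
      have "t powr (-B) \<le> t powr (-3)" using B t1 by (intro powr_mono) auto
      also have "\<dots> = t powr (-1) * (t powr (-1) / t)"
        using t1 by (simp add: powr_minus_divide powr_numeral field_simps eval_nat_numeral)
      also have "\<dots> \<le> T * (T / t)"
        using T t1 by (intro mult_mono divide_right_mono) (auto simp: powr_minus_divide)
      finally show ?thesis .
    qed
    \<comment> \<open>Indices absent from \<open>u\<close> are assigned 0; their coordinates may
      vanish, so a relative change would be meaningless.\<close>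
    define \<eta> where "\<eta> j = (if \<alpha> $ j = 0 then 0 else x' $ j / (lam $ j * x $ j) - 1)" for j
    define err where "err j = (if \<alpha> $ j = 0 then 0 else \<eta> j - a $ j / lam $ j * u ^ k)" for j
    have inM: "j \<in> M" if "\<alpha> $ j \<noteq> 0" for j using \<alpha> [of j] that by auto
    have xj: "x $ j \<noteq> 0" "norm u \<le> norm (x $ j)" if "\<alpha> $ j \<noteq> 0" for j
    proof -
      show "norm u \<le> norm (x $ j)" unfolding u_def using x1 that by (intro mi_pow_le_component) auto
      then show "x $ j \<noteq> 0" using u0 by (auto simp: u_def)
    qed
    have err: "norm (err j) \<le> K3 * (T / t)" for j
    proof (cases "\<alpha> $ j = 0")
      case False
      have j: "j \<in> M" "lam $ j \<noteq> 0" using inM [OF False] lam(1) [of j] by auto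
      define r where "r = x' $ j - x $ j * (lam $ j + a $ j * u ^ k + u ^ (k + 1) * \<gamma> j)"
      have r: "norm r \<le> K * t powr (-B)" using form j by (auto simp: r_def u_def)
      have "x' $ j = r + x $ j * (lam $ j + a $ j * u ^ k + u ^ (k + 1) * \<gamma> j)" by (simp add: r_def)
      then have "err j = u ^ k * u * \<gamma> j / lam $ j + r / (lam $ j * x $ j)"
        using False j(2) xj(1) [OF False] by (simp add: err_def \<eta>_def field_simps)
      then have "norm (err j) \<le> norm (u ^ k * u * \<gamma> j / lam $ j) + norm (r / (lam $ j * x $ j))"
        by (simp add: norm_triangle_ineq)
      also have "\<dots> = norm u ^ k * norm u * norm (\<gamma> j) + norm r / norm (x $ j)"
        using lam(1) [OF j(1)] by (simp add: norm_mult norm_divide norm_power)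
      also have "\<dots> \<le> 1 / (L0 * t) * (A * T) * K + K * (T * (T / t)) / (A' * T)"
      proof (intro add_mono mult_mono frac_le)
        show "norm r \<le> K * (T * (T / t))" using r tB K by (meson mult_left_mono order_trans less_imp_le)
        show "A' * T \<le> norm (x $ j)" using uA' xj(2) [OF False] by simp
      qed (use uk uA form j K T t1 A L0 in auto)
      also have "\<dots> = K3 * (T / t)" using T t1 A L0 by (simp add: K3_def field_simps)
      finally show ?thesis .
    qed (use K3 T t1 in \<open>simp add: err_def\<close>)
    have \<eta>: "norm (\<eta> j) \<le> K4 / t" for j
    proof (cases "\<alpha> $ j = 0")
      case False
      have "\<eta> j = a $ j / lam $ j * u ^ k + err j" using False by (simp add: err_def)
      then have "norm (\<eta> j) \<le> norm (a $ j / lam $ j * u ^ k) + norm (err j)"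
        by (simp add: norm_triangle_ineq)
      also have "norm (a $ j / lam $ j * u ^ k) = norm (a $ j) * norm u ^ k"
        using lam(1) [OF inM [OF False]] by (simp add: norm_mult norm_divide norm_power)
      also have "norm (a $ j) * norm u ^ k + norm (err j) \<le>
          (\<Sum>j\<in>UNIV. norm (a $ j)) * (1 / (L0 * t)) + K3 * (1 / t)"
      proof (intro add_mono mult_mono)
        have "K3 * (T / t) \<le> K3 * (1 / t)"
          using K3 t1 T(3) by (intro mult_left_mono divide_right_mono) auto
        then show "norm (err j) \<le> K3 * (1 / t)" using err [of j] by linarith
      qed (use uk member_le_sum [of j UNIV "\<lambda>j. norm (a $ j)"] in \<open>auto simp: sum_nonneg\<close>)
      also have "\<dots> = K4 / t" by (simp add: K4_def add_divide_distrib)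
      finally show ?thesis .
    qed (use K4 t1 in \<open>simp add: \<eta>_def\<close>)
    define P where "P = (\<Prod>i\<in>UNIV. (1 + \<eta> i) ^ (\<alpha> $ i))"
    have e: "0 \<le> K4 / t" "K4 / t \<le> 1" using K4 t C by auto
    have "mi_pow x' \<alpha> = mi_pow lam \<alpha> * u * P"
      unfolding u_def P_def mi_pow_def prod.distrib [symmetric]
    proof (rule prod.cong)
      fix i show "x' $ i ^ \<alpha> $ i = lam $ i ^ \<alpha> $ i * x $ i ^ \<alpha> $ i * (1 + \<eta> i) ^ \<alpha> $ i"
      proof (cases "\<alpha> $ i = 0")
        case False
        have "lam $ i \<noteq> 0" using inM [OF False] lam(1) [of i] by auto
        then have "x' $ i = lam $ i * x $ i * (1 + \<eta> i)" using False xj(1) by (simp add: \<eta>_def)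
        then show ?thesis by (simp only: power_mult_distrib)
      qed simp
    qed simp
    then have 1: "mi_pow x' \<alpha> = mi_pow x \<alpha> * P" using lam(2) by (simp add: u_def)
    have "norm (P - 1) \<le> norm (P - 1 - (\<Sum>i\<in>UNIV. of_nat (\<alpha> $ i) * \<eta> i)) + norm (\<Sum>i\<in>UNIV. of_nat (\<alpha> $ i) * \<eta> i)"
      by (metis diff_add_cancel norm_triangle_ineq)
    also have "\<dots> \<le> C1 * (K4 / t)\<^sup>2 + C1 * (K4 / t)"
      unfolding P_def using C1(2) [OF e, of \<eta>] \<eta> by (intro add_mono) auto
    also have "C1 * (K4 / t)\<^sup>2 \<le> C1 * (K4 / t)"
      using C1(1) power_decreasing [OF _ e, of 1 2] by (intro mult_left_mono) auto
    also have "C1 * (K4 / t) + C1 * (K4 / t) \<le> C / t"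
      using C(3) t1 by (simp add: divide_right_mono flip: add_divide_distrib)
    finally have 2: "norm (P - 1) \<le> C / t" by simp
    have Pk: "P ^ k = (\<Prod>i\<in>UNIV. (1 + \<eta> i) ^ (k * \<alpha> $ i))"
      by (simp add: P_def prod_power_distrib mult.commute [of k] power_mult)
    have V1: "of_nat k * \<Lambda> * u ^ k = - 1 / V"
      using u0 \<Lambda> k by (simp add: V u_def)
    have "(\<Sum>i\<in>UNIV. of_nat (\<alpha> $ i) * (a $ i / lam $ i * u ^ k)) = \<Lambda> * u ^ k"
    proof -
      have "\<Lambda> = (\<Sum>j\<in>UNIV. a $ j * of_nat (\<alpha> $ j) / lam $ j)"
        unfolding \<Lambda>(1) by (rule sum.mono_neutral_left) (use \<alpha> in auto)
      then have "\<Lambda> * u ^ k = (\<Sum>j\<in>UNIV. a $ j * of_nat (\<alpha> $ j) / lam $ j * u ^ k)"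
        by (simp only: sum_distrib_right)
      also have "\<dots> = (\<Sum>i\<in>UNIV. of_nat (\<alpha> $ i) * (a $ i / lam $ i * u ^ k))"
        by (rule sum.cong) simp_all
      finally show ?thesis by simp
    qed
    then have "(\<Sum>i\<in>UNIV. of_nat (k * \<alpha> $ i) * \<eta> i) = of_nat k * \<Lambda> * u ^ k + (\<Sum>i\<in>UNIV. of_nat (k * \<alpha> $ i) * err i)"
    proof -
      assume *: "(\<Sum>i\<in>UNIV. of_nat (\<alpha> $ i) * (a $ i / lam $ i * u ^ k)) = \<Lambda> * u ^ k"
      have "(\<Sum>i\<in>UNIV. of_nat (k * \<alpha> $ i) * \<eta> i) =
          (\<Sum>i\<in>UNIV. of_nat k * (of_nat (\<alpha> $ i) * (a $ i / lam $ i * u ^ k)) + of_nat (k * \<alpha> $ i) * err i)"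
        by (rule sum.cong) (auto simp: err_def algebra_simps)
      also have "\<dots> = of_nat k * (\<Lambda> * u ^ k) + (\<Sum>i\<in>UNIV. of_nat (k * \<alpha> $ i) * err i)"
        unfolding sum.distrib * [symmetric] sum_distrib_left ..
      finally show ?thesis by (simp add: mult.assoc)
    qed
    then have "P ^ k - (1 - 1 / V) = (P ^ k - 1 - (\<Sum>i\<in>UNIV. of_nat (k * \<alpha> $ i) * \<eta> i)) +
        (\<Sum>i\<in>UNIV. of_nat (k * \<alpha> $ i) * err i)"
      unfolding V1 by simp
    then have "norm (P ^ k - (1 - 1 / V)) \<le> norm (P ^ k - 1 - (\<Sum>i\<in>UNIV. of_nat (k * \<alpha> $ i) * \<eta> i)) +
        norm (\<Sum>i\<in>UNIV. of_nat (k * \<alpha> $ i) * err i)"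
      by (simp only: norm_triangle_ineq)
    also have "\<dots> \<le> C2 * (K4 / t)\<^sup>2 + (\<Sum>i\<in>UNIV. real (k * \<alpha> $ i) * (K3 * (T / t)))"
    proof (rule add_mono)
      show "norm (P ^ k - 1 - (\<Sum>i\<in>UNIV. of_nat (k * \<alpha> $ i) * \<eta> i)) \<le> C2 * (K4 / t)\<^sup>2"
        unfolding Pk using C2(2) [OF e, of \<eta>] \<eta> by blast
      have "norm (of_nat (k * \<alpha> $ i) * err i) \<le> real (k * \<alpha> $ i) * (K3 * (T / t))" for i
        unfolding norm_mult norm_of_nat using err [of i] by (rule mult_left_mono) simp
      then show "norm (\<Sum>i\<in>UNIV. of_nat (k * \<alpha> $ i) * err i) \<le> (\<Sum>i\<in>UNIV. real (k * \<alpha> $ i) * (K3 * (T / t)))"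
        by (rule sum_norm_le)
    qed
    also have "C2 * (K4 / t)\<^sup>2 \<le> C2 * K4\<^sup>2 * (T / t)"
    proof -
      have "(1 / t) * (1 / t) \<le> T * (1 / t)" using T t1 by (intro mult_right_mono) auto
      then have "C2 * K4\<^sup>2 * ((1 / t) * (1 / t)) \<le> C2 * K4\<^sup>2 * (T * (1 / t))"
        using C2 by (intro mult_left_mono) auto
      then show ?thesis by (simp add: power2_eq_square ac_simps)
    qed
    also have "C2 * K4\<^sup>2 * (T / t) + (\<Sum>i\<in>UNIV. real (k * \<alpha> $ i) * (K3 * (T / t))) = D * (T / t)"
      by (simp only: D_def sum_distrib_right distrib_right mult.assoc)
    also have "\<dots> \<le> C * (T / t)" using C(4) T t1 by (intro mult_right_mono) auto
    finally have "norm (P ^ k - (1 - 1 / V)) \<le> C * (t powr (-1/k) / t)" by (simp add: T_def)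
    with 1 2 show "\<exists>P. mi_pow x' \<alpha> = mi_pow x \<alpha> * P \<and> norm (P - 1) \<le> C / t \<and>
        norm (P ^ k - (1 - 1 / V)) \<le> C * (t powr (-1/k) / t)" by blast
  qed
qed

section \<open>The Fatou coordinate and the invariance of its branch\<close>

lemma tendsto_powr_minus: "b > 0 \<Longrightarrow> ((\<lambda>t::real. t powr (- b)) \<longlongrightarrow> 0) at_top"
  by (intro tendsto_neg_powr filterlim_ident) simp

lemma eventually_at_top_obtain:
  assumes "eventually P (at_top :: real filter)"
  obtains R where "R \<ge> 1" "\<And>t. t \<ge> R \<Longrightarrow> P t"
  using eventually_conj [OF assms eventually_ge_at_top [of 1]]
  by (metis (mono_tags, lifting) eventually_at_top_linorder order_refl)

text \<open>With \<open>E\<close> the error of \<open>Q\<close>, one has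
  \<open>V / Q - V - 1 = (1 / V - (V + 1) * E) / Q\<close>. The growth of \<open>V + 1\<close> is
  offset by the factor \<open>1 / t\<close> in \<open>E\<close>, which leaves
  \<open>O(t powr (-1/k))\<close>.\<close>

lemma V_step:
  assumes k: "k \<ge> 1" and C: "C \<ge> 1" and \<delta>: "\<delta> > 0"
  obtains R where "R \<ge> 1" "\<And>V Q t. t \<ge> R \<Longrightarrow> t \<le> norm V \<Longrightarrow> norm V \<le> 2 * t \<Longrightarrow>
    norm (Q - (1 - 1 / V)) \<le> C * (t powr (-1/real k) / t) \<Longrightarrow> Q \<noteq> 0 \<and> norm (V / Q - V - 1 :: complex) \<le> \<delta>"
proof -
  have lim: "((\<lambda>t. 1 / t + 3 * C * t powr (-1/k)) \<longlongrightarrow> 0 + 3 * C * 0) at_top"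
    using tendsto_powr_minus [of "1/k"] k
    by (intro tendsto_intros tendsto_divide_0 [OF tendsto_const] filterlim_ident
        filterlim_at_top_imp_at_infinity) auto
  have "\<forall>\<^sub>F t in at_top. 1 / t + 3 * C * t powr (-1/k) < min (1/2) (\<delta>/2)"
    by (rule order_tendstoD(2) [OF lim]) (use \<delta> in auto)
  then obtain R where R: "R \<ge> 1" "\<And>t. t \<ge> R \<Longrightarrow> 1 / t + 3 * C * t powr (-1/k) < min (1/2) (\<delta>/2)"
    by (rule eventually_at_top_obtain) blast
  show ?thesis
  proof (rule that [OF R(1)])
    fix V Q :: complex and t :: real
    assume t: "t \<ge> R" "t \<le> norm V" "norm V \<le> 2 * t"
      and Q: "norm (Q - (1 - 1 / V)) \<le> C * (t powr (-1/real k) / t)"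
    define T where "T = t powr (-1/k)"
    define E where "E = Q - (1 - 1 / V)"
    have t1: "t \<ge> 1" using t R by simp
    have V0: "V \<noteq> 0" using t t1 by auto
    have T: "T > 0" "1 / t + 3 * C * T < 1/2" "1 / t + 3 * C * T < \<delta>/2"
      using R(2) [OF t(1)] t1 by (auto simp: T_def)
    have E: "norm E \<le> C * (T / t)" using Q by (simp add: E_def T_def)
    have "C * (T / t) \<le> C * (T / 1)"
      using C T t1 by (intro mult_left_mono divide_left_mono) auto
    then have E': "norm E \<le> C * T" using E by simp
    have V1: "norm (1 / V) \<le> 1 / t"
      using t t1 V0 by (auto simp: norm_divide intro!: divide_left_mono)
    have CT: "C * T > 0" using C T by simp
    have "norm (1 - Q) \<le> norm (1 / V) + norm E"
      using norm_triangle_ineq4 [of "1 / V" E] by (simp add: E_def)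
    also have "\<dots> \<le> 1/2" using V1 E' T CT by linarith
    finally have "norm (1 - Q) \<le> 1/2" .
    then have Q2: "norm Q \<ge> 1/2"
      using norm_triangle_ineq2 [of 1 "1 - Q"] by simp
    then have Q0: "Q \<noteq> 0" by auto
    have "V / Q - V - 1 = (1 / V - (V + 1) * E) / Q"
      using V0 Q0 by (simp add: E_def field_simps)
    also have "norm \<dots> \<le> (1 / t + 3 * C * T) / (1/2)"
      unfolding norm_divide [of _ Q]
    proof (rule frac_le)
      have "norm (V + 1) \<le> 3 * t" using norm_triangle_ineq [of V 1] t t1 by simp
      then have "norm (V + 1) * norm E \<le> 3 * t * (C * (T / t))"
        using E t1 by (intro mult_mono) auto
      also have "\<dots> = 3 * C * T" using t1 by simp
      finally have "norm ((V + 1) * E) \<le> 3 * C * T" by (simp add: norm_mult)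
      then show "norm (1 / V - (V + 1) * E) \<le> 1 / t + 3 * C * T"
        using V1 norm_triangle_ineq4 [of "1 / V" "(V + 1) * E"] by linarith
    qed (use Q2 t1 CT in auto)
    also have "\<dots> \<le> \<delta>" using T by simp
    finally show "Q \<noteq> 0 \<and> norm (V / Q - V - 1) \<le> \<delta>" using Q0 by blast
  qed
qed

lemma root_of_unity_isolated:
  assumes "k \<ge> 1"
  obtains e where "e > 0" "\<And>\<zeta> :: complex. \<zeta> ^ k = 1 \<Longrightarrow> norm (\<zeta> - 1) < e \<Longrightarrow> \<zeta> = 1"
proof -
  have "finite ({\<zeta> :: complex. \<zeta> ^ k = 1} - {1})"
    using finite_roots_unity [OF assms] by (rule finite_Diff)
  then obtain e where "e > 0" "\<forall>\<zeta>\<in>{\<zeta> :: complex. \<zeta> ^ k = 1} - {1}. \<zeta> \<noteq> 1 \<longrightarrow> e \<le> dist 1 \<zeta>"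
    using finite_set_avoid by blast
  then show ?thesis using that [of e] by (force simp: dist_norm norm_minus_commute)
qed

text \<open>In the right half-plane both arguments are below \<open>pi / 2\<close> in modulus, so
  their difference stays within the principal branch.\<close>

lemma powr_divide_right_half_plane:
  assumes "Re V > 0" "Re W > 0"
  shows "W powr w = V powr w * (W / V) powr w"
proof -
  have nz: "V \<noteq> 0" "W \<noteq> 0" using assms by auto
  have "\<bar>Im (Ln V)\<bar> < pi / 2" "\<bar>Im (Ln W)\<bar> < pi / 2"
    using assms Re_Ln_pos_lt nz by blast+
  then have "Ln (W / V) = Ln W - Ln V"
    using nz by (intro Ln_unique) (auto simp: exp_diff)
  then have "Ln W = Ln V + Ln (W / V)" by simp
  then show ?thesis using nz by (simp add: powr_def distrib_left exp_add)
qed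

lemma powr_root_power:
  assumes "k \<ge> 1"
  shows "((z :: complex) powr (1 / of_nat k)) ^ k = z"
  using assms by (cases "z = 0") (simp_all add: powr_def flip: exp_of_nat_mult)

text \<open>The quantity \<open>u * V powr (1/k)\<close> is multiplied by a number whose
  \<open>k\<close>-th power is 1 and which is close to 1. The roots of unity being isolated, this
  number is 1, so an orbit cannot jump between petals.\<close>

lemma chi_step:
  assumes k: "k \<ge> 1" and C: "C \<ge> 1"
  obtains R where "R \<ge> 1" "\<And>u P V V' t. t \<ge> R \<Longrightarrow> t \<le> norm V \<Longrightarrow> Re V > 0 \<Longrightarrow> Re V' > 0 \<Longrightarrow>
    norm (V' - V - 1) \<le> 1 \<Longrightarrow> norm (P - 1) \<le> C / t \<Longrightarrow> u \<noteq> 0 \<Longrightarrow> (u * P) ^ k * V' = u ^ k * V \<Longrightarrow>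
    u * P * V' powr (1 / of_nat k) = u * V powr (1 / of_nat k :: complex)"
proof -
  obtain e where e: "e > 0" "\<And>\<zeta> :: complex. \<zeta> ^ k = 1 \<Longrightarrow> norm (\<zeta> - 1) < e \<Longrightarrow> \<zeta> = 1"
    by (rule root_of_unity_isolated [OF k]) blast
  have "isCont (\<lambda>s::complex. s powr (1 / of_nat k)) 1"
    by (intro continuous_intros) auto
  then have "((\<lambda>s::complex. s powr (1 / of_nat k)) \<longlongrightarrow> 1) (at 1)"
    by (simp add: isCont_def)
  then obtain d where d: "d > 0" "\<And>s::complex. norm (s - 1) < d \<Longrightarrow> norm (s powr (1 / of_nat k) - 1) < min 1 (e / 2)"
    using e(1) unfolding LIM_def dist_norm
    by (metis (no_types, lifting) diff_self half_gt_zero min_less_iff_conj norm_zero powr_one_eq_one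
        zero_less_norm_iff right_minus_eq zero_less_one)
  \<comment> \<open>\<open>3 / d\<close> forces \<open>|V' / V - 1| \<le> 2 / t < d\<close>, and
    \<open>5 * C / e\<close> forces \<open>2 * C / t < e / 2\<close>.\<close>
  define R where "R = max 1 (max (3 / d) (5 * C / e))"
  show ?thesis
  proof (rule that [of R])
    show "R \<ge> 1" by (simp add: R_def)
    fix u P V V' :: complex and t :: real
    assume t: "t \<ge> R" "t \<le> norm V" and Re: "Re V > 0" "Re V' > 0" and VV: "norm (V' - V - 1) \<le> 1"
      and P: "norm (P - 1) \<le> C / t" and u: "u \<noteq> 0" and inv: "(u * P) ^ k * V' = u ^ k * V"
    have t1: "t \<ge> 1" "3 / d \<le> t" "5 * C / e \<le> t" using t(1) by (auto simp: R_def)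
    have V0: "V \<noteq> 0" using Re by auto
    define s where "s = (V' / V) powr (1 / of_nat k)"
    have "norm (V' - V) \<le> 2" using norm_triangle_ineq [of "V' - V - 1" 1] VV by simp
    then have "norm (V' - V) / norm V \<le> 2 / t"
      using t t1 by (intro frac_le) auto
    also have "\<dots> < d" using t1 d(1) by (simp add: divide_simps mult.commute split: if_splits)
    finally have "norm (V' / V - 1) < d"
      using V0 by (simp add: divide_diff_eq_iff norm_divide)
    then have s: "norm (s - 1) < 1" "norm (s - 1) < e / 2" using d(2) by (auto simp: s_def)
    have "norm s \<le> 2" using norm_triangle_ineq [of "s - 1" 1] s by simp
    have "norm (P * s - 1) \<le> norm (P - 1) * norm s + norm (s - 1)"
    proof -
      have "P * s - 1 = (P - 1) * s + (s - 1)" by (simp add: algebra_simps)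
      then show ?thesis by (metis norm_mult norm_triangle_ineq)
    qed
    also have "\<dots> \<le> C / t * 2 + norm (s - 1)"
      using P \<open>norm s \<le> 2\<close> C t1 by (intro add_mono mult_mono) auto
    also have "C / t * 2 < e / 2"
    proof -
      have "5 * C \<le> t * e" using t1(3) e(1) by (simp add: divide_le_eq)
      then have "C * 4 < t * e" using C by linarith
      then show ?thesis using t1 by (simp add: field_simps)
    qed
    finally have small: "norm (P * s - 1) < e" using s by simp
    have sk: "s ^ k = V' / V"
      unfolding s_def by (rule powr_root_power [OF k])
    have "P ^ k * V' = V" using inv u by (simp add: power_mult_distrib mult.assoc)
    then have "(P * s) ^ k = 1" using V0 by (simp add: power_mult_distrib sk)
    then have "P * s = 1" using e(2) small by blast
    moreover have "V' powr (1 / of_nat k) = V powr (1 / of_nat k) * s"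
      unfolding s_def by (rule powr_divide_right_half_plane) (use Re in auto)
    ultimately show "u * P * V' powr (1 / of_nat k) = u * V powr (1 / of_nat k)"
      by (simp add: ac_simps)
  qed
qed

section \<open>Contraction of the coordinates against the barrier\<close>

lemma powr_shift_bound:
  fixes t b :: real
  assumes "t > 0" "b > 0" and that: "h \<ge> 0"
  shows "t powr (- b) * (1 - b * h / t) \<le> (t + h) powr (- b)"
proof -
  \<comment> \<open>Bernoulli's inequality for the exponent \<open>-b\<close>, from
    \<open>ln (1 + s) \<le> s\<close> and \<open>exp y \<ge> 1 + y\<close>.\<close>
  have "1 - b * (h / t) \<le> 1 - b * ln (1 + h / t)"
    using assms ln_add_one_self_le_self [of "h / t"] by (intro diff_left_mono mult_left_mono) auto
  also have "\<dots> \<le> exp (- b * ln (1 + h / t))"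
    using exp_ge_add_one_self [of "- b * ln (1 + h / t)"] by simp
  also have "\<dots> = (1 + h / t) powr (- b)"
    using assms that by (simp add: powr_def add_pos_nonneg less_imp_neq [symmetric])
  finally have "t powr (- b) * (1 - b * h / t) \<le> t powr (- b) * (1 + h / t) powr (- b)"
    by (simp add: mult_left_mono)
  also have "\<dots> = (t * (1 + h / t)) powr (- b)"
    using assms that by (simp add: powr_mult)
  also have "t * (1 + h / t) = t + h" using assms by (simp add: field_simps)
  finally show ?thesis .
qed

text \<open>This is \<open>sqrt (1 + s) \<le> 1 + s / 2\<close> applied to the squared modulus of
  \<open>1 - q\<close>.\<close>

lemma norm_one_minus_le: "norm (1 - q :: complex) \<le> 1 - Re q + (norm q)\<^sup>2 / 2"
proof (rule power2_le_imp_le)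
  have "(norm (1 - q))\<^sup>2 = 1 - 2 * Re q + (norm q)\<^sup>2"
    unfolding cmod_power2 by (simp add: power2_eq_square algebra_simps)
  also have "\<dots> \<le> 1 - 2 * Re q + (norm q)\<^sup>2 + (Re q - (norm q)\<^sup>2 / 2)\<^sup>2" by simp
  also have "\<dots> = (1 - Re q + (norm q)\<^sup>2 / 2)\<^sup>2"
    by (simp add: power2_eq_square algebra_simps)
  finally show "(norm (1 - q))\<^sup>2 \<le> (1 - Re q + (norm q)\<^sup>2 / 2)\<^sup>2" .
  have "0 \<le> (norm q - 1)\<^sup>2" by simp
  then have "norm q \<le> 1/2 + (norm q)\<^sup>2 / 2" by (simp add: power2_eq_square algebra_simps)
  then show "0 \<le> 1 - Re q + (norm q)\<^sup>2 / 2" using complex_Re_le_cmod [of q] by linarith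
qed

text \<open>The multiplier has modulus at most \<open>1 - 2 b / t + O(t powr (-1/k) / t)\<close>,
  whereas moving from \<open>t\<close> to \<open>t + h\<close> with \<open>h \<le> 3/2\<close>
  shrinks the barrier by no more than the factor \<open>1 - (3/2) b / t\<close>. The gap
  \<open>b / (2 t)\<close> absorbs all errors for large \<open>t\<close>.\<close>

lemma x_step:
  fixes \<mu> a \<Lambda> :: complex and k :: nat
  assumes k: "k \<ge> 1" and \<Lambda>: "\<Lambda> \<noteq> 0" and \<mu>: "norm \<mu> = 1" and b: "0 < b" "b \<le> 1"
    and K: "K > 0" and B: "B \<ge> 3" and h: "0 \<le> h" "h \<le> 3/2"
  obtains R where "R \<ge> 1" "\<And>\<xi> \<xi>' \<gamma> u V t. t \<ge> R \<Longrightarrow> t \<le> norm V \<Longrightarrow> of_nat k * \<Lambda> * u ^ k = - 1 / V \<Longrightarrow>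
    norm \<gamma> \<le> K \<Longrightarrow> norm \<xi> < t powr (-b) \<Longrightarrow>
    norm (\<xi>' - \<xi> * (\<mu> + a * u ^ k + u ^ (k + 1) * \<gamma>)) \<le> K * t powr (-B) \<Longrightarrow>
    Re (a / (\<mu> * \<Lambda>) / (of_nat k * V)) \<ge> 2 * b / t \<Longrightarrow> norm \<xi>' < (t + h) powr (-b)"
proof -
  define L0 where "L0 = k * norm \<Lambda>"
  have L0: "L0 > 0" using k \<Lambda> by (simp add: L0_def)
  define A where "A = (1 / L0) powr (1/k)"
  define p where "p = a / (\<mu> * \<Lambda>)"
  \<comment> \<open>The three summands come from the quadratic term of \<open>|1 - q|\<close>, from
    \<open>u ^ (k + 1) * \<gamma>\<close>, and from the additive remainder.\<close>
  define K7 where "K7 = (norm p)\<^sup>2 / 2 + K * A / L0 + K"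
  have A: "A > 0" using L0 by (simp add: A_def)
  have lim: "((\<lambda>t. K7 * t powr (-1/k)) \<longlongrightarrow> K7 * 0) at_top"
    using tendsto_powr_minus [of "1/k"] k by (intro tendsto_intros) auto
  have "\<forall>\<^sub>F t in at_top. K7 * t powr (-1/k) < b / 2"
    by (rule order_tendstoD(2) [OF lim]) (use b in auto)
  then obtain R where R: "R \<ge> 1" "\<And>t. t \<ge> R \<Longrightarrow> K7 * t powr (-1/k) < b / 2"
    by (rule eventually_at_top_obtain) blast
  show ?thesis
  proof (rule that [OF R(1)])
    fix \<xi> \<xi>' \<gamma> u V :: complex and t :: real
    assume t: "t \<ge> R" "t \<le> norm V" and V: "of_nat k * \<Lambda> * u ^ k = - 1 / V" and \<gamma>: "norm \<gamma> \<le> K"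
      and \<xi>: "norm \<xi> < t powr (-b)"
      and \<xi>': "norm (\<xi>' - \<xi> * (\<mu> + a * u ^ k + u ^ (k + 1) * \<gamma>)) \<le> K * t powr (-B)"
      and Re: "Re (a / (\<mu> * \<Lambda>) / (of_nat k * V)) \<ge> 2 * b / t"
    define T where "T = t powr (-1/k)"
    define q where "q = p / (of_nat k * V)"
    have t1: "t \<ge> 1" using t R by simp
    have V0: "V \<noteq> 0" using t t1 by auto
    have \<mu>0: "\<mu> \<noteq> 0" using \<mu> by auto
    have T: "T > 0" "1 / t \<le> T"
    proof -
      show "T > 0" using t1 by (simp add: T_def)
      have "t powr (-1) \<le> t powr (-1/k)" using t1 k by (intro powr_mono) (auto simp: divide_simps)
      then show "1 / t \<le> T" using t1 by (simp add: T_def powr_minus_divide)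
    qed
    have uk: "u ^ k = - 1 / (of_nat k * \<Lambda> * V)" using V k \<Lambda> V0 by (simp add: field_simps)
    have "norm u ^ k = 1 / (L0 * norm V)"
      using arg_cong [OF uk, of norm] by (simp add: norm_power norm_divide norm_mult L0_def)
    then have nuk: "norm u ^ k \<le> 1 / (L0 * t)"
      using t t1 L0 V0 by (auto intro!: divide_left_mono mult_left_mono)
    have uA: "norm u \<le> A * T"
    proof (cases "u = 0")
      case False
      have "norm u = (norm u ^ k) powr (1/k)"
        using False k by (simp add: powr_powr flip: powr_realpow)
      also have "\<dots> \<le> (1 / (L0 * t)) powr (1/k)"
        using nuk by (auto intro!: powr_mono2)
      also have "\<dots> = A * T"
        using t1 L0 by (simp add: A_def T_def powr_divide powr_mult powr_minus_divide)
      finally show ?thesis .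
    qed (use A T in auto)
    have nq: "norm q \<le> norm p / t"
    proof -
      have "norm q = norm p / (k * norm V)" by (simp add: q_def norm_divide norm_mult)
      also have "\<dots> \<le> norm p / (1 * t)" using k t t1 V0 by (intro divide_left_mono mult_mono) auto
      finally show ?thesis by simp
    qed
    have tt: "1 / t * (1 / t) \<le> T / t" using T t1 mult_right_mono [of "1 / t" T "1 / t"] by simp
    have "\<mu> + a * u ^ k + u ^ (k + 1) * \<gamma> = \<mu> * (1 - q + u ^ k * u * \<gamma> / \<mu>)"
      using \<mu>0 \<Lambda> V0 k by (simp add: uk q_def p_def field_simps)
    then have "norm (\<mu> + a * u ^ k + u ^ (k + 1) * \<gamma>) = norm (1 - q + u ^ k * u * \<gamma> / \<mu>)"
      using \<mu> by (simp add: norm_mult)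
    also have "\<dots> \<le> norm (1 - q) + norm (u ^ k * u * \<gamma> / \<mu>)" by (rule norm_triangle_ineq)
    also have "\<dots> \<le> (1 - 2 * b / t + (norm p)\<^sup>2 / 2 * (T / t)) + K * A / L0 * (T / t)"
    proof (rule add_mono)
      have "norm (1 - q) \<le> 1 - Re q + (norm q)\<^sup>2 / 2" by (rule norm_one_minus_le)
      also have "\<dots> \<le> 1 - 2 * b / t + (norm p / t)\<^sup>2 / 2"
        using Re nq by (intro add_mono diff_mono divide_right_mono power_mono) (auto simp: q_def p_def)
      also have "(norm p / t)\<^sup>2 / 2 = (norm p)\<^sup>2 / 2 * (1 / t * (1 / t))"
        by (simp add: power2_eq_square)
      also have "(norm p)\<^sup>2 / 2 * (1 / t * (1 / t)) \<le> (norm p)\<^sup>2 / 2 * (T / t)"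
        by (intro mult_left_mono tt) simp
      finally show "norm (1 - q) \<le> 1 - 2 * b / t + (norm p)\<^sup>2 / 2 * (T / t)" by simp
      have "norm (u ^ k * u * \<gamma> / \<mu>) = norm u ^ k * norm u * norm \<gamma>"
        using \<mu> by (simp add: norm_mult norm_divide norm_power)
      also have "\<dots> \<le> 1 / (L0 * t) * (A * T) * K"
        using nuk uA \<gamma> A T L0 t1 by (intro mult_mono) auto
      also have "\<dots> = K * A / L0 * (T / t)" by simp
      finally show "norm (u ^ k * u * \<gamma> / \<mu>) \<le> K * A / L0 * (T / t)" .
    qed
    finally have fac: "norm (\<mu> + a * u ^ k + u ^ (k + 1) * \<gamma>) \<le>
      1 - 2 * b / t + (norm p)\<^sup>2 / 2 * (T / t) + K * A / L0 * (T / t)" .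
    \<comment> \<open>The exponent 3 is at least \<open>b + 2\<close> because
      \<open>b \<le> 1\<close>; the remainder is thus small relative to the barrier, without any
      lower bound on the coordinate.\<close>
    have tB: "t powr (-B) \<le> t powr (-b) * (T / t)"
    proof -
      have "t powr (-B) \<le> t powr (-b + (-1) + (-1))" using B b t1 by (intro powr_mono) auto
      also have "\<dots> = t powr (-b) * (1 / t * (1 / t))"
        using t1 by (simp add: powr_add powr_diff powr_minus_divide power2_eq_square)
      also have "\<dots> \<le> t powr (-b) * (T / t)" by (intro mult_left_mono tt) simp
      finally show ?thesis .
    qed
    have "norm \<xi>' \<le> norm \<xi> * norm (\<mu> + a * u ^ k + u ^ (k + 1) * \<gamma>) + K * t powr (-B)"
      using norm_triangle_ineq [of "\<xi> * (\<mu> + a * u ^ k + u ^ (k + 1) * \<gamma>)"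
          "\<xi>' - \<xi> * (\<mu> + a * u ^ k + u ^ (k + 1) * \<gamma>)"] \<xi>'
      by (simp add: norm_mult)
    also have "\<dots> \<le> t powr (-b) * (1 - 2 * b / t + (norm p)\<^sup>2 / 2 * (T / t) + K * A / L0 * (T / t))
        + K * (t powr (-b) * (T / t))"
      using \<xi> fac tB K by (intro add_mono mult_mono mult_left_mono) auto
    also have "\<dots> = t powr (-b) * (1 - 2 * b / t + K7 * (T / t))"
    proof -
      have "w * (y + c1 * \<tau> + c2 * \<tau>) + K * (w * \<tau>) = w * (y + (c1 + c2 + K) * \<tau>)" for w y c1 c2 \<tau> :: real
        by (simp add: algebra_simps)
      then show ?thesis unfolding K7_def .
    qed
    also have "\<dots> < t powr (-b) * (1 - b * (3/2) / t)"
    proof (rule mult_strict_left_mono)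
      have "K7 * T / t < b / 2 / t"
        using R(2) [OF t(1)] t1 by (intro divide_strict_right_mono) (auto simp: T_def)
      then show "1 - 2 * b / t + K7 * (T / t) < 1 - b * (3/2) / t" by (simp add: field_simps)
    qed (use t1 in auto)
    also have "\<dots> \<le> t powr (-b) * (1 - b * h / t)"
      using h b t1 by (intro mult_left_mono diff_left_mono divide_right_mono) auto
    also have "\<dots> \<le> (t + h) powr (-b)" using b t1 h by (intro powr_shift_bound) auto
    finally show "norm \<xi>' < (t + h) powr (-b)" .
  qed
qed

text \<open>The contraction factor \<open>norm \<mu>\<close> is fixed below 1, while the factor by
  which the barrier shrinks tends to 1 and the quadratic error carries an extra
  \<open>t powr (-b)\<close>.\<close>

lemma y_step:
  fixes \<mu> :: complex
  assumes \<mu>: "norm \<mu> < 1" and b: "0 < b" and K: "K > 0" and h: "h \<ge> 0"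
  obtains R where "R \<ge> 1" "\<And>\<xi> \<xi>' t. t \<ge> R \<Longrightarrow> norm \<xi> < t powr (-b) \<Longrightarrow>
    norm (\<xi>' - \<mu> * \<xi>) \<le> K * (t powr (-b))\<^sup>2 \<Longrightarrow> norm \<xi>' < (t + h) powr (-b)"
proof -
  have lim: "((\<lambda>t. K * t powr (-b) + b * h / t) \<longlongrightarrow> K * 0 + 0) at_top"
    using tendsto_powr_minus [OF b]
    by (intro tendsto_intros tendsto_divide_0 [OF tendsto_const] filterlim_ident
        filterlim_at_top_imp_at_infinity) auto
  have "\<forall>\<^sub>F t in at_top. K * t powr (-b) + b * h / t < 1 - norm \<mu>"
    by (rule order_tendstoD(2) [OF lim]) (use \<mu> in auto)
  then obtain R where R: "R \<ge> 1" "\<And>t. t \<ge> R \<Longrightarrow> K * t powr (-b) + b * h / t < 1 - norm \<mu>"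
    by (rule eventually_at_top_obtain) blast
  show ?thesis
  proof (rule that [OF R(1)])
    fix \<xi> \<xi>' :: complex and t :: real
    assume t: "t \<ge> R" and \<xi>: "norm \<xi> < t powr (-b)"
      and \<xi>': "norm (\<xi>' - \<mu> * \<xi>) \<le> K * (t powr (-b))\<^sup>2"
    have t1: "t \<ge> 1" using t R by simp
    have "norm \<xi>' \<le> norm \<mu> * norm \<xi> + K * (t powr (-b))\<^sup>2"
      using norm_triangle_ineq [of "\<mu> * \<xi>" "\<xi>' - \<mu> * \<xi>"] \<xi>' by (simp add: norm_mult)
    also have "\<dots> \<le> norm \<mu> * t powr (-b) + K * (t powr (-b))\<^sup>2"
      using \<xi> K by (intro add_mono mult_left_mono) auto
    also have "\<dots> = t powr (-b) * (norm \<mu> + K * t powr (-b))"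
      by (simp add: power2_eq_square algebra_simps)
    also have "\<dots> < t powr (-b) * (1 - b * h / t)"
      using R(2) [OF t] t1 by (intro mult_strict_left_mono) auto
    also have "\<dots> \<le> (t + h) powr (-b)" using b t1 h by (intro powr_shift_bound) auto
    finally show "norm \<xi>' < (t + h) powr (-b)" .
  qed
qed

text \<open>For positive \<open>k\<close>, the convention for division by zero gives the value 0 at
  \<open>u = 0\<close>, so \<open>Re V > 0\<close> already excludes \<open>u = 0\<close>.\<close>

definition fatou_coord :: "nat \<Rightarrow> complex \<Rightarrow> complex \<Rightarrow> complex"
  where "fatou_coord k \<Lambda> u = - 1 / (of_nat k * \<Lambda> * u ^ k)"

text \<open>In the narrow sector the numerator \<open>Re p * Re V + Im p * Im V\<close> keeps three
  quarters of its main term and \<open>|V|^2\<close> exceeds \<open>(Re V)^2\<close> by a factor of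
  at most 3/2; the quotient of the two losses is 1/2.\<close>

lemma sector_Re_divide:
  fixes p V :: complex
  assumes V: "Re V > 0" "\<bar>Im V\<bar> \<le> \<epsilon> * Re V" and \<epsilon>: "0 \<le> \<epsilon>" "\<epsilon> \<le> 1/2"
    and p: "\<epsilon> * norm p \<le> Re p / 4"
  shows "Re (p / V) \<ge> Re p / (2 * Re V)"
proof -
  define t where "t = Re V"
  have t: "t > 0" using V by (simp add: t_def)
  have "\<epsilon> * norm p \<ge> 0" using \<epsilon>(1) by simp
  then have Rp: "Re p \<ge> 0" using p by linarith
  have "\<bar>Im p * Im V\<bar> \<le> norm p * (\<epsilon> * t)"
    unfolding abs_mult using V abs_Im_le_cmod [of p] by (intro mult_mono) (auto simp: t_def)
  also have "\<dots> \<le> Re p / 4 * t" using mult_right_mono [OF p, of t] t by (simp add: ac_simps)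
  finally have num: "Re p * t + Im p * Im V \<ge> 3/4 * (Re p * t)" by argo
  have "\<bar>Im V\<bar> \<le> 1/2 * t" using V(2) mult_right_mono [OF \<epsilon>(2), of t] t unfolding t_def by linarith
  then have "(Im V)\<^sup>2 \<le> (1/2 * t)\<^sup>2" using t abs_le_square_iff [of "Im V" "1/2 * t"] by simp
  then have "(Im V)\<^sup>2 * 4 \<le> t\<^sup>2" by (simp add: power_mult_distrib power_divide)
  then have den: "t\<^sup>2 + (Im V)\<^sup>2 \<le> 3/2 * t\<^sup>2"
    using zero_le_power2 [of "Im V"] by linarith
  have pos: "t\<^sup>2 + (Im V)\<^sup>2 > 0" using t by (simp add: add_pos_nonneg)
  have "Re p / (2 * t) = (3/4 * (Re p * t)) / (3/2 * t\<^sup>2)"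
    using t by (simp add: power2_eq_square)
  also have "\<dots> \<le> (3/4 * (Re p * t)) / (t\<^sup>2 + (Im V)\<^sup>2)"
    using den pos Rp t by (intro divide_left_mono) auto
  also have "\<dots> \<le> (Re p * t + Im p * Im V) / (t\<^sup>2 + (Im V)\<^sup>2)"
    using num pos by (intro divide_right_mono) auto
  also have "\<dots> = Re (p / V)" by (simp add: Re_divide t_def)
  finally show ?thesis by (simp add: t_def)
qed

text \<open>Every condition defining a petal is self-reproducing, each with a margin that survives
  errors tending to 0 as \<open>Re V\<close> grows; one threshold \<open>R\<close> then serves all
  conditions. The factor 4 in the condition on \<open>b\<close> becomes the 2 in
  \<open>2 * b / t\<close> after the loss of one half in the sector estimate.\<close>

lemma dynamics_step:
  fixes lam a :: "complex ^ 'n" and \<alpha> :: "nat ^ 'n"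
  assumes k: "k \<ge> 1" and \<Lambda>: "\<Lambda> = (\<Sum>j\<in>M. a $ j * of_nat (\<alpha> $ j) / lam $ j)" "\<Lambda> \<noteq> 0"
    and lam: "\<And>j. j \<in> M \<Longrightarrow> norm (lam $ j) = 1" "mi_pow lam \<alpha> = 1" "\<And>j. j \<notin> M \<Longrightarrow> norm (lam $ j) < 1"
    and \<alpha>: "\<And>j. j \<notin> M \<Longrightarrow> \<alpha> $ j = 0" and K: "K > 0" and B: "B \<ge> 3"
    and b: "0 < b" "b \<le> 1" and \<epsilon>: "0 < \<epsilon>" "\<epsilon> \<le> 1/2"
    and p: "\<And>j. j \<in> M \<Longrightarrow> \<epsilon> * norm (a $ j / (lam $ j * \<Lambda>)) \<le> Re (a $ j / (lam $ j * \<Lambda>)) / 4"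
      "\<And>j. j \<in> M \<Longrightarrow> 4 * b * k \<le> Re (a $ j / (lam $ j * \<Lambda>))"
  obtains R where "R \<ge> 1" "\<And>x x' \<gamma> V V'. V = fatou_coord k \<Lambda> (mi_pow x \<alpha>) \<Longrightarrow> V' = fatou_coord k \<Lambda> (mi_pow x' \<alpha>) \<Longrightarrow>
    Re V \<ge> R \<Longrightarrow> \<bar>Im V\<bar> < \<epsilon> * Re V \<Longrightarrow> (\<And>i. norm (x $ i) < Re V powr (-b)) \<Longrightarrow>
    (\<And>j. j \<in> M \<Longrightarrow> norm (\<gamma> j) \<le> K \<and>
       norm (x' $ j - x $ j * (lam $ j + a $ j * mi_pow x \<alpha> ^ k + mi_pow x \<alpha> ^ (k + 1) * \<gamma> j)) \<le> K * Re V powr (-B)) \<Longrightarrow>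
    (\<And>j. j \<notin> M \<Longrightarrow> norm (x' $ j - lam $ j * x $ j) \<le> K * (Re V powr (-b))\<^sup>2) \<Longrightarrow>
    Re V' \<ge> Re V + 1/2 \<and> \<bar>Im V'\<bar> < \<epsilon> * Re V' \<and> (\<forall>i. norm (x' $ i) < Re V' powr (-b)) \<and>
    mi_pow x' \<alpha> * V' powr (1 / of_nat k) = mi_pow x \<alpha> * V powr (1 / of_nat k)"
proof -
  define \<delta> where "\<delta> = \<epsilon> / 2"
  define h where "h = 1 + \<delta>"
  have \<delta>: "\<delta> > 0" "\<delta> \<le> 1/4" using \<epsilon> by (auto simp: \<delta>_def)
  have h: "0 \<le> h" "h \<le> 3/2" using \<delta> by (auto simp: h_def)
  obtain C where C: "C \<ge> 1" and u_step': "\<And>x x' \<gamma> V t. t \<ge> C \<Longrightarrow> mi_pow x \<alpha> \<noteq> 0 \<Longrightarrow>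
     V = -1 / (of_nat k * \<Lambda> * mi_pow x \<alpha> ^ k) \<Longrightarrow> t \<le> norm V \<Longrightarrow> norm V \<le> 2 * t \<Longrightarrow>
     (\<forall>i. norm (x $ i) \<le> 1) \<Longrightarrow> (\<forall>j\<in>M. norm (\<gamma> j) \<le> K \<and>
       norm (x' $ j - x $ j * (lam $ j + a $ j * mi_pow x \<alpha> ^ k + mi_pow x \<alpha> ^ (k + 1) * \<gamma> j)) \<le> K * t powr (-B)) \<Longrightarrow>
     (\<exists>P. mi_pow x' \<alpha> = mi_pow x \<alpha> * P \<and> norm (P - 1) \<le> C / t \<and>
        norm (P ^ k - (1 - 1 / V)) \<le> C * (t powr (-1/k) / t))"
    using u_step [OF k \<Lambda> lam(1,2) \<alpha> K B] by blast
  obtain R1 where R1: "R1 \<ge> 1" "\<And>V Q t. t \<ge> R1 \<Longrightarrow> t \<le> norm V \<Longrightarrow> norm V \<le> 2 * t \<Longrightarrow>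
    norm (Q - (1 - 1 / V)) \<le> C * (t powr (-1/real k) / t) \<Longrightarrow> Q \<noteq> 0 \<and> norm (V / Q - V - 1 :: complex) \<le> \<delta>"
    by (rule V_step [OF k C \<delta>(1)]) blast
  obtain R2 where R2: "R2 \<ge> 1" "\<And>u P V V' t. t \<ge> R2 \<Longrightarrow> t \<le> norm V \<Longrightarrow> Re V > 0 \<Longrightarrow> Re V' > 0 \<Longrightarrow>
    norm (V' - V - 1) \<le> 1 \<Longrightarrow> norm (P - 1) \<le> C / t \<Longrightarrow> u \<noteq> 0 \<Longrightarrow> (u * P) ^ k * V' = u ^ k * V \<Longrightarrow>
    u * P * V' powr (1 / of_nat k) = u * V powr (1 / of_nat k :: complex)"
    by (rule chi_step [OF k C]) blast
  have "\<forall>j. \<exists>R\<ge>1. \<forall>\<xi> \<xi>' \<gamma> u V t. t \<ge> R \<longrightarrow> norm \<xi> < t powr (-b) \<longrightarrow>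
    (j \<in> M \<longrightarrow> t \<le> norm V \<and> of_nat k * \<Lambda> * u ^ k = - 1 / V \<and> norm \<gamma> \<le> K \<and>
      norm (\<xi>' - \<xi> * (lam $ j + a $ j * u ^ k + u ^ (k + 1) * \<gamma>)) \<le> K * t powr (-B) \<and>
      Re (a $ j / (lam $ j * \<Lambda>) / (of_nat k * V)) \<ge> 2 * b / t) \<longrightarrow>
    (j \<notin> M \<longrightarrow> norm (\<xi>' - lam $ j * \<xi>) \<le> K * (t powr (-b))\<^sup>2) \<longrightarrow>
    norm \<xi>' < (t + h) powr (-b)" (is "\<forall>j. \<exists>R\<ge>1. ?P j R")
  proof
    fix j
    show "\<exists>R\<ge>1. ?P j R"
    proof (cases "j \<in> M")
      case True
      show ?thesis
        by (rule x_step [OF k \<Lambda>(2) lam(1) [OF True] b K B h, of "a $ j"]) (use True in blast)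
    next
      case False
      show ?thesis
        by (rule y_step [OF lam(3) [OF False] b(1) K h(1)]) (use False in blast)
    qed
  qed
  from choice [OF this] obtain Rf where Rf: "\<forall>j. Rf j \<ge> 1 \<and> ?P j (Rf j)" by (elim exE that)
  \<comment> \<open>All thresholds \<open>Rf j\<close> are positive, so their sum dominates each of
    them.\<close>
  define R where "R = max (max C R1) (max R2 (\<Sum>j\<in>UNIV. Rf j))"
  have RfR: "Rf j \<le> R" for j
  proof -
    have "Rf j \<le> (\<Sum>j\<in>UNIV. Rf j)"
      by (rule member_le_sum) (use Rf in \<open>auto intro: order_trans [OF zero_le_one]\<close>)
    then show ?thesis by (simp add: R_def)
  qed
  show ?thesis
  proof (rule that [of R])
    show "R \<ge> 1" using C by (simp add: R_def)
    fix x x' :: "complex ^ 'n" and \<gamma> :: "'n \<Rightarrow> complex" and V V' :: complex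
    assume V: "V = fatou_coord k \<Lambda> (mi_pow x \<alpha>)" and V': "V' = fatou_coord k \<Lambda> (mi_pow x' \<alpha>)"
      and ReV: "Re V \<ge> R" and ImV: "\<bar>Im V\<bar> < \<epsilon> * Re V" and x: "\<And>i. norm (x $ i) < Re V powr (-b)"
      and M: "\<And>j. j \<in> M \<Longrightarrow> norm (\<gamma> j) \<le> K \<and>
       norm (x' $ j - x $ j * (lam $ j + a $ j * mi_pow x \<alpha> ^ k + mi_pow x \<alpha> ^ (k + 1) * \<gamma> j)) \<le> K * Re V powr (-B)"
      and N: "\<And>j. j \<notin> M \<Longrightarrow> norm (x' $ j - lam $ j * x $ j) \<le> K * (Re V powr (-b))\<^sup>2"
    define t where "t = Re V"
    define u where "u = mi_pow x \<alpha>"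
    have t: "t \<ge> 1" "t \<ge> C" "t \<ge> R1" "t \<ge> R2" "t \<ge> Rf j" for j
      using ReV C RfR [of j] by (auto simp: R_def t_def)
    have u0: "u \<noteq> 0"
    proof
      assume "u = 0"
      then have "V = 0" using k by (simp add: V fatou_coord_def u_def)
      then show False using t(1) by (simp add: t_def)
    qed
    have tV: "t \<le> norm V" using complex_Re_le_cmod by (simp add: t_def)
    have "\<epsilon> * t \<le> 1/2 * t" using \<epsilon> t by (intro mult_right_mono) auto
    then have Vt: "norm V \<le> 2 * t" using cmod_le [of V] ImV t(1) unfolding t_def by linarith
    have x1: "norm (x $ i) \<le> 1" for i
    proof -
      have "t powr (-b) \<le> t powr 0" using b t by (intro powr_mono) auto
      then show ?thesis using x [of i] t by (simp add: t_def)
    qed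
    have "V = -1 / (of_nat k * \<Lambda> * mi_pow x \<alpha> ^ k)" by (simp add: V fatou_coord_def)
    then obtain P where P: "mi_pow x' \<alpha> = u * P" "norm (P - 1) \<le> C / t"
        "norm (P ^ k - (1 - 1 / V)) \<le> C * (t powr (-1/k) / t)"
      using u_step' [of t x V \<gamma> x'] u0 t tV Vt x1 M unfolding t_def u_def by blast
    have Q: "P ^ k \<noteq> 0" "norm (V / P ^ k - V - 1) \<le> \<delta>" using R1(2) [OF t(3) tV Vt P(3)] by auto
    have V'V: "V' = V / P ^ k"
      using Q(1) u0 by (simp add: V V' fatou_coord_def P(1) u_def power_mult_distrib)
    have d: "norm (V' - V - 1) \<le> \<delta>" using Q V'V by simp
    have Re1: "Re V' \<ge> t + 1 - \<delta>" "Re V' \<le> t + h"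
      using abs_Re_le_cmod [of "V' - V - 1"] d by (auto simp: t_def h_def)
    have "\<bar>Im V' - Im V\<bar> \<le> \<delta>" using abs_Im_le_cmod [of "V' - V - 1"] d by simp
    then have "\<bar>Im V'\<bar> < \<epsilon> * t + \<delta>" using ImV by (simp add: t_def)
    also have "\<dots> \<le> \<epsilon> * (t + 1 - \<delta>)"
    proof -
      have "\<epsilon> * \<delta> \<le> 1/2 * \<delta>" using \<epsilon> \<delta> by (intro mult_right_mono) auto
      moreover have "\<epsilon> * (t + 1 - \<delta>) = \<epsilon> * t + \<epsilon> - \<epsilon> * \<delta>" by (simp add: algebra_simps)
      ultimately show ?thesis using \<epsilon> by (simp add: \<delta>_def)
    qed
    also have "\<dots> \<le> \<epsilon> * Re V'" using Re1 \<epsilon> by (intro mult_left_mono) auto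
    finally have Im': "\<bar>Im V'\<bar> < \<epsilon> * Re V'" .
    have Repos: "Re V > 0" "Re V' > 0" using t(1) Re1 \<delta> by (auto simp: t_def)
    have V1: "of_nat k * \<Lambda> * u ^ k = - 1 / V"
      using u0 k \<Lambda>(2) by (simp add: V fatou_coord_def u_def)
    have x'b: "norm (x' $ j) < Re V' powr (-b)" for j
    proof -
      have "norm (x' $ j) < (t + h) powr (-b)"
      proof (rule Rf [rule_format, THEN conjunct2, rule_format, of j t "x $ j" V u "\<gamma> j"])
        show "t \<ge> Rf j" by (rule t)
        show "norm (x $ j) < t powr - b" using x by (simp add: t_def)
        show "norm (x' $ j - lam $ j * x $ j) \<le> K * (t powr (-b))\<^sup>2" if "j \<notin> M"
          using N [OF that] by (simp add: t_def)
        assume j: "j \<in> M"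
        have "Re (a $ j / (lam $ j * \<Lambda>) / V) \<ge> Re (a $ j / (lam $ j * \<Lambda>)) / (2 * Re V)"
          by (rule sector_Re_divide [OF Repos(1) _ _ \<epsilon>(2) p(1) [OF j]]) (use ImV \<epsilon> in auto)
        then have "Re (a $ j / (lam $ j * \<Lambda>) / V) \<ge> 4 * b * k / (2 * Re V)"
          using divide_right_mono [OF p(2) [OF j], of "2 * Re V"] Repos by linarith
        then have "Re (a $ j / (lam $ j * \<Lambda>) / V) / k \<ge> 4 * b * k / (2 * Re V) / k"
          by (rule divide_right_mono) simp
        also have "4 * b * k / (2 * Re V) / k = 2 * b / t" using k by (simp add: t_def)
        also have "Re (a $ j / (lam $ j * \<Lambda>) / V) / k = Re (a $ j / (lam $ j * \<Lambda>) / V / of_real (real k))"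
          by (rule Re_divide_of_real [symmetric])
        also have "a $ j / (lam $ j * \<Lambda>) / V / of_real (real k) = a $ j / (lam $ j * \<Lambda>) / (of_nat k * V)"
          by simp
        finally show "t \<le> norm V \<and> of_nat k * \<Lambda> * u ^ k = - 1 / V \<and> norm (\<gamma> j) \<le> K \<and>
          norm (x' $ j - x $ j * (lam $ j + a $ j * u ^ k + u ^ (k + 1) * \<gamma> j)) \<le> K * t powr (-B) \<and>
          Re (a $ j / (lam $ j * \<Lambda>) / (of_nat k * V)) \<ge> 2 * b / t"
          using tV V1 M [OF j] unfolding t_def u_def by blast
      qed
      also have "\<dots> \<le> Re V' powr (-b)" using Re1 Repos b by (intro powr_mono2') auto
      finally show ?thesis .
    qed
    have "u * P * V' powr (1 / of_nat k) = u * V powr (1 / of_nat k)"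
    proof (rule R2(2) [OF t(4) tV Repos _ P(2) u0])
      show "norm (V' - V - 1) \<le> 1" using d \<delta> by simp
      show "(u * P) ^ k * V' = u ^ k * V" using Q(1) unfolding V'V power_mult_distrib
        by (metis mult.assoc nonzero_mult_div_cancel_left times_divide_eq_right)
    qed
    then show "Re V' \<ge> Re V + 1/2 \<and> \<bar>Im V'\<bar> < \<epsilon> * Re V' \<and> (\<forall>i. norm (x' $ i) < Re V' powr (-b)) \<and>
      mi_pow x' \<alpha> * V' powr (1 / of_nat k) = mi_pow x \<alpha> * V powr (1 / of_nat k)"
      using Re1 Im' x'b \<delta> by (simp add: P(1) t_def u_def)
  qed
qed

section \<open>Petals\<close>

text \<open>\<open>\<rho>\<close> confines \<open>z\<close> to the range of the germ estimates.
  \<open>R\<close> remains a parameter because the sub-petals with larger \<open>R\<close> provide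
  the neighbourhood basis.\<close>

definition petal :: "(complex ^ 'n \<Rightarrow> complex ^ 'n) \<Rightarrow> (complex ^ 'n \<Rightarrow> complex) \<Rightarrow> (complex ^ 'n \<Rightarrow> complex) \<Rightarrow>
    nat \<Rightarrow> real \<Rightarrow> real \<Rightarrow> real \<Rightarrow> complex \<Rightarrow> real \<Rightarrow> (complex ^ 'n) set"
  where "petal X u V k \<epsilon> b \<rho> c R = {z. norm z < \<rho> \<and> Re (V z) > R \<and> \<bar>Im (V z)\<bar> < \<epsilon> * Re (V z) \<and>
    (\<forall>i. norm (X z $ i) < Re (V z) powr (-b)) \<and> u z * V z powr (1 / of_nat k) = c}"

text \<open>
  On a petal, \<open>u V\<^bsup>1/k\<^esup>\<close> takes only the finitely many values \<open>c\<close> with \<open>c\<^sup>k = - 1 / (k \<Lambda>)\<close>; these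
  label the \<open>k\<close> sectors in the \<open>u\<close>-plane, and the last condition is thus both open and closed.
\<close>

lemma open_petal:
  fixes X :: "complex ^ 'n \<Rightarrow> complex ^ 'n" and u :: "complex ^ 'n \<Rightarrow> complex"
  assumes k: "k \<ge> 1" and \<Lambda>: "\<Lambda> \<noteq> 0" and R: "R \<ge> 0"
    and X: "\<And>z i. norm z < \<rho> \<Longrightarrow> isCont (\<lambda>z. X z $ i) z"
    and u: "\<And>z. norm z < \<rho> \<Longrightarrow> isCont u z"
  shows "open (petal X u (\<lambda>z. fatou_coord k \<Lambda> (u z)) k \<epsilon> b \<rho> c R)" (is "open ?P")
proof -
  define V where "V z = fatou_coord k \<Lambda> (u z)" for z
  have P: "?P = petal X u V k \<epsilon> b \<rho> c R" by (simp add: V_def [abs_def])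
  define br where "br z = u z * V z powr (1 / of_nat k)" for z
  have root: "br z ^ k = - 1 / (of_nat k * \<Lambda>)" if "Re (V z) > 0" for z
  proof -
    have "u z \<noteq> 0" using that k by (auto simp: V_def fatou_coord_def power_0_left)
    moreover have "br z ^ k = u z ^ k * V z" by (simp add: br_def power_mult_distrib powr_root_power [OF k])
    ultimately show ?thesis using k \<Lambda> by (simp add: V_def fatou_coord_def)
  qed
  have "finite {w. w ^ k = - 1 / (of_nat k * \<Lambda>)}"
    using k by (intro finite_nth_roots) auto
  then obtain e where e: "e > 0" "\<And>w. w ^ k = - 1 / (of_nat k * \<Lambda>) \<Longrightarrow> w \<noteq> c \<Longrightarrow> e \<le> dist c w"
    using finite_set_avoid [of "{w. w ^ k = - 1 / (of_nat k * \<Lambda>)}" c] by blast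
  have "\<exists>T. open T \<and> z \<in> T \<and> T \<subseteq> petal X u V k \<epsilon> b \<rho> c R" if z: "z \<in> petal X u V k \<epsilon> b \<rho> c R" for z
  proof -
    have z': "norm z < \<rho>" "Re (V z) > R" "\<bar>Im (V z)\<bar> < \<epsilon> * Re (V z)"
      "\<And>i. norm (X z $ i) < Re (V z) powr (-b)" "br z = c"
      using z by (auto simp: petal_def br_def)
    have u0: "u z \<noteq> 0" using z'(2) R k by (auto simp: V_def fatou_coord_def power_0_left)
    have cu: "(u \<longlongrightarrow> u z) (nhds z)"
      using u [OF z'(1)] by (simp add: isCont_def tendsto_at_iff_tendsto_nhds)
    have cX: "((\<lambda>z. X z $ i) \<longlongrightarrow> X z $ i) (nhds z)" for i
      using X [OF z'(1), of i] unfolding isCont_def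
      by (rule tendsto_at_iff_tendsto_nhds [of "\<lambda>z. X z $ i" z, THEN iffD1])
    have cV: "(V \<longlongrightarrow> V z) (nhds z)"
      unfolding V_def fatou_coord_def using u0 k \<Lambda> by (intro tendsto_intros cu) auto
    have "V z \<notin> \<real>\<^sub>\<le>\<^sub>0" using z'(2) R by (auto simp: complex_nonpos_Reals_iff)
    then have cbr: "(br \<longlongrightarrow> c) (nhds z)"
      unfolding z'(5) [symmetric] br_def
      by (intro tendsto_mult cu tendsto_powr_complex cV tendsto_const) auto
    have 1: "\<forall>\<^sub>F w in nhds z. norm w < \<rho>"
      by (rule order_tendstoD(2) [OF _ z'(1)]) (intro tendsto_norm filterlim_ident)
    have 2: "\<forall>\<^sub>F w in nhds z. Re (V w) > R"
      by (rule order_tendstoD(1) [OF _ z'(2)]) (intro tendsto_intros cV)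
    have "\<forall>\<^sub>F w in nhds z. \<epsilon> * Re (V w) - \<bar>Im (V w)\<bar> > 0"
      by (rule order_tendstoD(1) [where y = "\<epsilon> * Re (V z) - \<bar>Im (V z)\<bar>"])
         (intro tendsto_intros cV, use z'(3) in simp)
    then have 3: "\<forall>\<^sub>F w in nhds z. \<bar>Im (V w)\<bar> < \<epsilon> * Re (V w)" by eventually_elim simp
    have "\<forall>\<^sub>F w in nhds z. Re (V w) powr (-b) - norm (X w $ i) > 0" for i
      by (rule order_tendstoD(1) [where y = "Re (V z) powr (-b) - norm (X z $ i)"])
         (intro tendsto_intros cV cX, use z'(2) R z'(4) [of i] in auto)
    then have 4: "\<forall>\<^sub>F w in nhds z. \<forall>i. norm (X w $ i) < Re (V w) powr (-b)"
      by (intro eventually_all_finite) simp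
    have "\<forall>\<^sub>F w in nhds z. dist (br w) c < e" by (rule tendstoD [OF cbr e(1)])
    then have "\<forall>\<^sub>F w in nhds z. w \<in> petal X u V k \<epsilon> b \<rho> c R"
      using 1 2 3 4
    proof eventually_elim
      case (elim w)
      then have "br w = c" using root [of w] e(2) [of "br w"] R by (force simp: dist_commute)
      with elim show ?case by (simp add: petal_def br_def)
    qed
    then show ?thesis unfolding eventually_nhds by blast
  qed
  then show ?thesis unfolding P open_subopen [of "petal X u V k \<epsilon> b \<rho> c R"] by blast
qed

lemma petal_disjoint: "c \<noteq> c' \<Longrightarrow> petal X u V k \<epsilon> b \<rho> c R \<inter> petal X u V k \<epsilon> b \<rho> c' R' = {}"
  by (auto simp: petal_def)

lemma petal_mono: "R \<le> R' \<Longrightarrow> petal X u V k \<epsilon> b \<rho> c R' \<subseteq> petal X u V k \<epsilon> b \<rho> c R"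
  by (auto simp: petal_def)

text \<open>A sub-petal \<open>P R\<close> is forward invariant but no neighbourhood of 0, so a
  small ball is adjoined. The ball is chosen so that its part of \<open>P R0\<close> already lies in
  \<open>P R\<close>; intersecting with \<open>P R0\<close> therefore returns just the invariant set
  \<open>P R\<close>.\<close>

lemma petal_basin:
  fixes F X :: "complex ^ 'n \<Rightarrow> complex ^ 'n" and u V :: "complex ^ 'n \<Rightarrow> complex"
  assumes P: "P = petal X u V k \<epsilon> b \<rho> c" and R0: "R0 \<ge> 1" and b: "b > 0" and op: "open (P R0)" and acc: "\<And>e. e > 0 \<Longrightarrow> \<exists>z\<in>P R0. norm z < e"
    and step: "\<And>z R. R \<ge> R0 \<Longrightarrow> z \<in> P R \<Longrightarrow> F z \<in> P R \<and> Re (V (F z)) \<ge> Re (V z) + 1/2"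
    and size: "\<And>z. z \<in> P R0 \<Longrightarrow> norm z \<le> K * Re (V z) powr (-b)" and K: "K > 0"
    and large: "\<And>R. \<exists>r>0. \<forall>z\<in>P R0. norm z < r \<longrightarrow> Re (V z) > R"
  shows "basin_of_attraction F (P R0) \<and> 0 \<in> frontier (P R0)"
proof -
  define B where "B = {ball 0 r \<union> P R | r R. r > 0 \<and> R \<ge> R0 \<and> (\<forall>z\<in>P R0. norm z < r \<longrightarrow> Re (V z) > R)}"
  have sub: "P R \<subseteq> P R0" if "R \<ge> R0" for R unfolding P by (rule petal_mono [OF that])
  have powr_small: "\<exists>R\<ge>R0. K * R powr (-b) < e" if "e > 0" for e
  proof -
    have "((\<lambda>t. K * t powr (-b)) \<longlongrightarrow> K * 0) at_top"
      by (intro tendsto_intros tendsto_powr_minus b)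
    then have "\<forall>\<^sub>F t in at_top. K * t powr (-b) < e"
      by (rule order_tendstoD(2)) (use that in simp)
    then have "\<forall>\<^sub>F t in at_top. R0 \<le> t \<and> K * t powr (-b) < e"
      using eventually_ge_at_top [of R0] by eventually_elim simp
    then show ?thesis by (rule eventually_happens'[rotated]) simp
  qed
  have orbit: "(F ^^ p) z \<in> P R0 \<and> Re (V ((F ^^ p) z)) \<ge> R0 + p / 2" if "z \<in> P R0" for z p
  proof (induction p)
    case 0
    then show ?case using that by (simp add: P petal_def)
  next
    case (Suc p)
    then show ?case using step [of R0 "(F ^^ p) z"] by (simp add: field_simps)
  qed
  have conv: "(\<lambda>p. (F ^^ p) z) \<longlonglongrightarrow> 0" if z: "z \<in> P R0" for z
  proof (rule Lim_null_comparison)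
    show "\<forall>\<^sub>F p in sequentially. norm ((F ^^ p) z) \<le> K * (R0 + p / 2) powr (-b)"
    proof (rule always_eventually, rule allI)
      fix p
      have "norm ((F ^^ p) z) \<le> K * Re (V ((F ^^ p) z)) powr (-b)"
        by (rule size) (use orbit [OF z] in blast)
      also have "\<dots> \<le> K * (R0 + p / 2) powr (-b)"
        using orbit [OF z, of p] K b R0 by (intro mult_left_mono powr_mono2') auto
      finally show "norm ((F ^^ p) z) \<le> K * (R0 + p / 2) powr (-b)" .
    qed
    have "filterlim (\<lambda>p. R0 + 1/2 * real p) at_top sequentially"
      by (rule filterlim_tendsto_add_at_top [OF tendsto_const
            filterlim_tendsto_pos_mult_at_top [OF tendsto_const _ filterlim_real_sequentially]]) simp
    then have "filterlim (\<lambda>p. R0 + real p / 2) at_top sequentially" by simp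
    then have "(\<lambda>p. K * (R0 + real p / 2) powr (-b)) \<longlonglongrightarrow> K * 0"
      by (intro tendsto_mult tendsto_const filterlim_compose [OF tendsto_powr_minus [OF b]])
    then show "(\<lambda>p. K * (R0 + real p / 2) powr (-b)) \<longlonglongrightarrow> 0" by simp
  qed
  have "nhd_basis_at_0 B"
    unfolding nhd_basis_at_0_def
  proof (intro conjI ballI allI impI)
    fix \<Omega> assume "\<Omega> \<in> B"
    then obtain r where "r > 0" "ball 0 r \<subseteq> \<Omega>" by (auto simp: B_def)
    then show "0 \<in> interior \<Omega>" by (meson centre_in_ball interiorI open_ball)
  next
    fix W :: "(complex ^ 'n) set" assume "open W \<and> 0 \<in> W"
    then obtain e where e: "e > 0" "ball 0 e \<subseteq> W" using openE by blast
    obtain R where R: "R \<ge> R0" "K * R powr (-b) < e" using powr_small [OF e(1)] by blast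
    obtain r where r: "r > 0" "\<forall>z\<in>P R0. norm z < r \<longrightarrow> Re (V z) > R" using large by blast
    have "P R \<subseteq> ball 0 e"
    proof
      fix z assume z: "z \<in> P R"
      have "norm z \<le> K * Re (V z) powr (-b)" using size sub [OF R(1)] z by blast
      also have "\<dots> \<le> K * R powr (-b)"
        using z K R R0 b by (intro mult_left_mono powr_mono2') (auto simp: P petal_def)
      finally show "z \<in> ball 0 e" using R by simp
    qed
    moreover have "ball 0 (min r e) \<union> P R \<in> B"
      unfolding B_def using r e R by (intro CollectI exI [of _ "min r e"] exI [of _ R]) auto
    ultimately show "\<exists>\<Omega>\<in>B. \<Omega> \<subseteq> W" using e(2)
      by (intro bexI [of _ "ball 0 (min r e) \<union> P R"]) auto
  qed
  moreover have "F ` (P R0 \<inter> \<Omega>) \<subseteq> P R0 \<inter> \<Omega>" if "\<Omega> \<in> B" for \<Omega>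
  proof -
    obtain r R where \<Omega>: "\<Omega> = ball 0 r \<union> P R" "R \<ge> R0" "\<forall>z\<in>P R0. norm z < r \<longrightarrow> Re (V z) > R"
      using \<open>\<Omega> \<in> B\<close> by (auto simp: B_def)
    have "P R0 \<inter> \<Omega> \<subseteq> P R"
      using \<Omega> by (auto simp: P petal_def)
    then have "F ` (P R0 \<inter> \<Omega>) \<subseteq> P R" using step [OF \<Omega>(2)] by blast
    then show ?thesis using \<Omega>(1) sub [OF \<Omega>(2)] by blast
  qed
  moreover have "0 \<in> closure (P R0)"
    unfolding closure_approachable using acc by (simp add: dist_norm)
  moreover have "P R0 \<noteq> {}" using acc [of 1] by auto
  ultimately have "basin_of_attraction F (P R0)"
    unfolding basin_of_attraction_def using op conv by blast
  \<comment> \<open>If 0 were in the petal, \<open>large\<close> with the bound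
    \<open>Re (V 0)\<close> would give \<open>Re (V 0) > Re (V 0)\<close>.\<close>
  moreover have "0 \<notin> P R0"
    using large [of "Re (V 0)"] by force
  then have "0 \<in> frontier (P R0)"
    using \<open>0 \<in> closure (P R0)\<close> interior_subset by (auto simp: frontier_def)
  ultimately show ?thesis by blast
qed

section \<open>Accumulation of the petals at 0 and construction of the basins\<close>

lemma ord_germs_uniform:
  fixes f :: "'n::finite \<Rightarrow> complex ^ 'm \<Rightarrow> complex"
  assumes "\<And>i. f i \<in> ord_germs d"
  obtains C r where "C > 0" "r > 0" "\<And>z i. norm z < r \<Longrightarrow> norm (f i z) \<le> C * norm z ^ d"
proof -
  have "(\<lambda>z. of_real (norm (\<chi> i. f i z))) \<in> ord_germs d"
    by (rule norm_ord_germs) (simp add: assms)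
  then obtain C r where C: "C > 0" "r > 0" "\<And>z. norm z < r \<Longrightarrow> norm (\<chi> i. f i z) \<le> C * norm z ^ d"
    by (auto simp: ord_germs_iff)
  have "norm (f i z) \<le> C * norm z ^ d" if "norm z < r" for z i
    using Finite_Cartesian_Product.norm_nth_le [of "\<chi> i. f i z" i] C(3) [OF that] by simp
  then show ?thesis using that C by blast
qed

lemma has_derivative_vecI:
  fixes f :: "'a::euclidean_space \<Rightarrow> complex ^ 'n"
  assumes "\<And>i. ((\<lambda>z. f z $ i) has_derivative (\<lambda>v. D v $ i)) F"
  shows "(f has_derivative D) F"
  unfolding has_derivative_def
proof
  have lin: "linear (\<lambda>v. D v $ i)" for i
    using has_derivative_bounded_linear [OF assms] by (rule bounded_linear.linear)
  have "linear D"
    by (rule linearI) (simp_all add: vec_eq_iff linear_add [OF lin] linear_scale [OF lin])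
  then show "bounded_linear D" by (rule linear_conv_bounded_linear [THEN iffD1])
  show "((\<lambda>y. (f y - f (Lim F (\<lambda>x. x)) - D (y - Lim F (\<lambda>x. x))) /\<^sub>R norm (y - Lim F (\<lambda>x. x))) \<longlongrightarrow> 0) F"
    by (rule vec_tendstoI) (use assms in \<open>simp add: has_derivative_def\<close>)
qed

lemma continuous_mi_pow:
  assumes "\<And>i. isCont (\<lambda>z. X z $ i :: complex) z"
  shows "isCont (\<lambda>z. mi_pow (X z) \<alpha>) z"
  using assms unfolding mi_pow_def isCont_def by (intro tendsto_prod tendsto_power) auto

text \<open>A point is prescribed in the coordinates \<open>X\<close>: all entries in
  \<open>M\<close> equal one root \<open>\<tau>\<close>, the others are 0, and \<open>V\<close> is a
  large real \<open>T\<close>. Then \<open>|\<tau>|\<close> has size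
  \<open>T powr (- 1 / (k * mi_deg \<alpha>))\<close>, below the barrier exactly because of the
  condition on \<open>b\<close>. The invertible derivative makes \<open>X\<close> open at 0, so such
  points have preimages near 0.\<close>

lemma normal_form_accumulates:
  fixes X :: "complex ^ 'n \<Rightarrow> complex ^ 'n" and b :: real
  assumes k: "k \<ge> 1" and \<Lambda>: "\<Lambda> \<noteq> 0" and \<alpha>: "\<And>j. j \<notin> M \<Longrightarrow> \<alpha> $ j = 0" "mi_deg \<alpha> \<ge> 1"
    and X: "\<And>z i. norm z < \<rho> \<Longrightarrow> isCont (\<lambda>z. X z $ i) z" and \<rho>: "\<rho> > 0"
    and der: "\<And>i. ((\<lambda>z. X z $ i) has_derivative (\<lambda>v. cc $ i * v $ i)) (at 0)" and X0: "X 0 = 0"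
    and cc: "\<And>i. cc $ i \<noteq> 0"
    and b: "b > 0" "b * (k * mi_deg \<alpha>) < 1" and \<epsilon>: "\<epsilon> > 0"
    and c: "c ^ k = - 1 / (of_nat k * \<Lambda>)" and e: "e > 0" and R: "R \<ge> 1"
  shows "\<exists>z\<in>petal X (\<lambda>z. mi_pow (X z) \<alpha>) (\<lambda>z. fatou_coord k \<Lambda> (mi_pow (X z) \<alpha>)) k \<epsilon> b \<rho> c R. norm z < e"
proof -
  define e' where "e' = min e \<rho>"
  have e': "e' > 0" using e \<rho> by (simp add: e'_def)
  define N where "N = mi_deg \<alpha>"
  have N: "N \<ge> 1" using \<alpha> by (simp add: N_def)
  have derX: "(X has_derivative (\<lambda>v. \<chi> i. cc $ i * v $ i)) (at 0)"
    by (rule has_derivative_vecI) (simp add: der)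
  have "0 \<in> interior (X ` ball 0 e')"
  proof -
    have "X 0 \<in> interior (X ` ball 0 e')"
    proof (rule sussmann_open_mapping [OF open_ball _ _ derX])
      show "continuous_on (ball 0 e') X"
        using X unfolding e'_def
        by (intro continuous_at_imp_continuous_on ballI) (auto simp: isCont_def intro: vec_tendstoI)
      show "bounded_linear (\<lambda>v :: complex ^ 'n. \<chi> i. v $ i / cc $ i)"
        by (rule linear_conv_bounded_linear [THEN iffD1], rule linearI)
           (auto simp: vec_eq_iff add_divide_distrib scaleR_conv_of_real)
      show "(\<lambda>v. \<chi> i. cc $ i * v $ i) \<circ> (\<lambda>v. \<chi> i. v $ i / cc $ i) = id"
        using cc by (auto simp: fun_eq_iff vec_eq_iff)
    qed (use e' in \<open>auto simp: interior_open\<close>)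
    then show ?thesis using X0 by simp
  qed
  then obtain s where s: "s > 0" "ball 0 s \<subseteq> X ` ball 0 e'"
    unfolding mem_interior by blast
  \<comment> \<open>The surplus of the decay exponent of \<open>\<tau>\<close> over that of the
    barrier.\<close>
  define h where "h = 1 / (real k * real N) - b"
  have h: "h > 0" using b k N by (simp add: h_def N_def field_simps)
  define A where "A = norm c powr (1 / N)"
  have "((\<lambda>t. A * t powr (-h)) \<longlongrightarrow> A * 0) at_top"
    by (intro tendsto_intros tendsto_powr_minus h)
  then have 1: "\<forall>\<^sub>F t in at_top. A * t powr (-h) < 1"
    by (rule order_tendstoD(2)) simp
  have "((\<lambda>t. real CARD('n) * t powr (-b)) \<longlongrightarrow> real CARD('n) * 0) at_top"
    by (intro tendsto_intros tendsto_powr_minus b)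
  then have 2: "\<forall>\<^sub>F t in at_top. real CARD('n) * t powr (-b) < s"
    by (rule order_tendstoD(2)) (use s in simp)
  have "\<forall>\<^sub>F t in at_top. R < t \<and> A * t powr (-h) < 1 \<and> real CARD('n) * t powr (-b) < s"
    using 1 2 eventually_gt_at_top [of R] by eventually_elim simp
  then obtain T where T: "R < T" "A * T powr (-h) < 1" "real CARD('n) * T powr (-b) < s"
    using eventually_happens'[rotated] by force
  \<comment> \<open>For \<open>V = T\<close> real and positive this is the only value of
    \<open>u\<close> with label \<open>c\<close>.\<close>
  define u where "u = c * of_real (T powr (-1/k))"
  have T0: "T > 0" using T R by simp
  have c0: "c \<noteq> 0" using c k \<Lambda> by (auto simp: power_0_left)
  obtain \<tau> where \<tau>: "\<tau> ^ N = u"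
    using powr_root_power [OF N] by blast
  define \<xi> :: "complex ^ 'n" where "\<xi> = (\<chi> i. if i \<in> M then \<tau> else 0)"
  have mp: "mi_pow \<xi> \<alpha> = u"
  proof -
    have "\<xi> $ i ^ \<alpha> $ i = \<tau> ^ \<alpha> $ i" for i using \<alpha>(1) [of i] by (cases "i \<in> M") (simp_all add: \<xi>_def)
    then show ?thesis by (simp add: mi_pow_def mi_deg_def N_def flip: \<tau> power_sum)
  qed
  have Tk: "(T powr (-1/k)) ^ k = 1 / T"
  proof -
    have "(T powr (-1/k)) ^ k = (T powr (-1/k)) powr real k" using T0 by (simp only: powr_realpow powr_gt_zero)
    also have "\<dots> = T powr (-1)" unfolding powr_powr using k by simp
    finally show ?thesis using T0 by (simp add: powr_minus_divide)
  qed
  have V: "fatou_coord k \<Lambda> u = of_real T"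
  proof -
    have "u ^ k = - 1 / (of_nat k * \<Lambda>) * of_real (1 / T)"
      by (simp only: u_def power_mult_distrib c of_real_power [symmetric] Tk)
    then show ?thesis using k \<Lambda> T0 by (simp add: fatou_coord_def)
  qed
  have br: "u * of_real T powr (1 / of_nat k) = c"
  proof -
    have "(of_real T :: complex) powr (1 / of_nat k) = of_real (T powr (1 / k))"
      using powr_of_real [of T "1 / k"] T0 by simp
    moreover have "T powr (-1/k) * T powr (1/k) = 1"
      using T0 by (simp flip: powr_add)
    ultimately show ?thesis
      by (simp add: u_def mult.assoc flip: of_real_mult)
  qed
  have n\<tau>: "norm \<tau> < T powr (-b)"
  proof -
    have "norm \<tau> = (norm \<tau> ^ N) powr (1 / N)"
      using N c0 T0 \<tau> by (cases "\<tau> = 0") (simp_all add: u_def power_0_left powr_powr flip: powr_realpow)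
    also have "norm \<tau> ^ N = norm c * T powr (-1/k)"
      unfolding norm_power [symmetric] \<tau> using T0 by (simp add: u_def norm_mult)
    also have "\<dots> powr (1 / N) = A * T powr (- (1 / (real k * real N)))"
      using T0 by (simp add: A_def powr_mult powr_powr)
    also have "\<dots> = A * T powr (-h) * T powr (-b)"
      using T0 by (simp add: h_def mult.assoc flip: powr_add)
    also have "\<dots> < 1 * T powr (-b)"
      using T T0 by (intro mult_strict_right_mono) auto
    finally show ?thesis by simp
  qed
  have \<xi>: "norm (\<xi> $ i) < T powr (-b)" for i
    using n\<tau> T0 by (simp add: \<xi>_def)
  have "norm \<xi> \<le> (\<Sum>i\<in>(UNIV::'n set). norm (\<xi> $ i))" by (rule norm_vec_le_sum)
  also have "\<dots> \<le> (\<Sum>i\<in>(UNIV::'n set). T powr (-b))"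
    by (intro sum_mono less_imp_le \<xi>)
  also have "\<dots> < s" using T by simp
  finally obtain z where z: "norm z < e'" "X z = \<xi>" using s(2) by (auto simp: subset_iff image_iff)
  then have "z \<in> petal X (\<lambda>z. mi_pow (X z) \<alpha>) (\<lambda>z. fatou_coord k \<Lambda> (mi_pow (X z) \<alpha>)) k \<epsilon> b \<rho> c R"
    using T T0 \<xi> br \<epsilon> by (simp add: petal_def mp V e'_def)
  then show ?thesis using z by (auto simp: e'_def)
qed

text \<open>On a petal \<open>|z| \<le> K0 * t powr (-b)\<close>, which turns orders of vanishing
  into powers of \<open>t\<close>: the remainder of order \<open>d\<close> becomes
  \<open>K * t powr (- (b * d))\<close>, and outside \<open>M\<close>, where \<open>X\<close> is the
  identity, the nonlinear part of \<open>F\<close> becomes quadratic in the barrier.\<close>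

lemma normal_form_basins:
  fixes F X :: "complex ^ 'n \<Rightarrow> complex ^ 'n" and b \<epsilon> :: real
  assumes F: "holomorphic_map_on F U" "0 \<in> U" "F 0 = 0"
    and Flin: "\<And>i. agree 1 (\<lambda>z. F z $ i) (\<lambda>z. lam $ i * z $ i)"
    and k: "k \<ge> 1" and \<Lambda>: "\<Lambda> = (\<Sum>j\<in>M. a $ j * of_nat (\<alpha> $ j) / lam $ j)" "\<Lambda> \<noteq> 0"
    and lam: "\<And>j. j \<in> M \<Longrightarrow> norm (lam $ j) = 1" "mi_pow lam \<alpha> = 1" "\<And>j. j \<notin> M \<Longrightarrow> norm (lam $ j) < 1"
    and \<alpha>: "\<And>j. j \<notin> M \<Longrightarrow> \<alpha> $ j = 0" "mi_deg \<alpha> \<ge> 1"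
    and cc: "\<And>i. cc $ i \<noteq> 0" and nf: "normal_form F lam M \<alpha> k a cc d X g"
    and b: "0 < b" "b \<le> 1" "b * (k * mi_deg \<alpha>) < 1" and d: "b * d \<ge> 3" and \<epsilon>: "0 < \<epsilon>" "\<epsilon> \<le> 1/2"
    and p: "\<And>j. j \<in> M \<Longrightarrow> \<epsilon> * norm (a $ j / (lam $ j * \<Lambda>)) \<le> Re (a $ j / (lam $ j * \<Lambda>)) / 4"
      "\<And>j. j \<in> M \<Longrightarrow> 4 * b * k \<le> Re (a $ j / (lam $ j * \<Lambda>))"
  obtains W where "\<And>c. c ^ k = - 1 / (of_nat k * \<Lambda>) \<Longrightarrow> basin_of_attraction F (W c) \<and> 0 \<in> frontier (W c)"
    "\<And>c c'. c \<noteq> c' \<Longrightarrow> W c \<inter> W c' = {}"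
proof -
  define u where "u z = mi_pow (X z) \<alpha>" for z
  define V where "V z = fatou_coord k \<Lambda> (u z)" for z
  have holX: "holomorphic_germ (\<lambda>z. X z $ i)" and agX: "agree 1 (\<lambda>z. X z $ i) (\<lambda>z. cc $ i * z $ i)"
    and XN: "i \<notin> M \<Longrightarrow> X z $ i = z $ i" for i z
    using nf by (auto simp: normal_form_def)
  have nfM: "holomorphic_germ (g j)" "(\<lambda>z. X (F z) $ j - X z $ j *
         (lam $ j + a $ j * mi_pow (X z) \<alpha> ^ k + mi_pow (X z) \<alpha> ^ (k + 1) * g j z)) \<in> ord_germs d"
    if "j \<in> M" for j using nf that by (auto simp: normal_form_def)
  have X1: "(\<lambda>z. X z $ i) \<in> ord_germs 1" for i using agX agree_ord by blast
  have X0: "X 0 = 0"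
  proof -
    have "X 0 $ i = 0" for i
    proof -
      obtain C r where "C > 0" "r > 0" "\<And>z. norm z < r \<Longrightarrow> norm (X z $ i) \<le> C * norm z ^ 1"
        using X1 [of i] unfolding ord_germs_iff by blast
      from this(3) [of 0] this(2) show ?thesis by simp
    qed
    then show ?thesis by (simp add: vec_eq_iff)
  qed
  have F1: "(\<lambda>z. F z $ i) \<in> ord_germs 1" for i using Flin agree_ord by blast
  obtain C1 r1 where C1: "C1 > 0" "r1 > 0" "\<And>z i. norm z < r1 \<Longrightarrow> norm (if i \<in> M then X (F z) $ i - X z $ i *
         (lam $ i + a $ i * mi_pow (X z) \<alpha> ^ k + mi_pow (X z) \<alpha> ^ (k + 1) * g i z) else 0) \<le> C1 * norm z ^ d"
  proof (rule ord_germs_uniform [of "\<lambda>i z. if i \<in> M then X (F z) $ i - X z $ i *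
         (lam $ i + a $ i * mi_pow (X z) \<alpha> ^ k + mi_pow (X z) \<alpha> ^ (k + 1) * g i z) else 0" d])
    fix i show "(\<lambda>z. if i \<in> M then X (F z) $ i - X z $ i *
         (lam $ i + a $ i * mi_pow (X z) \<alpha> ^ k + mi_pow (X z) \<alpha> ^ (k + 1) * g i z) else 0) \<in> ord_germs d"
      by (cases "i \<in> M") (use nfM(2) [of i] in \<open>simp_all add: ord_germs_zero\<close>)
  qed blast
  obtain C2 r2 where C2: "C2 > 0" "r2 > 0" "\<And>z i. norm z < r2 \<Longrightarrow> norm (if i \<in> M then g i z else 0) \<le> C2 * norm z ^ 0"
  proof (rule ord_germs_uniform [of "\<lambda>i z. if i \<in> M then g i z else 0" 0])
    fix i show "(\<lambda>z. if i \<in> M then g i z else 0) \<in> ord_germs 0"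
      by (cases "i \<in> M") (use holomorphic_germ_bounded [OF nfM(1)] in \<open>simp_all add: ord_germs_zero\<close>)
  qed blast
  obtain C3 r3 where C3: "C3 > 0" "r3 > 0" "\<And>z. norm z < r3 \<Longrightarrow> norm (F z) \<le> C3 * norm z"
    using norm_ord_germs [OF F1] by (auto simp: ord_germs_iff)
  obtain C4 r4 where C4: "C4 > 0" "r4 > 0" "\<And>z i. norm z < r4 \<Longrightarrow> norm (F z $ i - lam $ i * z $ i) \<le> C4 * norm z ^ 2"
    by (rule ord_germs_uniform [of "\<lambda>i z. F z $ i - lam $ i * z $ i" 2])
       (use Flin in \<open>auto simp: agree_def numeral_2_eq_2\<close>)
  obtain C5 r5 where C5: "C5 > 0" "r5 > 0" "\<And>z i. norm z < r5 \<Longrightarrow> norm (X z $ i - cc $ i * z $ i) \<le> C5 * norm z ^ 2"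
    by (rule ord_germs_uniform [of "\<lambda>i z. X z $ i - cc $ i * z $ i" 2])
       (use agX in \<open>auto simp: agree_def numeral_2_eq_2\<close>)
  have "\<forall>\<^sub>F z in nhds 0. \<forall>i. \<exists>D. ((\<lambda>z. X z $ i) has_derivative D) (at z) \<and> (\<forall>c v. D (c *s v) = c * D v)"
    using holX unfolding holomorphic_germ_def by (intro eventually_all_finite) simp
  then have "\<forall>\<^sub>F z in nhds 0. \<forall>i. \<exists>D. ((\<lambda>z. X z $ i) has_derivative D) (at z)"
    by (rule eventually_mono) blast
  then obtain r6 where r6: "r6 > 0" "\<And>z i. norm z < r6 \<Longrightarrow> \<exists>D. ((\<lambda>z. X z $ i) has_derivative D) (at z)"
    unfolding eventually_nhds_metric by auto
  define S where "S = (\<Sum>i\<in>(UNIV::'n set). 1 / norm (cc $ i))"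
  have S: "S > 0" unfolding S_def using cc by (intro sum_pos) auto
  \<comment> \<open>Besides the validity radii, the last bound makes
    \<open>C5 * S * norm z \<le> 1/2\<close>, so that the quadratic part of \<open>X\<close> can be
    absorbed when \<open>z\<close> is estimated by \<open>X z\<close>.\<close>
  define \<rho> where "\<rho> = min (min (min r1 r2) (min r3 r4)) (min (min r5 r6) (1 / (2 * S * C5)))"
  have \<rho>: "\<rho> > 0" using C1 C2 C3 C4 C5 r6 S by (simp add: \<rho>_def)
  have \<rho>_le: "\<rho> \<le> r1" "\<rho> \<le> r2" "\<rho> \<le> r3" "\<rho> \<le> r4" "\<rho> \<le> r5" "\<rho> \<le> r6" "\<rho> \<le> 1 / (2 * S * C5)"
    by (auto simp: \<rho>_def)
  have contX: "isCont (\<lambda>z. X z $ i) z" if "norm z < \<rho>" for z i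
    using r6(2) [of z i] that \<rho>_le has_derivative_continuous by fastforce
  have size: "norm z \<le> 2 * S * s" if z: "norm z < \<rho>" and s: "\<And>i. norm (X z $ i) < s" for z s
  proof -
    have "norm (z $ i) \<le> (s + C5 * norm z ^ 2) * (1 / norm (cc $ i))" for i
    proof -
      have "norm (cc $ i * z $ i) \<le> norm (X z $ i) + norm (X z $ i - cc $ i * z $ i)"
        using norm_triangle_sub [of "cc $ i * z $ i" "X z $ i"] by (simp add: norm_minus_commute)
      also have "\<dots> \<le> s + C5 * norm z ^ 2" using s [of i] C5(3) [of z i] z \<rho>_le by simp
      finally show ?thesis using cc [of i] by (simp add: norm_mult field_simps)
    qed
    then have "(\<Sum>i\<in>UNIV. norm (z $ i)) \<le> (s + C5 * norm z ^ 2) * S"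
      unfolding S_def sum_distrib_left by (intro sum_mono)
    then have "norm z \<le> (s + C5 * norm z ^ 2) * S" using norm_vec_le_sum [of z] by linarith
    moreover have "C5 * norm z ^ 2 * S \<le> norm z / 2"
    proof -
      have "norm z \<le> 1 / (2 * S * C5)" using z \<rho>_le by simp
      then have "S * C5 * norm z \<le> 1 / 2" using S C5(1) by (simp add: field_simps)
      then have "S * C5 * norm z * norm z \<le> 1 / 2 * norm z" by (rule mult_right_mono) simp
      then show ?thesis by (simp add: power2_eq_square ac_simps)
    qed
    ultimately show ?thesis by (simp add: algebra_simps)
  qed
  define K0 where "K0 = 2 * S"
  have K0: "K0 > 0" using S by (simp add: K0_def)
  define K where "K = C1 * K0 ^ d + C2 + C4 * K0\<^sup>2"
  have K: "K > 0" using C1 C2 C4 K0 by (simp add: K_def add_pos_pos)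
  have K': "C1 * K0 ^ d \<le> K" "C2 \<le> K" "C4 * K0\<^sup>2 \<le> K" using C1 C2 C4 K0 by (auto simp: K_def)
  obtain R1 where R1: "R1 \<ge> 1" "\<And>x x' \<gamma> V V'. V = fatou_coord k \<Lambda> (mi_pow x \<alpha>) \<Longrightarrow> V' = fatou_coord k \<Lambda> (mi_pow x' \<alpha>) \<Longrightarrow>
    Re V \<ge> R1 \<Longrightarrow> \<bar>Im V\<bar> < \<epsilon> * Re V \<Longrightarrow> (\<And>i. norm (x $ i) < Re V powr (-b)) \<Longrightarrow>
    (\<And>j. j \<in> M \<Longrightarrow> norm (\<gamma> j) \<le> K \<and>
       norm (x' $ j - x $ j * (lam $ j + a $ j * mi_pow x \<alpha> ^ k + mi_pow x \<alpha> ^ (k + 1) * \<gamma> j)) \<le> K * Re V powr (- (b * d))) \<Longrightarrow>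
    (\<And>j. j \<notin> M \<Longrightarrow> norm (x' $ j - lam $ j * x $ j) \<le> K * (Re V powr (-b))\<^sup>2) \<Longrightarrow>
    Re V' \<ge> Re V + 1/2 \<and> \<bar>Im V'\<bar> < \<epsilon> * Re V' \<and> (\<forall>i. norm (x' $ i) < Re V' powr (-b)) \<and>
    mi_pow x' \<alpha> * V' powr (1 / of_nat k) = mi_pow x \<alpha> * V powr (1 / of_nat k)"
    by (rule dynamics_step [OF k \<Lambda> lam \<alpha>(1) K d b(1,2) \<epsilon> p]) blast+
  \<comment> \<open>The petal also requires \<open>norm z < \<rho>\<close>; beyond this threshold
    the image under \<open>F\<close> satisfies it automatically.\<close>
  have "((\<lambda>t. C3 * K0 * t powr (-b)) \<longlongrightarrow> C3 * K0 * 0) at_top"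
    by (intro tendsto_intros tendsto_powr_minus b)
  then have "\<forall>\<^sub>F t in at_top. C3 * K0 * t powr (-b) < \<rho>"
    by (rule order_tendstoD(2)) (use \<rho> in simp)
  then obtain R2 where R2: "R2 \<ge> 1" "\<And>t. t \<ge> R2 \<Longrightarrow> C3 * K0 * t powr (-b) < \<rho>"
    by (rule eventually_at_top_obtain) blast
  define R0 where "R0 = max R1 R2"
  have R0: "R0 \<ge> 1" "R0 \<ge> R1" "R0 \<ge> R2" using R1 by (auto simp: R0_def)
  define P where "P c = petal X u V k \<epsilon> b \<rho> c" for c
  have size': "norm z \<le> K0 * Re (V z) powr (-b)" if "z \<in> P c R" for z c R
    unfolding K0_def by (rule size) (use that in \<open>auto simp: P_def petal_def\<close>)
  have step: "F z \<in> P c R \<and> Re (V (F z)) \<ge> Re (V z) + 1/2" if R: "R \<ge> R0" and z: "z \<in> P c R" for z c R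
  proof -
    define t where "t = Re (V z)"
    have z': "norm z < \<rho>" "t > R" "\<bar>Im (V z)\<bar> < \<epsilon> * t" "\<And>i. norm (X z $ i) < t powr (-b)"
      "u z * V z powr (1 / of_nat k) = c"
      using z by (auto simp: P_def petal_def t_def)
    have t: "t \<ge> 1" "t \<ge> R1" "t \<ge> R2" using z'(2) R R0 by auto
    have nz: "norm z \<le> K0 * t powr (-b)" using size' [OF z] by (simp add: t_def)
    have "norm (F z) \<le> C3 * (K0 * t powr (-b))"
      using C3(3) [of z] z'(1) \<rho>_le nz C3(1) by (intro order_trans [OF _ mult_left_mono [OF nz]]) auto
    also have "\<dots> < \<rho>" using R2(2) [OF t(3)] by (simp add: mult.assoc)
    finally have nF: "norm (F z) < \<rho>" .
    have "Re (V (F z)) \<ge> Re (V z) + 1/2 \<and> \<bar>Im (V (F z))\<bar> < \<epsilon> * Re (V (F z)) \<and>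
      (\<forall>i. norm (X (F z) $ i) < Re (V (F z)) powr (-b)) \<and>
      mi_pow (X (F z)) \<alpha> * V (F z) powr (1 / of_nat k) = mi_pow (X z) \<alpha> * V z powr (1 / of_nat k)"
    proof (rule R1(2) [where \<gamma> = "\<lambda>j. g j z"])
      show "V z = fatou_coord k \<Lambda> (mi_pow (X z) \<alpha>)" "V (F z) = fatou_coord k \<Lambda> (mi_pow (X (F z)) \<alpha>)"
        by (simp_all add: V_def u_def)
      show "Re (V z) \<ge> R1" "\<bar>Im (V z)\<bar> < \<epsilon> * Re (V z)" using t z' by (simp_all add: t_def)
      show "norm (X z $ i) < Re (V z) powr (-b)" for i using z' by (simp add: t_def)
      show "norm (g j z) \<le> K \<and> norm (X (F z) $ j - X z $ j * (lam $ j + a $ j * mi_pow (X z) \<alpha> ^ k +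
          mi_pow (X z) \<alpha> ^ (k + 1) * g j z)) \<le> K * Re (V z) powr (- (b * d))" if j: "j \<in> M" for j
      proof
        show "norm (g j z) \<le> K" using C2(3) [of z j] j z'(1) \<rho>_le K' by simp
        have "norm (X (F z) $ j - X z $ j * (lam $ j + a $ j * mi_pow (X z) \<alpha> ^ k +
          mi_pow (X z) \<alpha> ^ (k + 1) * g j z)) \<le> C1 * norm z ^ d"
          using C1(3) [of z j] j z'(1) \<rho>_le by simp
        also have "\<dots> \<le> C1 * (K0 * t powr (-b)) ^ d"
          using nz C1(1) by (intro mult_left_mono power_mono) auto
        also have "\<dots> = C1 * K0 ^ d * t powr (- (b * d))"
          using t by (simp add: power_mult_distrib powr_powr flip: powr_realpow)
        also have "\<dots> \<le> K * t powr (- (b * d))" using K' by (intro mult_right_mono) auto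
        finally show "norm (X (F z) $ j - X z $ j * (lam $ j + a $ j * mi_pow (X z) \<alpha> ^ k +
          mi_pow (X z) \<alpha> ^ (k + 1) * g j z)) \<le> K * Re (V z) powr (- (b * d))" by (simp add: t_def)
      qed
      show "norm (X (F z) $ j - lam $ j * X z $ j) \<le> K * (Re (V z) powr (-b))\<^sup>2" if j: "j \<notin> M" for j
      proof -
        have "norm (X (F z) $ j - lam $ j * X z $ j) \<le> C4 * norm z ^ 2"
          using C4(3) [of z j] z'(1) \<rho>_le XN [OF j] by simp
        also have "\<dots> \<le> C4 * (K0 * t powr (-b)) ^ 2"
          using nz C4(1) by (intro mult_left_mono power_mono) auto
        also have "\<dots> = C4 * K0\<^sup>2 * (t powr (-b))\<^sup>2" by (simp add: power_mult_distrib)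
        also have "\<dots> \<le> K * (t powr (-b))\<^sup>2" using K' by (intro mult_right_mono) auto
        finally show ?thesis by (simp add: t_def)
      qed
    qed
    then show ?thesis using nF z' by (simp add: P_def petal_def t_def u_def)
  qed
  have contu: "isCont u z" if "norm z < \<rho>" for z
    unfolding u_def by (rule continuous_mi_pow [OF contX [OF that]])
  have u0: "u 0 = 0"
  proof -
    obtain i where "\<alpha> $ i \<noteq> 0" using \<alpha>(2) unfolding mi_deg_def by (metis not_one_le_zero sum.neutral)
    then show ?thesis using mi_pow_le_component [of "X 0" \<alpha> i] by (simp add: u_def X0)
  qed
  \<comment> \<open>Near 0 the monomial \<open>u\<close> is small, hence \<open>|V|\<close> large,
    and in the sector \<open>|V| \<le> 2 * Re V\<close>.\<close>
  have large: "\<exists>r>0. \<forall>z\<in>P c R0. norm z < r \<longrightarrow> Re (V z) > R" for c R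
  proof -
    define R' where "R' = max R 1"
    have "(u \<longlongrightarrow> u 0) (nhds 0)"
      using contu [of 0] \<rho> by (simp add: isCont_def tendsto_at_iff_tendsto_nhds)
    then have "((\<lambda>z. norm (of_nat k * \<Lambda> * u z ^ k)) \<longlongrightarrow> norm (of_nat k * \<Lambda> * u 0 ^ k)) (nhds 0)"
      by (intro tendsto_intros)
    then have "\<forall>\<^sub>F z in nhds 0. norm (of_nat k * \<Lambda> * u z ^ k) < 1 / (2 * R')"
      by (rule order_tendstoD(2)) (use k u0 in \<open>simp add: R'_def power_0_left\<close>)
    then obtain r where r: "r > 0" "\<And>z. norm z < r \<Longrightarrow> norm (of_nat k * \<Lambda> * u z ^ k) < 1 / (2 * R')"
      unfolding eventually_nhds_metric by auto
    have "Re (V z) > R" if z: "z \<in> P c R0" "norm z < r" for z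
    proof -
      have z': "Re (V z) > R0" "\<bar>Im (V z)\<bar> < \<epsilon> * Re (V z)" using z by (auto simp: P_def petal_def)
      then have V0: "V z \<noteq> 0" using R0 by auto
      have "1 / (2 * R') > norm (1 / V z)"
        using r(2) [OF z(2)] by (simp add: V_def fatou_coord_def norm_divide)
      then have "norm (V z) > 2 * R'"
        using V0 by (simp add: norm_divide R'_def field_simps)
      moreover have "norm (V z) \<le> 2 * Re (V z)"
      proof -
        have "\<epsilon> * Re (V z) \<le> 1/2 * Re (V z)" using \<epsilon> z' R0 by (intro mult_right_mono) auto
        then show ?thesis using cmod_le [of "V z"] z' R0 by linarith
      qed
      ultimately show ?thesis by (simp add: R'_def)
    qed
    then show ?thesis using r(1) by blast
  qed
  have derX: "((\<lambda>z. X z $ i) has_derivative (\<lambda>v. cc $ i * v $ i)) (at 0)" for i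
  proof -
    have "((\<lambda>z. (X z $ i - cc $ i * z $ i) + cc $ i * z $ i) has_derivative (\<lambda>v. 0 + cc $ i * v $ i)) (at 0)"
      using agX [of i]
      by (intro has_derivative_add ord_germs_2_derivative bounded_linear_imp_has_derivative
          bounded_linear_const_mult bounded_linear_vec_nth) (auto simp: agree_def numeral_2_eq_2)
    then show ?thesis by simp
  qed
  have VX: "V = (\<lambda>z. fatou_coord k \<Lambda> (mi_pow (X z) \<alpha>))" "u = (\<lambda>z. mi_pow (X z) \<alpha>)"
    by (auto simp: V_def u_def)
  show ?thesis
  proof (rule that [of "\<lambda>c. P c R0"])
    fix c :: complex assume c: "c ^ k = - 1 / (of_nat k * \<Lambda>)"
    show "basin_of_attraction F (P c R0) \<and> 0 \<in> frontier (P c R0)"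
    proof (rule petal_basin [OF P_def R0(1) b(1) _ _ step size' K0 large])
      have "V = (\<lambda>z. fatou_coord k \<Lambda> (u z))" by (auto simp: V_def)
      then show "open (P c R0)"
        unfolding P_def using open_petal [OF k \<Lambda>(2) _ contX contu] R0 by simp
      show "\<exists>z\<in>P c R0. norm z < e" if "e > 0" for e
        unfolding P_def VX
        by (rule normal_form_accumulates [OF k \<Lambda>(2) \<alpha> contX \<rho> derX X0 cc b(1,3) \<epsilon>(1) c that R0(1)])
    qed
  next
    show "P c R0 \<inter> P c' R0 = {}" if "c \<noteq> c'" for c c'
      unfolding P_def by (rule petal_disjoint [OF that])
  qed
qed

section \<open>Choice of the constants and the count of the petals\<close>

theorem theorem1p1:
  fixes F :: "complex ^ ('n :: {finite, linorder}) \<Rightarrow> complex ^ ('n :: {finite, linorder})"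
    and lam :: "complex ^ ('n :: {finite, linorder})"
    and m k :: nat and \<alpha> :: "nat ^ ('n :: {finite, linorder})"
  assumes "holomorphic_diffeo_germ F"
    and "(F has_derivative (\<lambda>v. \<chi> i. lam $ i * v $ i)) (at 0)"
    and "1 \<le> m" and "m \<le> CARD('n)"
    and "one_resonant lam (first_indices m) \<alpha>"
    and "nondegenerate F lam (first_indices m) \<alpha>"
    and "parabolically_attracting F lam (first_indices m) \<alpha>"
    and "\<And>j. j \<notin> first_indices m \<Longrightarrow> norm (lam $ j) < 1"
    and "k = res_order F lam (first_indices m) \<alpha>"
  shows "\<exists>U :: nat \<Rightarrow> (complex ^ ('n :: {finite, linorder})) set.
    (\<forall>h\<in>{1..k}. basin_of_attraction F (U h) \<and> 0 \<in> frontier (U h)) \<and>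
    disjoint_family_on U {1..k}"
proof -
  define M where "M = (first_indices m :: 'n set)"
  obtain G where "biholomorphic_germs F G"
    using assms(1) by (auto simp: holomorphic_diffeo_germ_def)
  then obtain D where F: "holomorphic_map_on F D" "0 \<in> D" "F 0 = 0"
    by (auto simp: biholomorphic_germs_def)
  obtain a where lf: "has_leading_form F lam M \<alpha> k a" and lam: "\<And>j. j \<in> M \<Longrightarrow> norm (lam $ j) = 1"
    and pos: "\<And>j. j \<in> M \<Longrightarrow> Re (a $ j * inverse (lam $ j) * inverse (Lambda_coeff lam M \<alpha> a)) > 0"
    using assms(7,9) unfolding parabolically_attracting_def M_def by blast
  have k: "k \<ge> 1" and "\<exists>j\<in>M. a $ j \<noteq> 0" using lf by (auto simp: has_leading_form_def)
  then have ne: "M \<noteq> {}" by auto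
  have res: "one_resonant lam M \<alpha>" and N: "\<And>j. j \<notin> M \<Longrightarrow> norm (lam $ j) < 1"
    using assms(5,8) by (auto simp: M_def)
  define \<Lambda> where "\<Lambda> = (\<Sum>j\<in>M. a $ j * of_nat (\<alpha> $ j) / lam $ j)"
  define p where "p j = a $ j / (lam $ j * \<Lambda>)" for j
  have Re_p: "Re (p j) > 0" if "j \<in> M" for j
    using pos [OF that] by (simp add: p_def \<Lambda>_def Lambda_coeff_def divide_inverse mult.assoc)
  \<comment> \<open>For \<open>\<Lambda> = 0\<close> division by zero would make every
    \<open>p j\<close> zero, contradicting the positive real part.\<close>
  have \<Lambda>0: "\<Lambda> \<noteq> 0" using ne Re_p by (force simp: p_def)
  have lam0: "lam $ j \<noteq> 0" if "j \<in> M" for j using lam [OF that] by auto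
  have lam\<alpha>: "mi_pow lam \<alpha> = 1" using ne one_resonant_eigenvalue [OF res] lam0 by blast
  have \<alpha>: "\<And>j. j \<notin> M \<Longrightarrow> \<alpha> $ j = 0" "mi_deg \<alpha> \<ge> 1"
    using one_resonant_off [OF res] one_resonant_deg [OF res] by auto
  have Flin: "agree 1 (\<lambda>z. F z $ i) (\<lambda>z. lam $ i * z $ i)" for i
    using bounded_linear.has_derivative [OF bounded_linear_vec_nth assms(2), of i] F(3)
    by (intro agree_linear holomorphic_germ_component [OF F(1,2)]) auto
  \<comment> \<open>The factor 8 is generous: the dynamics needs
    \<open>4 * b * k \<le> Re (p j)\<close>, and the strict inequality
    \<open>b * (k * mi_deg \<alpha>) < 1\<close> also results.\<close>
  define b where "b = min 1 (Min ((\<lambda>j. Re (p j)) ` M) / (8 * k))"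
  \<comment> \<open>An aperture this small keeps \<open>Re (p j / V)\<close> at half of
    \<open>Re (p j) / Re V\<close> or more.\<close>
  define \<epsilon> where "\<epsilon> = min (1/2) (Min ((\<lambda>j. Re (p j) / (4 * norm (p j))) ` M))"
  have np: "norm (p j) > 0" if "j \<in> M" for j using Re_p [OF that] by auto
  have b: "0 < b" "b \<le> 1" using ne Re_p k by (auto simp: b_def)
  have \<epsilon>: "0 < \<epsilon>" "\<epsilon> \<le> 1/2" using ne Re_p np by (auto simp: \<epsilon>_def)
  have bp: "8 * b * k \<le> Re (p j)" if "j \<in> M" for j
  proof -
    have "b \<le> Min ((\<lambda>j. Re (p j)) ` M) / (8 * k)" by (simp add: b_def)
    also have "\<dots> \<le> Re (p j) / (8 * k)" using that by (intro divide_right_mono) auto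
    finally show ?thesis using k by (simp add: field_simps)
  qed
  have \<epsilon>p: "\<epsilon> * norm (p j) \<le> Re (p j) / 4" if "j \<in> M" for j
  proof -
    have "\<epsilon> \<le> Min ((\<lambda>j. Re (p j) / (4 * norm (p j))) ` M)" by (simp add: \<epsilon>_def)
    also have "\<dots> \<le> Re (p j) / (4 * norm (p j))" using that by auto
    finally show ?thesis using np [OF that] by (simp add: field_simps)
  qed
  have bk: "b * (k * mi_deg \<alpha>) < 1"
  proof -
    \<comment> \<open>The definition of \<open>\<Lambda>\<close> normalizes the
      \<open>\<alpha>\<close>-weighted sum of the \<open>p j\<close> to 1; inserting
      \<open>8 * b * k \<le> Re (p j)\<close> then bounds \<open>b * (k * mi_deg \<alpha>)\<close>
      by 1/8.\<close>
    have "(\<Sum>j\<in>M. of_nat (\<alpha> $ j) * p j) = (\<Sum>j\<in>M. a $ j * of_nat (\<alpha> $ j) / lam $ j) / \<Lambda>"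
      unfolding sum_divide_distrib by (rule sum.cong) (simp_all add: p_def)
    also have "\<dots> = 1" unfolding \<Lambda>_def [symmetric] using \<Lambda>0 by simp
    finally have "Re (\<Sum>j\<in>M. of_nat (\<alpha> $ j) * p j) = 1" by simp
    then have one: "(\<Sum>j\<in>M. real (\<alpha> $ j) * Re (p j)) = 1" by simp
    have "mi_deg \<alpha> = (\<Sum>j\<in>M. \<alpha> $ j)"
      unfolding mi_deg_def by (rule sum.mono_neutral_right) (use \<alpha>(1) in auto)
    then have "8 * b * k * mi_deg \<alpha> = (\<Sum>j\<in>M. real (\<alpha> $ j) * (8 * b * k))"
      by (simp only: of_nat_sum sum_distrib_right [symmetric] mult.commute)
    also have "\<dots> \<le> (\<Sum>j\<in>M. real (\<alpha> $ j) * Re (p j))"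
      by (intro sum_mono mult_left_mono bp) auto
    finally have "8 * (b * (k * mi_deg \<alpha>)) \<le> 1" unfolding one by (simp add: mult.assoc)
    then show ?thesis by linarith
  qed
  \<comment> \<open>\<open>3 / b\<close> makes the remainder at most of size
    \<open>t powr (-3)\<close> on the petals; the other entry is the order at which normalization
    starts.\<close>
  define d where "d = max (mi_deg \<alpha> * k + 2) (nat \<lceil>3 / b\<rceil>)"
  have "3 / b \<le> d" unfolding d_def by linarith
  then have d: "b * d \<ge> 3" "d \<ge> mi_deg \<alpha> * k + 2"
    using b by (simp_all add: field_simps d_def)
  obtain cc where cc: "\<And>i. cc $ i \<noteq> 0"
    and "\<exists>X g. normal_form F lam M \<alpha> k a cc (mi_deg \<alpha> * k + 2) X g"
    using leading_form_normal_form [OF F assms(2) res lf lam N] by blast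
  then obtain X g where nf: "normal_form F lam M \<alpha> k a cc d X g"
    using normal_form_exists [OF F Flin _ \<alpha>(2) k cc _ d(2)] one_resonant_cases [OF res] by blast
  obtain W where W: "\<And>c. c ^ k = - 1 / (of_nat k * \<Lambda>) \<Longrightarrow> basin_of_attraction F (W c) \<and> 0 \<in> frontier (W c)"
    "\<And>c c'. c \<noteq> c' \<Longrightarrow> W c \<inter> W c' = {}"
  proof (rule normal_form_basins [OF F Flin k \<Lambda>_def \<Lambda>0 lam lam\<alpha> N \<alpha> cc nf b bk d(1) \<epsilon>])
    fix j assume j: "j \<in> M"
    show "\<epsilon> * norm (a $ j / (lam $ j * \<Lambda>)) \<le> Re (a $ j / (lam $ j * \<Lambda>)) / 4"
      using \<epsilon>p [OF j] by (simp add: p_def)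
    have "4 * b * k \<le> 8 * b * k" using b by (intro mult_right_mono) auto
    then show "4 * b * k \<le> Re (a $ j / (lam $ j * \<Lambda>))"
      using bp [OF j] by (simp add: p_def)
  next
    fix W
    assume "\<And>c. c ^ k = - 1 / (of_nat k * \<Lambda>) \<Longrightarrow> basin_of_attraction F (W c) \<and> 0 \<in> frontier (W c)"
      and "\<And>c c'. c \<noteq> c' \<Longrightarrow> W c \<inter> W c' = {}"
    then show ?thesis by (rule that)
  qed
  \<comment> \<open>The labels of the petals: a nonzero number has exactly \<open>k\<close> distinct
    \<open>k\<close>-th roots.\<close>
  define C where "C = {c. c ^ k = - 1 / (of_nat k * \<Lambda>)}"
  have "finite C" "card C = k"
    unfolding C_def using k \<Lambda>0 by (auto intro!: finite_nth_roots card_nth_roots)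
  then obtain h where h: "bij_betw h {1..k} C"
    using ex_bij_betw_nat_finite_1 [of C] by auto
  show ?thesis
  proof (intro exI [of _ "W \<circ> h"] conjI ballI)
    fix i assume "i \<in> {1..k}"
    then have "h i \<in> C" using bij_betw_apply [OF h] by blast
    then show "basin_of_attraction F ((W \<circ> h) i)" "0 \<in> frontier ((W \<circ> h) i)"
      using W(1) [of "h i"] by (auto simp: C_def)
  next
    show "disjoint_family_on (W \<circ> h) {1..k}"
      unfolding disjoint_family_on_def
    proof (intro ballI impI)
      fix i j assume "i \<in> {1..k}" "j \<in> {1..k}" "i \<noteq> j"
      then have "h i \<noteq> h j" using h by (meson bij_betw_imp_inj_on inj_onD)
      then show "(W \<circ> h) i \<inter> (W \<circ> h) j = {}" using W(2) by simp
    qed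
  qed
qed

end
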